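(* (i) Let $f\in\partial\Sigma_4$ be strictly positive. Then the normal cone $N_f(\Sigma_4)$ is a ray. Moreover $f$ has, up to orthogonal equivalence, exactly one sum of squares representation over $\mathbb{R}$, and this representation has length $4$: $f=p_1^2+p_2^2+p_3^2+p_4^2$ with linearly independent $p_1,\dots,p_4\in A_2$. If $I\subset A$ denotes the ideal generated by $p_1,\dots,p_4$, then $A/I$ is a Gorenstein graded algebra with socle degree $4$. (ii) Let $f\in\Sigma_4$ be a strictly positive form with coefficients in $\mathbb{Q}$. If $f$ fails to be a sum of squares of polynomials in $\mathbb{Q}[x_1,x_2,x_3,x_4]$, then $f$ lies in the boundary $\partial\Sigma_4$ of $\Sigma_4$, and $f$ is a singular point of the hypersurface $V$.
   Context: Let $A=\mathbb{R}[x_1,x_2,x_3,x_4]=\bigoplus_{d\ge0}A_d$ with the standard grading. $\Sigma_4\subset A_4$ is the closed convex cone of all sums of squares of forms in $A_2$; its boundary $\partial\Sigma_4$ is taken in the finite-dimensional real vector space $A_4$. A form $f\in A$ is strictly positive if $f(a)>0$ for all $0\ne a\in\mathbb{R}^4$. Let $A_4^\vee=\mathrm{Hom}(A_4,\mathbb{R})$ and $\Sigma_4^*=\{\alpha\in A_4^\vee:\alpha(g)\ge0\text{ for all }g\in\Sigma_4\}$. For $f\in\Sigma_4$ the normal cone is $N_f(\Sigma_4)=\{\alpha\in\Sigma_4^*:\alpha(f)=0\}$. It is a ray if it equals $\mathbb{R}_{+}\alpha=\{c\alpha: c\ge0\}$ for some $\alpha\ne0$. Two sum of squares representations $f=\sum_{i=1}^rp_i^2=\sum_{i=1}^rq_i^2$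 with $p_i,q_i\in A_2$ (made of the same length by adding zero summands) are orthogonally equivalent if there is an orthogonal real $r\times r$ matrix $(a_{ij})$ with $q_i=\sum_{j}a_{ij}p_j$ for all $i$. $V\subset A_4$ is the Zariski closure of the set of all sums of four squares of forms in $A_2$. It is known that $V$ is an irreducible hypersurface in $A_4$ (one of the two irreducible components of the Zariski closure of $\partial\Sigma_4$), i.e. the zero set of an irreducible homogeneous polynomial $F$ in the coefficients of a quaternary quartic, generating the vanishing ideal of $V$. A point $f\in V$ is singular if all first partial derivatives of $F$ vanish at $f$. *)

theory Defs
  imports
    "HOL-Analysis.Analysis"
    "HOL-Library.Poly_Mapping"
    "HOL-Computational_Algebra.Factorial_Ring"
begin

section \<open>Multivariate polynomials\<close>

text \<open>
  Monomials are exponent vectors \<^typ>\<open>'v \<Rightarrow>\<^sub>0 nat\<close>; with the convolution product of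
  \<^theory>\<open>HOL-Library.Poly_Mapping\<close> the type below is the polynomial ring over \<^typ>\<open>'a\<close> with
  variables indexed by \<^typ>\<open>'v\<close>.
\<close>

type_synonym ('v, 'a) mpoly = "('v \<Rightarrow>\<^sub>0 nat) \<Rightarrow>\<^sub>0 'a"

instantiation poly_mapping :: (type, real_vector) real_vector
begin

definition scaleR_poly_mapping :: "real \<Rightarrow> ('a \<Rightarrow>\<^sub>0 'b) \<Rightarrow> 'a \<Rightarrow>\<^sub>0 'b" where
  "scaleR_poly_mapping c p = Poly_Mapping.map ((*\<^sub>R) c) p"

lemma lookup_scaleR [simp]: "Poly_Mapping.lookup (c *\<^sub>R p) k = c *\<^sub>R Poly_Mapping.lookup p k"
  for p :: "'a \<Rightarrow>\<^sub>0 'b"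
  by (simp add: scaleR_poly_mapping_def map.rep_eq when_def)

instance
  by standard
    (auto intro!: poly_mapping_eqI simp: lookup_add scaleR_add_left scaleR_add_right)

end

definition mon_degree :: "('v::finite \<Rightarrow>\<^sub>0 nat) \<Rightarrow> nat" where
  "mon_degree m = (\<Sum>v\<in>UNIV. Poly_Mapping.lookup m v)"

definition forms :: "nat \<Rightarrow> ('v::finite, 'a::zero) mpoly set" where
  "forms d = {p. \<forall>m\<in>Poly_Mapping.keys p. mon_degree m = d}"

definition variable :: "'v \<Rightarrow> ('v, 'a::zero_neq_one) mpoly" where
  "variable v = Poly_Mapping.single (Poly_Mapping.single v 1) 1"

definition mpoly_eval :: "('v::finite, 'a::comm_semiring_1) mpoly \<Rightarrow> ('v \<Rightarrow> 'a) \<Rightarrow> 'a" where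
  "mpoly_eval p x =
    (\<Sum>m\<in>Poly_Mapping.keys p. Poly_Mapping.lookup p m * (\<Prod>v\<in>UNIV. x v ^ Poly_Mapping.lookup m v))"

text \<open>
  In the partial derivative, the truncated subtraction on exponents only occurs in terms
  whose coefficient is zero.
\<close>

definition mpoly_pderiv :: "'v \<Rightarrow> ('v, 'a::comm_semiring_1) mpoly \<Rightarrow> ('v, 'a) mpoly" where
  "mpoly_pderiv v p =
    (\<Sum>m\<in>Poly_Mapping.keys p.
      Poly_Mapping.single (m - Poly_Mapping.single v 1)
        (of_nat (Poly_Mapping.lookup m v) * Poly_Mapping.lookup p m))"

abbreviation ideal_generated :: "'a::comm_ring_1 set \<Rightarrow> 'a set" where
  "ideal_generated \<equiv> module.span (*)"


section \<open>Quaternary forms and sums of squares\<close>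

type_synonym quaternary = "(4, real) mpoly"

definition strictly_positive :: "quaternary \<Rightarrow> bool" where
  "strictly_positive f \<longleftrightarrow> (\<forall>a :: real ^ 4. a \<noteq> 0 \<longrightarrow> mpoly_eval f (\<lambda>i. a $ i) > 0)"

definition rational_coeffs :: "quaternary \<Rightarrow> bool" where
  "rational_coeffs p \<longleftrightarrow> (\<forall>m. Poly_Mapping.lookup p m \<in> \<rat>)"

definition sos_rep :: "quaternary \<Rightarrow> quaternary list \<Rightarrow> bool" where
  "sos_rep f ps \<longleftrightarrow> set ps \<subseteq> forms 2 \<and> f = (\<Sum>p\<leftarrow>ps. p\<^sup>2)"

definition Sigma4 :: "quaternary set" where
  "Sigma4 = {f. \<exists>ps. sos_rep f ps}"

definition rational_sos :: "quaternary \<Rightarrow> bool" where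
  "rational_sos f \<longleftrightarrow> (\<exists>ps. (\<forall>p\<in>set ps. rational_coeffs p) \<and> f = (\<Sum>p\<leftarrow>ps. p\<^sup>2))"

text \<open>
  The topology on \<open>A\<^sub>4\<close> is that of coefficientwise convergence. Since only finitely many
  coefficients of elements of \<open>A\<^sub>4\<close> are nonzero, it is the usual topology of this
  finite-dimensional space.
\<close>

definition A4_topology :: "quaternary topology" where
  "A4_topology = pullback_topology (forms 4) Poly_Mapping.lookup euclidean"

definition boundary_Sigma4 :: "quaternary set" where
  "boundary_Sigma4 = A4_topology frontier_of Sigma4"

text \<open>
  A linear functional on \<open>A\<^sub>4\<close> is identified with its extension to the whole polynomial ring
  by zero on all \<open>A\<^sub>d\<close> with \<open>d \<noteq> 4\<close>.
\<close>

definition A4_dual :: "(quaternary \<Rightarrow> real) set" where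
  "A4_dual = {\<alpha>. linear \<alpha> \<and> (\<forall>d. d \<noteq> 4 \<longrightarrow> (\<forall>p\<in>forms d. \<alpha> p = 0))}"

definition Sigma4_dual_cone :: "(quaternary \<Rightarrow> real) set" where
  "Sigma4_dual_cone = {\<alpha>\<in>A4_dual. \<forall>g\<in>Sigma4. \<alpha> g \<ge> 0}"

definition normal_cone :: "quaternary \<Rightarrow> (quaternary \<Rightarrow> real) set" where
  "normal_cone f = {\<alpha>\<in>Sigma4_dual_cone. \<alpha> f = 0}"

definition is_ray :: "(quaternary \<Rightarrow> real) set \<Rightarrow> bool" where
  "is_ray N \<longleftrightarrow> (\<exists>\<alpha>\<in>A4_dual. \<alpha> \<noteq> (\<lambda>_. 0) \<and> N = {\<lambda>p. c * \<alpha> p | c. c \<ge> 0})"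

definition pad :: "nat \<Rightarrow> quaternary list \<Rightarrow> quaternary list" where
  "pad r ps = ps @ replicate (r - length ps) 0"

definition orthogonal_mat :: "nat \<Rightarrow> (nat \<Rightarrow> nat \<Rightarrow> real) \<Rightarrow> bool" where
  "orthogonal_mat r a \<longleftrightarrow>
    (\<forall>i<r. \<forall>j<r. (\<Sum>k<r. a i k * a j k) = (if i = j then 1 else 0)) \<and>
    (\<forall>i<r. \<forall>j<r. (\<Sum>k<r. a k i * a k j) = (if i = j then 1 else 0))"

definition orthogonally_equivalent :: "quaternary list \<Rightarrow> quaternary list \<Rightarrow> bool" where
  "orthogonally_equivalent ps qs \<longleftrightarrow>
    (let r = max (length ps) (length qs) in
      \<exists>a. orthogonal_mat r a \<and> (\<forall>i<r. pad r qs ! i = (\<Sum>j<r. a i j *\<^sub>R pad r ps ! j)))"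


section \<open>Gorenstein graded algebras\<close>

definition homogeneous_ideal :: "('v::finite, real) mpoly set \<Rightarrow> bool" where
  "homogeneous_ideal I \<longleftrightarrow> I = ideal_generated (I \<inter> (\<Union>d. forms d))"

text \<open>
  The preimage in the polynomial ring \<open>A\<close> of the socle of \<open>A/I\<close>, i.e. of the annihilator of
  the maximal ideal generated by the variables.
\<close>

definition socle_preimage :: "('v::finite, real) mpoly set \<Rightarrow> ('v, real) mpoly set" where
  "socle_preimage I = {a. \<forall>v. variable v * a \<in> I}"

text \<open>
  \<open>A/I\<close> is an (Artinian) Gorenstein graded algebra with socle degree \<open>d\<close>: the ideal \<open>I\<close> is
  homogeneous, \<open>A/I\<close> has finite dimension over the reals, and the socle of \<open>A/I\<close> is
  one-dimensional, spanned by the class of a form of degree \<open>d\<close>. Here \<^term>\<open>span\<close> is the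
  real linear span.
\<close>

definition gorenstein_quotient :: "('v::finite, real) mpoly set \<Rightarrow> nat \<Rightarrow> bool" where
  "gorenstein_quotient I d \<longleftrightarrow>
    homogeneous_ideal I \<and>
    (\<exists>B. finite B \<and> span (B \<union> I) = UNIV) \<and>
    (\<exists>s\<in>forms d. s \<notin> I \<and> socle_preimage I = span (insert s I))"


section \<open>The hypersurface of sums of four squares\<close>

text \<open>
  The coefficients of a quaternary quartic are indexed by the 35 monomials of degree 4;
  the coordinate ring of \<open>A\<^sub>4\<close> is the polynomial ring in variables indexed by this type.
\<close>

typedef quartic_mon = "{m :: 4 \<Rightarrow>\<^sub>0 nat. mon_degree m = 4}"
  morphisms exponents quartic_mon_of
proof
  show "Poly_Mapping.single 1 4 \<in> {m :: 4 \<Rightarrow>\<^sub>0 nat. mon_degree m = 4}"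
    by (simp add: mon_degree_def lookup_single when_def)
qed

lemma finite_mon_degree: "finite {m :: 'v::finite \<Rightarrow>\<^sub>0 nat. mon_degree m = d}"
proof -
  have "Poly_Mapping.lookup m \<in> UNIV \<rightarrow>\<^sub>E {..d}" if "mon_degree m = d" for m :: "'v \<Rightarrow>\<^sub>0 nat"
  proof -
    have "Poly_Mapping.lookup m v \<le> mon_degree m" for v
      unfolding mon_degree_def by (rule member_le_sum) auto
    with that show ?thesis by auto
  qed
  then have "Poly_Mapping.lookup ` {m :: 'v \<Rightarrow>\<^sub>0 nat. mon_degree m = d} \<subseteq> UNIV \<rightarrow>\<^sub>E {..d}"
    by auto
  then have "finite (Poly_Mapping.lookup ` {m :: 'v \<Rightarrow>\<^sub>0 nat. mon_degree m = d})"
    by (rule finite_subset) (simp add: finite_PiE)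
  then show ?thesis
    by (rule finite_imageD) (simp add: inj_on_def)
qed

instance quartic_mon :: finite
proof
  have "UNIV = quartic_mon_of ` {m. mon_degree m = 4}"
    using type_definition.Abs_image[OF type_definition_quartic_mon] by simp
  then show "finite (UNIV :: quartic_mon set)"
    by (metis finite_imageI finite_mon_degree)
qed

definition eval_at_quartic :: "(quartic_mon, real) mpoly \<Rightarrow> quaternary \<Rightarrow> real" where
  "eval_at_quartic F f = mpoly_eval F (\<lambda>m. Poly_Mapping.lookup f (exponents m))"

definition zero_set :: "(quartic_mon, real) mpoly set \<Rightarrow> quaternary set" where
  "zero_set J = {f\<in>forms 4. \<forall>G\<in>J. eval_at_quartic G f = 0}"

definition vanishing_ideal :: "quaternary set \<Rightarrow> (quartic_mon, real) mpoly set" where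
  "vanishing_ideal S = {G. \<forall>f\<in>S. eval_at_quartic G f = 0}"

definition four_squares_variety :: "quaternary set" where
  "four_squares_variety = zero_set (vanishing_ideal {f. \<exists>ps. length ps = 4 \<and> sos_rep f ps})"

definition hypersurface_equation ::
    "quaternary set \<Rightarrow> (quartic_mon, real) mpoly \<Rightarrow> bool" where
  "hypersurface_equation V F \<longleftrightarrow>
    irreducible F \<and> (\<exists>d. F \<in> forms d) \<and> V = zero_set {F} \<and>
    vanishing_ideal V = ideal_generated {F}"

definition singular_point :: "(quartic_mon, real) mpoly \<Rightarrow> quaternary \<Rightarrow> bool" where
  "singular_point F f \<longleftrightarrow>
    eval_at_quartic F f = 0 \<and> (\<forall>m. eval_at_quartic (mpoly_pderiv m F) f = 0)"

end

theory Submission imports Defs begin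

text \<open>
  A boundary form \<open>f\<close> is annihilated by a nonzero functional \<open>v\<close> that is nonnegative on squares. Its
  kernel \<open>W\<close>, the radical of the quadratic form \<open>v(q\<^sup>2)\<close> on quadrics, contains every \<open>p\<^sub>i\<close> with
  \<open>f = \<Sum>p\<^sub>i\<^sup>2\<close>, hence has no real zero. If the functionals vanishing on \<open>W A\<^sub>2\<close> do not form a line,
  moving \<open>v\<close> inside that space enlarges \<open>W\<close>. If they do, then \<open>dim W \<le> 4\<close>: otherwise \<open>A\<^sub>2/W\<close> is
  small, and the multiplication operators \<open>A\<^sub>1 \<rightarrow> A\<^sub>2/W \<cong> l A\<^sub>1\<close> (up to one extra dimension) yield
  either a common eigenvector, i.e. a real zero of \<open>W\<close>, or a second functional vanishing on \<open>W A\<^sub>2\<close>.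
  Three \<open>p\<^sub>i\<close> never suffice, by deforming the fourth element of \<open>W\<close> to the square of a linear form.
  So \<open>dim W = 4\<close> and the products of \<open>W\<close> with quadrics satisfy only the Koszul relations,
  which gives uniqueness of the normal direction and of the Gram matrix, and the Gorenstein property.

  For rational \<open>f\<close>, interior forms are rational sums of squares by approximation. At a boundary point
  that is regular on the hypersurface, the gradient of its equation spans the normal line, so \<open>W\<close> has
  a rational basis close to \<open>p\<^sub>1, \<dots>, p\<^sub>4\<close>; in this basis \<open>f\<close> has a rational Gram matrix near the
  identity and is a sum of squares over the rationals.
\<close>

section \<open>Evaluation and homogeneous forms\<close>

text \<open>Three counts carry the argument. Quadrics have dimension 10 and quartics 35; four
  quadrics have at most 10 + 9 + 8 + 7 = 34 independent products with quadrics, three have at most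
  27. So every four-dimensional W is annihilated by some functional, no three-dimensional W by just
  one line of them, and if the line is unique in dimension four then all 34 products are
  independent. This replaces exactness of the Koszul complex; complex zeros and intersection numbers
  never occur. The obstacle is a kernel of dimension 5 without linear forms m such that m A_1 lies
  in W. Multiplication by n followed by division by a generic l is then self-adjoint for the inner
  product v(l a l b) on linear forms, but l A_1 misses one dimension of A_2/W, so these operators
  commute only up to rank two. Their Jacobi identity controls the error. Rationality rests on one
  device: a Q-linear retraction of the reals onto the rationals that moves finitely many given
  numbers very little. It is applied to the coefficients of the hypersurface equation, to a basis of
  W, and to a Gram matrix.\<close>

lemma mpoly_eval_superset:
  assumes "finite K" "Poly_Mapping.keys p \<subseteq> K"
  shows "mpoly_eval p x = (\<Sum>m\<in>K. Poly_Mapping.lookup p m * (\<Prod>v\<in>UNIV. x v ^ Poly_Mapping.lookup m v))"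
  unfolding mpoly_eval_def using assms
  by (intro sum.mono_neutral_left) (auto simp: in_keys_iff)

lemma mpoly_eval_zero [simp]: "mpoly_eval 0 x = 0"
  by (simp add: mpoly_eval_def)

lemma mpoly_eval_single [simp]:
  "mpoly_eval (Poly_Mapping.single m c) x = c * (\<Prod>v\<in>UNIV. x v ^ Poly_Mapping.lookup m v)"
  by (subst mpoly_eval_superset[of "{m}"]) auto

lemma mpoly_eval_add [simp]: "mpoly_eval (p + q) x = mpoly_eval p x + mpoly_eval q x"
proof -
  let ?K = "Poly_Mapping.keys p \<union> Poly_Mapping.keys q"
  have "Poly_Mapping.keys (p + q) \<subseteq> ?K" by (rule keys_add)
  then show ?thesis
    by (simp add: mpoly_eval_superset[of ?K] lookup_add distrib_right sum.distrib)
qed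

lemma mpoly_eval_sum [simp]: "mpoly_eval (sum p I) x = (\<Sum>i\<in>I. mpoly_eval (p i) x)"
  by (induction I rule: infinite_finite_induct) auto

lemma poly_mapping_single_add_induct [case_names zero single add]:
  assumes "P 0" "\<And>m c. P (Poly_Mapping.single m c)" "\<And>p q. P p \<Longrightarrow> P q \<Longrightarrow> P (p + q)"
  shows "P (p :: 'a \<Rightarrow>\<^sub>0 'b::comm_monoid_add)"
proof -
  have fin: "P (\<Sum>m\<in>K. Poly_Mapping.single m (Poly_Mapping.lookup p m))" if "finite K" for K
    using that by induction (auto intro: assms)
  have "p = (\<Sum>m\<in>Poly_Mapping.keys p. Poly_Mapping.single m (Poly_Mapping.lookup p m))"
    by (rule poly_mapping_eqI) (auto simp: lookup_sum lookup_single when_def sum.delta in_keys_iff)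
  then show ?thesis
    using fin[OF finite_keys[of p]] by simp
qed

lemma mpoly_eval_mult [simp]: "mpoly_eval (p * q) x = mpoly_eval p x * mpoly_eval q x"
proof (induction p rule: poly_mapping_single_add_induct)
  case (single m c)
  show ?case
    by (induction q rule: poly_mapping_single_add_induct)
      (auto simp: mult_single lookup_add power_add prod.distrib algebra_simps)
qed (auto simp: distrib_right)

lemma mpoly_eval_power [simp]: "mpoly_eval (p ^ n) x = mpoly_eval p x ^ n"
proof (induction n)
  case 0
  show ?case
    unfolding power_0 single_one[symmetric] by (simp add: lookup_single_not_eq del: single_one)
qed auto

lemma mpoly_eval_scaleR [simp]: "mpoly_eval (c *\<^sub>R p) x = c * mpoly_eval p x"
  for p :: "('v::finite, real) mpoly"
proof -
  have "Poly_Mapping.keys (c *\<^sub>R p) \<subseteq> Poly_Mapping.keys p"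
    by (auto simp: in_keys_iff)
  then show ?thesis
    by (simp add: mpoly_eval_superset[of "Poly_Mapping.keys p"] sum_distrib_left mult.assoc)
qed

lemma mon_degree_add: "mon_degree (m + n) = mon_degree m + mon_degree n"
  by (simp add: mon_degree_def lookup_add sum.distrib)

lemma mon_degree_single [simp]: "mon_degree (Poly_Mapping.single v n) = n"
  by (simp add: mon_degree_def lookup_single when_def)

lemma forms_iff: "p \<in> forms d \<longleftrightarrow> (\<forall>m. mon_degree m \<noteq> d \<longrightarrow> Poly_Mapping.lookup p m = 0)"
  by (auto simp: forms_def in_keys_iff)

lemma forms_0 [simp]: "0 \<in> forms d"
  by (simp add: forms_iff)

lemma forms_add [intro]: "p \<in> forms d \<Longrightarrow> q \<in> forms d \<Longrightarrow> p + q \<in> forms d"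
  for p q :: "('v::finite, 'a::comm_monoid_add) mpoly"
  by (auto simp: forms_iff lookup_add)

lemma forms_scaleR [intro]: "p \<in> forms d \<Longrightarrow> c *\<^sub>R p \<in> forms d"
  for p :: "('v::finite, real) mpoly"
  by (auto simp: forms_iff)

lemma subspace_forms: "subspace (forms d :: ('v::finite, real) mpoly set)"
  by (auto simp: subspace_def)

lemma forms_sum [intro]: "(\<And>i. i \<in> I \<Longrightarrow> p i \<in> forms d) \<Longrightarrow> sum p I \<in> forms d"
  for p :: "'i \<Rightarrow> ('v::finite, 'a::comm_monoid_add) mpoly"
  by (induction I rule: infinite_finite_induct) auto

lemma forms_single [simp]: "mon_degree m = d \<Longrightarrow> Poly_Mapping.single m c \<in> forms d"
  by (auto simp: forms_iff lookup_single when_def)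

lemma forms_mult [intro]: "p \<in> forms d \<Longrightarrow> q \<in> forms e \<Longrightarrow> p * q \<in> forms (d + e)"
  for p q :: "('v::finite, 'a::semiring_0) mpoly"
  unfolding forms_def using keys_mult[of p q] by (fastforce simp: mon_degree_add)

lemma scaleR_mult_left: "c *\<^sub>R p * q = c *\<^sub>R (p * q)"
  for p q :: "('v, real) mpoly"
proof -
  have "c *\<^sub>R p = Poly_Mapping.single 0 c * p" for p :: "('v, real) mpoly"
    unfolding mult_map_scale_conv_mult[symmetric] scaleR_poly_mapping_def
    by (simp add: scaleR_conv_of_real[abs_def])
  then show ?thesis by (simp add: mult.assoc)
qed

lemma scaleR_mult_right: "p * (c *\<^sub>R q) = c *\<^sub>R (p * q)"
  for p q :: "('v, real) mpoly"
  using scaleR_mult_left[of c q p] by (simp add: mult.commute)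

subsection \<open>Coordinates\<close>

text \<open>The type \<open>'m\<close> indexes the monomials of a fixed degree through \<open>ex\<close>.\<close>

definition form_of :: "('m::finite \<Rightarrow> (4 \<Rightarrow>\<^sub>0 nat)) \<Rightarrow> real ^ 'm \<Rightarrow> quaternary" where
  "form_of ex x = (\<Sum>m\<in>UNIV. Poly_Mapping.single (ex m) (x $ m))"

definition coords :: "('m::finite \<Rightarrow> (4 \<Rightarrow>\<^sub>0 nat)) \<Rightarrow> quaternary \<Rightarrow> real ^ 'm" where
  "coords ex p = (\<chi> m. Poly_Mapping.lookup p (ex m))"

lemma linear_form_of: "linear (form_of ex)"
proof (rule linearI)
  show "form_of ex (x + y) = form_of ex x + form_of ex y" for x y
    by (simp add: form_of_def single_add sum.distrib)
  have "Poly_Mapping.single m (c * d) = c *\<^sub>R Poly_Mapping.single m d" for m :: "4 \<Rightarrow>\<^sub>0 nat" and c d :: real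
    by (rule poly_mapping_eqI) (auto simp: lookup_single when_def)
  then show "form_of ex (c *\<^sub>R x) = c *\<^sub>R form_of ex x" for c x
    by (simp add: form_of_def scaleR_sum_right)
qed

lemma linear_coords: "linear (coords ex)"
  by (rule linearI) (auto simp: coords_def lookup_add vec_eq_iff)

locale degree_index =
  fixes ex :: "'m::finite \<Rightarrow> (4 \<Rightarrow>\<^sub>0 nat)" and d :: nat
  assumes inj: "inj ex" and range: "range ex = {m. mon_degree m = d}"
begin

lemma lookup_form_of [simp]: "Poly_Mapping.lookup (form_of ex x) (ex m) = x $ m"
  by (simp add: form_of_def lookup_sum lookup_single when_def inj_eq[OF inj])

lemma form_of_forms [simp]: "form_of ex x \<in> forms d"
  unfolding form_of_def using range by (intro forms_sum forms_single) auto

lemma coords_form_of [simp]: "coords ex (form_of ex x) = x"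
  by (simp add: coords_def vec_eq_iff)

lemma form_of_coords: "p \<in> forms d \<Longrightarrow> form_of ex (coords ex p) = p"
proof (rule poly_mapping_eqI)
  fix m assume p: "p \<in> forms d"
  show "Poly_Mapping.lookup (form_of ex (coords ex p)) m = Poly_Mapping.lookup p m"
  proof (cases "mon_degree m = d")
    case True
    then obtain k where "m = ex k" using range by blast
    then show ?thesis by (simp add: coords_def)
  next
    case False
    then show ?thesis using p form_of_forms[of "coords ex p"] unfolding forms_iff by metis
  qed
qed

lemma inj_form_of: "inj (form_of ex)"
  by (metis coords_form_of injI)

lemma card_UNIV: "CARD('m) = card {m :: 4 \<Rightarrow>\<^sub>0 nat. mon_degree m = d}"
  using card_image[OF inj] range by simp

end

text \<open>Three exponents with sum at most \<open>d\<close> determine the fourth, which turns the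
  count into an explicit finite sum.\<close>

lemma card_mon_degree:
  "card {m :: 4 \<Rightarrow>\<^sub>0 nat. mon_degree m = d} =
    card (Set.filter (\<lambda>(a, b, c). a + b + c \<le> d) ({..d} \<times> {..d} \<times> {..d}))"
proof (rule bij_betw_same_card)
  let ?l = "Poly_Mapping.lookup :: (4 \<Rightarrow>\<^sub>0 nat) \<Rightarrow> 4 \<Rightarrow> nat"
  let ?g = "\<lambda>(a, b, c). Poly_Mapping.single (1::4) a + Poly_Mapping.single 2 b + Poly_Mapping.single 3 c
    + Poly_Mapping.single 4 (d - (a + b + c))"
  have dist: "(1::4) \<noteq> 2" "(1::4) \<noteq> 3" "(1::4) \<noteq> 4" "(2::4) \<noteq> 3" "(2::4) \<noteq> 4" "(3::4) \<noteq> 4"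
    by simp_all
  show "bij_betw (\<lambda>m. (?l m 1, ?l m 2, ?l m 3)) {m :: 4 \<Rightarrow>\<^sub>0 nat. mon_degree m = d}
      (Set.filter (\<lambda>(a, b, c). a + b + c \<le> d) ({..d} \<times> {..d} \<times> {..d}))"
  proof (rule bij_betw_byWitness[where f' = ?g], goal_cases)
    case 1
    have "?l (?g (?l m 1, ?l m 2, ?l m 3)) i = ?l m i" if "mon_degree m = d" for m i
    proof -
      have "i \<in> UNIV" by simp
      then have "i = 1 \<or> i = 2 \<or> i = 3 \<or> i = 4" unfolding UNIV_4 by blast
      then show ?thesis
        using that dist by (auto simp: lookup_add lookup_single mon_degree_def sum_4)
    qed
    then show ?case by (auto intro!: poly_mapping_eqI)
  next
    case 2
    show ?case using dist by (auto simp: lookup_add lookup_single)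
  next
    case 3
    show ?case by (auto simp: mon_degree_def sum_4)
  next
    case 4
    show ?case by (auto simp: mon_degree_add)
  qed
qed

lemma card_mon_degree_sum:
  "card {m :: 4 \<Rightarrow>\<^sub>0 nat. mon_degree m = d} = (\<Sum>a\<le>d. \<Sum>b\<le>d - a. Suc (d - a - b))"
proof -
  have "Set.filter (\<lambda>(a, b, c). a + b + c \<le> d) ({..d} \<times> {..d} \<times> {..d}) =
      (SIGMA a:{..d}. SIGMA b:{..d - a}. {..d - a - b})"
    by auto
  then show ?thesis unfolding card_mon_degree by simp
qed

lemma card_mon_degree_2: "card {m :: 4 \<Rightarrow>\<^sub>0 nat. mon_degree m = 2} = 10"
  unfolding card_mon_degree_sum by (simp add: eval_nat_numeral)

lemma card_mon_degree_3: "card {m :: 4 \<Rightarrow>\<^sub>0 nat. mon_degree m = 3} = 20"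
  unfolding card_mon_degree_sum by (simp add: eval_nat_numeral)

lemma card_mon_degree_4: "card {m :: 4 \<Rightarrow>\<^sub>0 nat. mon_degree m = 4} = 35"
  unfolding card_mon_degree_sum by (simp add: eval_nat_numeral)

typedef quad_mon = "{m :: 4 \<Rightarrow>\<^sub>0 nat. mon_degree m = 2}"
  morphisms quad_exps quad_mon_of
  by (rule exI[of _ "Poly_Mapping.single 1 2"]) simp

instance quad_mon :: finite
proof
  have "UNIV = quad_mon_of ` {m. mon_degree m = 2}"
    using type_definition.Abs_image[OF type_definition_quad_mon] by simp
  then show "finite (UNIV :: quad_mon set)"
    by (metis finite_imageI finite_mon_degree)
qed

definition lin_exps :: "4 \<Rightarrow> (4 \<Rightarrow>\<^sub>0 nat)" where
  "lin_exps i = Poly_Mapping.single i 1"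

interpretation i2: degree_index quad_exps 2
  by unfold_locales
    (auto simp: inj_def quad_exps_inject type_definition.Rep_range[OF type_definition_quad_mon])

interpretation i4: degree_index exponents 4
  by unfold_locales
    (auto simp: inj_def exponents_inject type_definition.Rep_range[OF type_definition_quartic_mon])

interpretation i1: degree_index lin_exps 1
proof
  show "inj lin_exps"
  proof (rule injI)
    fix i j assume "lin_exps i = lin_exps j"
    then have "Poly_Mapping.lookup (lin_exps i) i = Poly_Mapping.lookup (lin_exps j) i" by simp
    then show "i = j" by (simp add: lin_exps_def lookup_single when_def split: if_splits)
  qed
  have "m \<in> range lin_exps" if "mon_degree m = 1" for m :: "4 \<Rightarrow>\<^sub>0 nat"
  proof -
    have "(\<Sum>v\<in>UNIV. Poly_Mapping.lookup m v) = 1" using that by (simp add: mon_degree_def)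
    then obtain v where v: "Poly_Mapping.lookup m v = 1" "\<forall>w. w \<noteq> v \<longrightarrow> Poly_Mapping.lookup m w = 0"
      using sum_eq_1_iff[of UNIV "Poly_Mapping.lookup m"] by auto
    then have "m = Poly_Mapping.single v 1"
      by (intro poly_mapping_eqI) (auto simp: lookup_single when_def)
    then show ?thesis by (auto simp: lin_exps_def)
  qed
  then show "range lin_exps = {m. mon_degree m = 1}"
    by (auto simp: lin_exps_def)
qed

lemma CARD_quad_mon: "CARD(quad_mon) = 10"
  using i2.card_UNIV card_mon_degree_2 by simp

lemma CARD_quartic_mon: "CARD(quartic_mon) = 35"
  using i4.card_UNIV card_mon_degree_4 by simp

section \<open>Products of forms in coordinates\<close>

abbreviation lf :: "real ^ 4 \<Rightarrow> quaternary" where "lf \<equiv> form_of lin_exps"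
abbreviation qf :: "real ^ quad_mon \<Rightarrow> quaternary" where "qf \<equiv> form_of quad_exps"
abbreviation pf :: "real ^ quartic_mon \<Rightarrow> quaternary" where "pf \<equiv> form_of exponents"
abbreviation vec4 :: "quaternary \<Rightarrow> real ^ quartic_mon" where "vec4 \<equiv> coords exponents"

text \<open>Multiplication is moved to coordinate vectors so that dimension, orthogonality and
  compactness arguments can take place in Euclidean spaces.\<close>

definition m11 :: "real ^ 4 \<Rightarrow> real ^ 4 \<Rightarrow> real ^ quad_mon" where
  "m11 a b = coords quad_exps (lf a * lf b)"

definition m22 :: "real ^ quad_mon \<Rightarrow> real ^ quad_mon \<Rightarrow> real ^ quartic_mon" where
  "m22 x y = vec4 (qf x * qf y)"

lemma qf_m11 [simp]: "qf (m11 a b) = lf a * lf b"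
proof -
  have "lf a * lf b \<in> forms (1 + 1)" by (intro forms_mult i1.form_of_forms)
  then show ?thesis by (simp add: m11_def i2.form_of_coords numeral_2_eq_2)
qed

lemma pf_m22 [simp]: "pf (m22 x y) = qf x * qf y"
proof -
  have "qf x * qf y \<in> forms (2 + 2)" by (intro forms_mult) auto
  then show ?thesis by (simp add: m22_def i4.form_of_coords)
qed

lemma bilinear_m11: "bilinear m11"
  unfolding bilinear_def m11_def
  by (auto intro!: linearI simp: linear_add[OF linear_form_of] linear_cmul[OF linear_form_of]
      linear_add[OF linear_coords] linear_cmul[OF linear_coords] algebra_simps
      scaleR_mult_left scaleR_mult_right)

lemma bilinear_m22: "bilinear m22"
  unfolding bilinear_def m22_def
  by (auto intro!: linearI simp: linear_add[OF linear_form_of] linear_cmul[OF linear_form_of]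
      linear_add[OF linear_coords] linear_cmul[OF linear_coords] algebra_simps
      scaleR_mult_left scaleR_mult_right)

lemma m11_commute: "m11 a b = m11 b a"
  by (simp add: m11_def mult.commute)

lemma m22_commute: "m22 x y = m22 y x"
  by (simp add: m22_def mult.commute)

text \<open>The later arguments on kernels use the ring structure mostly through this exchange of
  factors; \<open>symmetric_form_from_functional\<close> is its converse.\<close>

lemma m22_swap: "m22 (m11 a b) (m11 c d) = m22 (m11 a c) (m11 b d)"
  by (simp add: m22_def mult_ac)

lemmas m11_simps = bilinear_ladd[OF bilinear_m11] bilinear_radd[OF bilinear_m11]
  bilinear_lmul[OF bilinear_m11] bilinear_rmul[OF bilinear_m11]
  bilinear_lzero[OF bilinear_m11] bilinear_rzero[OF bilinear_m11]
  bilinear_lsub[OF bilinear_m11] bilinear_rsub[OF bilinear_m11]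
  bilinear_lneg[OF bilinear_m11] bilinear_rneg[OF bilinear_m11]

lemmas m22_simps = bilinear_ladd[OF bilinear_m22] bilinear_radd[OF bilinear_m22]
  bilinear_lmul[OF bilinear_m22] bilinear_rmul[OF bilinear_m22]
  bilinear_lzero[OF bilinear_m22] bilinear_rzero[OF bilinear_m22]
  bilinear_lsub[OF bilinear_m22] bilinear_rsub[OF bilinear_m22]
  bilinear_lneg[OF bilinear_m22] bilinear_rneg[OF bilinear_m22]

lemma linear_m11_right: "linear (m11 a)" and linear_m22_right: "linear (m22 x)"
  using bilinear_m11 bilinear_m22 by (auto simp: bilinear_def)

lemma lf_axis: "lf (axis i 1) = Poly_Mapping.single (lin_exps i) 1"
  by (simp add: form_of_def axis_def if_distrib sum.delta cong: if_cong)

lemma qf_axis: "qf (axis m 1) = Poly_Mapping.single (quad_exps m) 1"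
  by (simp add: form_of_def axis_def if_distrib sum.delta cong: if_cong)

lemma pf_axis: "pf (axis m 1) = Poly_Mapping.single (exponents m) 1"
  by (simp add: form_of_def axis_def if_distrib sum.delta cong: if_cong)

lemma monomial_split:
  assumes "mon_degree (m :: 4 \<Rightarrow>\<^sub>0 nat) = Suc d"
  obtains i n where "m = lin_exps i + n" "mon_degree n = d"
proof -
  obtain i where i: "Poly_Mapping.lookup m i > 0"
  proof (rule ccontr)
    assume "\<not> thesis"
    with that have "Poly_Mapping.lookup m i = 0" for i by blast
    then show False using assms by (simp add: mon_degree_def)
  qed
  have "m = lin_exps i + (m - lin_exps i)"
    by (rule poly_mapping_eqI) (use i in \<open>auto simp: lookup_add lookup_minus lin_exps_def lookup_single when_def\<close>)
  moreover from this have "mon_degree (m - lin_exps i) = d"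
    using assms mon_degree_add[of "lin_exps i" "m - lin_exps i"] by (simp add: lin_exps_def)
  ultimately show ?thesis using that by blast
qed

lemma m11_axis:
  assumes "quad_exps m = lin_exps i + lin_exps j"
  shows "m11 (axis i 1) (axis j 1) = axis m 1"
  by (rule injD[OF i2.inj_form_of]) (simp add: lf_axis qf_axis mult_single assms)

lemma m22_axis:
  assumes "exponents m = quad_exps n + quad_exps k"
  shows "m22 (axis n 1) (axis k 1) = axis m 1"
  by (rule injD[OF i4.inj_form_of]) (simp add: qf_axis pf_axis mult_single assms)

lemma quad_exps_split: "\<exists>i j. quad_exps m = lin_exps i + lin_exps j"
proof -
  have "mon_degree (quad_exps m) = Suc (Suc 0)" using quad_exps by (auto simp: numeral_2_eq_2)
  then obtain i n where n: "quad_exps m = lin_exps i + n" "mon_degree n = Suc 0" by (rule monomial_split)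
  then have "n \<in> range lin_exps" using i1.range by auto
  then show ?thesis using n by auto
qed

lemma exponents_split: "\<exists>n k. exponents m = quad_exps n + quad_exps k"
proof -
  have "mon_degree (exponents m) = Suc (Suc 2)" using exponents by (auto simp: eval_nat_numeral)
  then obtain i n where n: "exponents m = lin_exps i + n" "mon_degree n = Suc 2" by (rule monomial_split)
  from n(2) obtain j k where k: "n = lin_exps j + k" "mon_degree k = 2" by (rule monomial_split)
  then have "k \<in> range quad_exps" "lin_exps i + lin_exps j \<in> range quad_exps"
    using i2.range by (auto simp: mon_degree_add lin_exps_def)
  then show ?thesis using n k by (metis add.assoc rangeE)
qed

lemma m22_axis_obtain: obtains n k where "m22 (axis n 1) (axis k 1) = axis m 1"
  using exponents_split[of m] m22_axis by blast

lemma m11_axis_obtain: obtains i j where "m11 (axis i 1) (axis j 1) = axis m 1"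
  using quad_exps_split[of m] m11_axis by blast

lemma span_eq_UNIV_axis:
  assumes "\<And>i. axis i 1 \<in> span (S :: (real ^ 'n) set)"
  shows "span S = UNIV"
proof -
  have "Basis \<subseteq> span S" using assms by (auto simp: Basis_vec_def)
  then show ?thesis by (metis UNIV_I span_Basis span_minimal subspace_span subset_antisym top_greatest)
qed

lemma span_m11: "span {m11 a b | a b. True} = UNIV"
proof (rule span_eq_UNIV_axis)
  fix m :: quad_mon
  obtain i j where "m11 (axis i 1) (axis j 1) = axis m 1" by (rule m11_axis_obtain)
  then have "axis m 1 \<in> {m11 a b | a b. True}" by (metis (mono_tags) mem_Collect_eq)
  then show "axis m 1 \<in> span {m11 a b | a b. True}" by (rule span_base)
qed

lemma span_m22: "span {m22 a b | a b. True} = UNIV"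
proof (rule span_eq_UNIV_axis)
  fix m :: quartic_mon
  obtain i j where "m22 (axis i 1) (axis j 1) = axis m 1" by (rule m22_axis_obtain)
  then have "axis m 1 \<in> {m22 a b | a b. True}" by (metis (mono_tags) mem_Collect_eq)
  then show "axis m 1 \<in> span {m22 a b | a b. True}" by (rule span_base)
qed

section \<open>Point evaluations, and quartic functionals as symmetric bilinear forms on
  quadrics\<close>

definition ev :: "real ^ quad_mon \<Rightarrow> real ^ 4 \<Rightarrow> real" where
  "ev x a = mpoly_eval (qf x) (\<lambda>i. a $ i)"

lemma mpoly_eval_lf: "mpoly_eval (lf b) (\<lambda>i. a $ i) = b \<bullet> a"
proof -
  have "(\<Prod>v\<in>UNIV. (a $ v) ^ Poly_Mapping.lookup (lin_exps i) v) = a $ i" for i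
    by (simp add: lin_exps_def lookup_single when_def if_distrib prod.delta cong: if_cong)
  then show ?thesis by (simp add: form_of_def inner_vec_def)
qed

lemma ev_m11 [simp]: "ev (m11 b c) a = (b \<bullet> a) * (c \<bullet> a)"
  by (simp add: ev_def mpoly_eval_lf)

lemma linear_ev: "linear (\<lambda>x. ev x a)"
  by (rule linearI) (auto simp: ev_def linear_add[OF linear_form_of] linear_cmul[OF linear_form_of])

text \<open>Evaluating the product at \<open>a\<close> and at \<open>b\<close> forces
  \<open>a\<close> and \<open>b\<close> to be orthogonal if both are nonzero; its value at
  \<open>a + b\<close> is then the product of their squared norms.\<close>

lemma m11_eq_0: "m11 a b = 0 \<longleftrightarrow> a = 0 \<or> b = 0"
proof
  assume "m11 a b = 0"
  then have ab: "(a \<bullet> x) * (b \<bullet> x) = 0" for x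
    using ev_m11[of a b x] linear_0[OF linear_ev] by simp
  show "a = 0 \<or> b = 0"
    using ab[of a] ab[of b] ab[of "a + b"]
    by (auto simp: inner_commute[of b a] inner_add_right)
qed (auto simp: m11_simps)

text \<open>The catalecticant, or middle Hankel form, of the functional \<open>v\<close>;
  functionals on quartics are identified with vectors through the coordinate inner product.\<close>

definition B :: "real ^ quartic_mon \<Rightarrow> real ^ quad_mon \<Rightarrow> real ^ quad_mon \<Rightarrow> real" where
  "B v x y = v \<bullet> m22 x y"

lemma B_simps:
  "B v (x + x') y = B v x y + B v x' y" "B v x (y + y') = B v x y + B v x y'"
  "B v (x - x') y = B v x y - B v x' y" "B v x (y - y') = B v x y - B v x y'"
  "B v (c *\<^sub>R x) y = c * B v x y" "B v x (c *\<^sub>R y) = c * B v x y"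
  "B v 0 y = 0" "B v x 0 = 0" "B v (- x) y = - B v x y" "B v x (- y) = - B v x y"
  "B (v + v') x y = B v x y + B v' x y" "B (v - v') x y = B v x y - B v' x y"
  "B (c *\<^sub>R v) x y = c * B v x y" "B 0 x y = 0" "B (- v) x y = - B v x y"
  by (simp_all add: B_def m22_simps inner_simps)

lemma bilinear_B: "bilinear (B v)"
  by (auto simp: bilinear_def B_simps intro!: linearI)

lemma B_commute: "B v x y = B v y x"
  by (simp add: B_def m22_commute)

lemma B_swap: "B v (m11 a b) (m11 c d) = B v (m11 a c) (m11 b d)"
  by (simp add: B_def m22_swap)

lemma B_eq_0:
  assumes "\<And>x y. B v x y = 0" shows "v = 0"
proof -
  have "v $ m = 0" for m
  proof -
    obtain i j where "m22 (axis i 1) (axis j 1) = axis m 1" by (rule m22_axis_obtain)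
    with assms[of "axis i 1" "axis j 1"] show ?thesis by (simp add: B_def inner_axis)
  qed
  then show ?thesis by (simp add: vec_eq_iff)
qed

lemma tendsto_B:
  assumes "(f \<longlongrightarrow> a) F" "(g \<longlongrightarrow> b) F" "(h \<longlongrightarrow> c) F"
  shows "((\<lambda>t. B (f t) (g t) (h t)) \<longlongrightarrow> B a b c) F"
  unfolding B_def
  using bounded_bilinear.tendsto[OF bilinear_m22[unfolded bilinear_conv_bounded_bilinear] assms(2,3)]
    assms(1) by (intro tendsto_inner)

lemma lin_exps_mem:
  assumes "lin_exps i + n = lin_exps i' + lin_exps j' + lin_exps k' + lin_exps h'"
  shows "i \<in> {i', j', k', h'}"
proof (rule ccontr)
  assume "i \<notin> {i', j', k', h'}"
  then show False
    using arg_cong[OF assms, of "\<lambda>m. Poly_Mapping.lookup m i"]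
    by (auto simp: lookup_add lin_exps_def lookup_single)
qed

text \<open>Adjacent transpositions generate all permutations, so \<open>G\<close> sees only the
  multiset of its indices, that is, the monomial. The multisets are matched from the left:
  \<open>i\<close> is located on the right-hand side and cancelled, and the same is done for three
  and for two indices.\<close>

lemma symmetric_4_fun:
  fixes G :: "4 \<Rightarrow> 4 \<Rightarrow> 4 \<Rightarrow> 4 \<Rightarrow> real"
  assumes s: "\<And>i j k h. G i j k h = G j i k h" "\<And>i j k h. G i j k h = G i k j h"
      "\<And>i j k h. G i j k h = G i j h k"
    and eq: "lin_exps i + lin_exps j + lin_exps k + lin_exps h =
      lin_exps i' + lin_exps j' + lin_exps k' + lin_exps h'"
  shows "G i j k h = G i' j' k' h'"
proof -
  have inj: "lin_exps x = lin_exps y \<Longrightarrow> x = y" for x y by (rule injD[OF i1.inj])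
  have two: "G a b k h = G a b k' h'" if "lin_exps k + lin_exps h = lin_exps k' + lin_exps h'" for a b k h k' h'
  proof -
    have "k \<in> {k', h'}" using lin_exps_mem[of k "lin_exps h + lin_exps k' + lin_exps k'" k' h' k' k'] that
      by (simp add: add.assoc[symmetric]) (simp add: ac_simps)
    then consider "k = k'" | "k = h'" by blast
    then show ?thesis
    proof cases
      case 1
      then show ?thesis using that inj by auto
    next
      case 2
      then have "h = k'" using that inj by (simp add: add.commute)
      then show ?thesis using 2 s(3)[of a b h' k'] by simp
    qed
  qed
  have three: "G a j k h = G a j' k' h'"
    if e: "lin_exps j + lin_exps k + lin_exps h = lin_exps j' + lin_exps k' + lin_exps h'" for a j k h j' k' h'
  proof -
    have "j \<in> {j', k', h'}" using lin_exps_mem[of j "lin_exps k + lin_exps h + lin_exps j'" j' k' h' j'] e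
      by (auto simp: add.assoc[symmetric])
    then consider "j = j'" | "j = k'" | "j = h'" by blast
    then show ?thesis
    proof cases
      case 1
      then show ?thesis using e two[of k h k' h' a j] by (simp add: add.assoc)
    next
      case 2
      then have "lin_exps j + (lin_exps k + lin_exps h) = lin_exps j + (lin_exps j' + lin_exps h')" using e by (simp add: ac_simps)
      then have "lin_exps k + lin_exps h = lin_exps j' + lin_exps h'"
        by (rule add_left_imp_eq)
      then show ?thesis using 2 two[of k h j' h' a k'] s(2)[of a k' j' h'] by simp
    next
      case 3
      then have "lin_exps j + (lin_exps k + lin_exps h) = lin_exps j + (lin_exps j' + lin_exps k')" using e by (simp add: ac_simps)
      then have "lin_exps k + lin_exps h = lin_exps j' + lin_exps k'"
        by (rule add_left_imp_eq)
      then show ?thesis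
        using 3 two[of k h j' k' a h'] s(2)[of a h' j' k'] s(3)[of a j' h' k'] by simp
    qed
  qed
  have "i \<in> {i', j', k', h'}" using lin_exps_mem[of i "lin_exps j + lin_exps k + lin_exps h" i' j' k' h'] eq
    by (simp add: add.assoc)
  then consider "i = i'" | "i = j'" | "i = k'" | "i = h'" by blast
  then show ?thesis
  proof cases
    case 1
    then show ?thesis using eq three[of j k h j' k' h' i] by (simp add: add.assoc)
  next
    case 2
    then have "lin_exps i + (lin_exps j + lin_exps k + lin_exps h) = lin_exps i + (lin_exps i' + lin_exps k' + lin_exps h')"
      using eq by (simp add: ac_simps)
      then have "lin_exps j + lin_exps k + lin_exps h = lin_exps i' + lin_exps k' + lin_exps h'"
        by (rule add_left_imp_eq)
    then show ?thesis using 2 three[of j k h i' k' h' j'] s(1)[of j' i' k' h'] by simp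
  next
    case 3
    then have "lin_exps i + (lin_exps j + lin_exps k + lin_exps h) = lin_exps i + (lin_exps i' + lin_exps j' + lin_exps h')"
      using eq by (simp add: ac_simps)
      then have "lin_exps j + lin_exps k + lin_exps h = lin_exps i' + lin_exps j' + lin_exps h'"
        by (rule add_left_imp_eq)
    then show ?thesis
      using 3 three[of j k h i' j' h' k'] s(1)[of k' i' j' h'] s(2)[of i' k' j' h'] by simp
  next
    case 4
    then have "lin_exps i + (lin_exps j + lin_exps k + lin_exps h) = lin_exps i + (lin_exps i' + lin_exps j' + lin_exps k')"
      using eq by (simp add: ac_simps)
      then have "lin_exps j + lin_exps k + lin_exps h = lin_exps i' + lin_exps j' + lin_exps k'"
        by (rule add_left_imp_eq)
    then show ?thesis
      using 4 three[of j k h i' j' k' h'] s(1)[of h' i' j' k'] s(2)[of i' h' j' k']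
        s(3)[of i' j' h' k'] by simp
  qed
qed

lemma bilinear_eq_axis:
  fixes f g :: "real ^ 'm \<Rightarrow> real ^ 'n \<Rightarrow> real"
  assumes "bilinear f" "bilinear g" "\<And>i j. f (axis i 1) (axis j 1) = g (axis i 1) (axis j 1)"
  shows "f = g"
  by (rule bilinear_eq_stdbasis[OF assms(1,2)]) (use assms(3) in \<open>auto simp: Basis_vec_def\<close>)

text \<open>The exchange law and commutativity of \<open>m11\<close> make the values of \<gamma> on
  products of variables symmetric in all four indices, hence a function of the quartic monomial.
  This turns operators built from multiplications into functionals.\<close>

lemma symmetric_form_from_functional:
  assumes "bilinear \<gamma>" and sw: "\<And>a b c d. \<gamma> (m11 a b) (m11 c d) = \<gamma> (m11 a c) (m11 b d)"
  obtains v where "\<gamma> = B v"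
proof -
  let ?e = "\<lambda>i. axis i 1 :: real ^ 4"
  define G where "G i j k h = \<gamma> (m11 (?e i) (?e j)) (m11 (?e k) (?e h))" for i j k h
  have s: "G i j k h = G j i k h" "G i j k h = G i k j h" "G i j k h = G i j h k" for i j k h
    unfolding G_def by (simp_all only: m11_commute[of "?e j" "?e i"] m11_commute[of "?e h" "?e k"] sw[of "?e i" "?e j"])
  \<comment> \<open>Any factorisation of the monomial into variables will do: by
    \<open>symmetric_4_fun\<close> the value of \<open>G\<close> does not depend on the
    choice.\<close>
  define P where "P m = (\<lambda>(i,j,k,h). exponents m = lin_exps i + lin_exps j + lin_exps k + lin_exps h)" for m
  define v :: "real ^ quartic_mon" where "v = (\<chi> m. case Eps (P m) of (i,j,k,h) \<Rightarrow> G i j k h)"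
  have "\<gamma> = B v"
  proof (rule bilinear_eq_axis[OF assms(1) bilinear_B])
    fix x y
    obtain i j where x: "quad_exps x = lin_exps i + lin_exps j" using quad_exps_split by blast
    obtain k h where y: "quad_exps y = lin_exps k + lin_exps h" using quad_exps_split by blast
    have "quad_exps x + quad_exps y \<in> range exponents"
      using quad_exps i4.range by (auto simp: mon_degree_add)
    then obtain m where m: "exponents m = quad_exps x + quad_exps y" by auto
    have "P m (i, j, k, h)" by (simp add: P_def m x y add.assoc)
    then have "P m (Eps (P m))" by (rule someI)
    moreover obtain i' j' k' h' where e: "Eps (P m) = (i', j', k', h')" by (metis prod_cases4)
    ultimately have "lin_exps i + lin_exps j + lin_exps k + lin_exps h =
        lin_exps i' + lin_exps j' + lin_exps k' + lin_exps h'"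
      using \<open>P m (i, j, k, h)\<close> by (simp add: P_def)
    then have "G i j k h = G i' j' k' h'" by (rule symmetric_4_fun[OF s])
    moreover have "v $ m = G i' j' k' h'" by (simp add: v_def e)
    ultimately show "\<gamma> (axis x 1) (axis y 1) = B v (axis x 1) (axis y 1)"
      unfolding B_def m22_axis[OF m] inner_axis by (simp add: G_def m11_axis[OF x] m11_axis[OF y])
  qed
  then show ?thesis by (rule that)
qed

section \<open>Positive semidefinite functionals on quartics\<close>

definition psd :: "real ^ quartic_mon \<Rightarrow> bool" where
  "psd v \<longleftrightarrow> (\<forall>x. 0 \<le> B v x x)"

definition ker :: "real ^ quartic_mon \<Rightarrow> (real ^ quad_mon) set" where
  "ker v = {x. \<forall>y. B v x y = 0}"

definition ann :: "(real ^ quad_mon) set \<Rightarrow> (real ^ quartic_mon) set" where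
  "ann U = {v. \<forall>u\<in>U. \<forall>y. B v u y = 0}"

definition zero_free :: "(real ^ quad_mon) set \<Rightarrow> bool" where
  "zero_free U \<longleftrightarrow> (\<forall>a. a \<noteq> 0 \<longrightarrow> (\<exists>x\<in>U. ev x a \<noteq> 0))"

lemma kerD: "x \<in> ker v \<Longrightarrow> B v x y = 0" "x \<in> ker v \<Longrightarrow> B v y x = 0"
  by (auto simp: ker_def B_commute[of v y x])

lemma subspace_ker: "subspace (ker v)"
  by (auto simp: subspace_def ker_def B_simps)

lemma subspace_ann: "subspace (ann U)"
  by (auto simp: subspace_def ann_def B_simps)

lemma ann_iff_ker: "v \<in> ann U \<longleftrightarrow> U \<subseteq> ker v"
  by (auto simp: ann_def ker_def)

lemma ann_span: "ann (span U) = ann U"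
  using span_minimal[OF _ subspace_ker] span_superset[of U] by (force simp: ann_iff_ker)

lemma zero_free_mono: "zero_free U \<Longrightarrow> U \<subseteq> V \<Longrightarrow> zero_free V"
  by (force simp: zero_free_def)

lemma ker_eq_UNIV: "ker v = UNIV \<Longrightarrow> v = 0"
  by (rule B_eq_0) (auto simp: ker_def)

lemma real_linear_bound_0:
  fixes b c :: real
  assumes "0 \<le> c" "\<And>t. 0 \<le> 2 * t * b + t\<^sup>2 * c"
  shows "b = 0"
proof (rule ccontr)
  assume "b \<noteq> 0"
  \<comment> \<open>The shift by 1 keeps the denominator positive also for \<open>c = 0\<close>; at
    \<open>- u\<close> the quadratic is already negative.\<close>
  define u where "u = b / (1 + c)"
  have b: "b = u * (1 + c)" using assms(1) by (simp add: u_def)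
  have "2 * (- u) * b + (- u)\<^sup>2 * c = - (u\<^sup>2 * (2 + c))"
    unfolding b by (simp add: power2_eq_square algebra_simps)
  moreover have "u\<^sup>2 * (2 + c) > 0" using \<open>b \<noteq> 0\<close> assms(1) b by (intro mult_pos_pos) auto
  ultimately show False using assms(2)[of "- u"] by linarith
qed

text \<open>An isotropic vector outside the radical would make the form change sign along a line
  through it.\<close>

lemma psd_ker:
  assumes "psd v" "B v x x = 0" shows "x \<in> ker v"
proof -
  have "B v x y = 0" for y
  proof (rule real_linear_bound_0[of "B v y y"])
    show "0 \<le> B v y y" using assms(1) by (simp add: psd_def)
    fix t
    have "0 \<le> B v (x + t *\<^sub>R y) (x + t *\<^sub>R y)" using assms(1) by (simp add: psd_def)
    also have "\<dots> = 2 * t * B v x y + t\<^sup>2 * B v y y"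
      using assms(2) by (simp add: B_simps B_commute[of v y x] power2_eq_square algebra_simps)
    finally show "0 \<le> 2 * t * B v x y + t\<^sup>2 * B v y y" .
  qed
  then show ?thesis by (simp add: ker_def)
qed

lemma psd_pos: "psd v \<Longrightarrow> x \<notin> ker v \<Longrightarrow> 0 < B v x x"
  using psd_ker[of v x] by (auto simp: psd_def order_less_le)

lemma B_polar: "B v x y = (B v (x + y) (x + y) - B v (x - y) (x - y)) / 4"
  by (simp add: B_simps B_commute[of v y x])

lemma B_bounded: "\<exists>M>0. \<forall>v x y. \<bar>B v x y\<bar> \<le> M * norm v * norm x * norm y"
proof -
  obtain M where M: "M > 0" "\<And>x y. norm (m22 x y) \<le> norm x * norm y * M"
    using bounded_bilinear.pos_bounded[OF bilinear_m22[unfolded bilinear_conv_bounded_bilinear]] by blast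
  have "\<bar>B v x y\<bar> \<le> M * norm v * norm x * norm y" for v x y
  proof -
    have "\<bar>B v x y\<bar> \<le> norm v * norm (m22 x y)" unfolding B_def by (rule Cauchy_Schwarz_ineq2)
    also have "\<dots> \<le> norm v * (norm x * norm y * M)" by (intro mult_left_mono M) auto
    finally show ?thesis by (simp add: mult_ac)
  qed
  then show ?thesis using M(1) by blast
qed

lemma pd_bound:
  fixes G :: "'a::euclidean_space \<Rightarrow> 'a \<Rightarrow> real"
  assumes G: "bilinear G" and S: "subspace S" and pd: "\<And>x. x \<in> S \<Longrightarrow> x \<noteq> 0 \<Longrightarrow> 0 < G x x"
  obtains c where "c > 0" "\<And>x. x \<in> S \<Longrightarrow> c * (norm x)\<^sup>2 \<le> G x x"
proof (cases "S \<inter> sphere 0 1 = {}")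
  case True
  have S0: "x = 0" if "x \<in> S" for x
  proof (rule ccontr)
    assume "x \<noteq> 0"
    then have "(1 / norm x) *\<^sub>R x \<in> S \<inter> sphere 0 1" using that S by (auto simp: subspace_scale)
    then show False using True by auto
  qed
  have "1 * (norm x)\<^sup>2 \<le> G x x" if "x \<in> S" for x
    using S0[OF that] by (simp add: bilinear_lzero[OF G])
  then show ?thesis using that[of 1] by simp
next
  case False
  have "compact (S \<inter> sphere 0 1)"
    using S by (intro closed_Int_compact closed_subspace) auto
  moreover have "continuous_on (S \<inter> sphere 0 1) (\<lambda>x. G x x)"
    by (intro bounded_bilinear.continuous_on[OF G[unfolded bilinear_conv_bounded_bilinear]] continuous_on_id)
  ultimately obtain x0 where x0: "x0 \<in> S" "norm x0 = 1"
      and min: "\<And>y. y \<in> S \<Longrightarrow> norm y = 1 \<Longrightarrow> G x0 x0 \<le> G y y"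
    using continuous_attains_inf[of "S \<inter> sphere 0 1"] False by force
  have "G x0 x0 * (norm x)\<^sup>2 \<le> G x x" if "x \<in> S" for x
  proof (cases "x = 0")
    case False
    then have "G x0 x0 \<le> G ((1 / norm x) *\<^sub>R x) ((1 / norm x) *\<^sub>R x)"
      using that S by (intro min) (auto simp: subspace_scale)
    then show ?thesis
      using False by (simp add: bilinear_lmul[OF G] bilinear_rmul[OF G] field_simps power2_eq_square)
  qed (simp add: bilinear_lzero[OF G])
  moreover have "0 < G x0 x0" using pd[of x0] x0 by fastforce
  ultimately show ?thesis using that by blast
qed

text \<open>By compactness of the unit sphere of \<open>S\<close> the form is bounded below there,
  and \<open>B\<close> depends boundedly on the functional.\<close>

lemma pd_stable:
  assumes S: "subspace S" and pd: "\<And>x. x \<in> S \<Longrightarrow> x \<noteq> 0 \<Longrightarrow> 0 < B v x x"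
  obtains e where "e > 0" "\<And>w x. norm (w - v) < e \<Longrightarrow> x \<in> S \<Longrightarrow> x \<noteq> 0 \<Longrightarrow> 0 < B w x x"
proof -
  obtain c where c: "c > 0" "\<And>x. x \<in> S \<Longrightarrow> c * (norm x)\<^sup>2 \<le> B v x x"
    using pd_bound[OF bilinear_B assms] by blast
  obtain M where M: "M > 0" "\<And>v x y. \<bar>B v x y\<bar> \<le> M * norm v * norm x * norm y"
    using B_bounded by blast
  have "0 < B w x x" if w: "norm (w - v) < c / M" and x: "x \<in> S" "x \<noteq> 0" for w x
  proof -
    have "\<bar>B (w - v) x x\<bar> \<le> M * norm (w - v) * (norm x)\<^sup>2"
      using M(2)[of "w - v" x x] by (simp add: power2_eq_square mult.assoc)
    also have "\<dots> < c * (norm x)\<^sup>2"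
      using w M(1) x(2) by (intro mult_strict_right_mono) (auto simp: field_simps)
    also have "\<dots> \<le> B v x x" using c x by simp
    finally show ?thesis by (simp add: B_simps)
  qed
  then show ?thesis using that[of "c / M"] c(1) M(1) by simp
qed

lemma orth_decomp:
  assumes "subspace (W :: 'a::euclidean_space set)"
  obtains y z where "x = y + z" "y \<in> W" "z \<in> {z. \<forall>w\<in>W. orthogonal z w}"
proof -
  obtain y z where "y \<in> span W" "\<And>w. w \<in> span W \<Longrightarrow> orthogonal z w" "x = y + z"
    using orthogonal_subspace_decomp_exists[of W x] by blast
  moreover have "span W = W" using assms by (rule span_eq_iff[THEN iffD2])
  ultimately show ?thesis using that by auto
qed

text \<open>The criterion for perturbing a functional: if \<open>W\<close> stays in the radical and
  positivity survives on a complement, neither semidefiniteness nor the size of the kernel can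
  change.\<close>

lemma psd_from_pd:
  assumes W: "subspace W" "W \<subseteq> ker w" and S: "\<And>x. \<exists>y z. x = y + z \<and> y \<in> W \<and> z \<in> S"
    and pd: "\<And>x. x \<in> S \<Longrightarrow> x \<noteq> 0 \<Longrightarrow> 0 < B w x x"
  shows "psd w" "ker w = W"
proof -
  have *: "B w (y + z) (y + z) = B w z z" if "y \<in> W" for y z
    using kerD[of y w] that W by (auto simp: B_simps)
  show "psd w"
    unfolding psd_def
  proof
    fix x
    obtain y z where x: "x = y + z" "y \<in> W" "z \<in> S" using S by blast
    then have "B w x x = B w z z" using * by simp
    then show "0 \<le> B w x x"
      using pd[of z] x by (cases "z = 0") (auto simp: B_simps)
  qed
  show "ker w = W"
  proof
    show "ker w \<subseteq> W"
    proof
      fix x assume x: "x \<in> ker w"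
      obtain y z where yz: "x = y + z" "y \<in> W" "z \<in> S" using S by blast
      have "B w z z = 0" using *[OF yz(2), of z] kerD[OF x] yz(1) by simp
      then have "z = 0" using pd[of z] yz by fastforce
      then show "x \<in> W" using yz by simp
    qed
  qed (rule W)
qed

section \<open>Enlarging the kernel until the functional is extreme\<close>

lemma closed_psd: "closed {v. psd v}"
proof -
  have "{v. psd v} = (\<Inter>x. {v. 0 \<le> v \<bullet> m22 x x})" by (auto simp: psd_def B_def)
  also have "closed \<dots>" by (intro closed_INT ballI closed_Collect_le continuous_intros)
  finally show ?thesis .
qed

lemma psd_add: "psd v \<Longrightarrow> psd w \<Longrightarrow> psd (v + w)"
  by (auto simp: psd_def B_simps)

lemma psd_scale: "psd v \<Longrightarrow> 0 \<le> c \<Longrightarrow> psd (c *\<^sub>R v)"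
  by (auto simp: psd_def B_simps)

lemma small_scaleR:
  fixes b :: "'a::real_normed_vector"
  assumes "e > 0" obtains d where "d > 0" "norm (d *\<^sub>R b) < e"
proof
  have nb: "0 < norm b + 1" using norm_ge_zero[of b] by linarith
  show "e / (norm b + 1) > 0" using nb assms by simp
  have "norm ((e / (norm b + 1)) *\<^sub>R b) = e * (norm b / (norm b + 1))" using nb assms by simp
  also have "\<dots> < e * 1" using nb assms by (intro mult_strict_left_mono) simp_all
  finally show "norm ((e / (norm b + 1)) *\<^sub>R b) < e" by simp
qed

text \<open>Move from \<open>v\<close> in direction \<open>b\<close> up to the last semidefinite
  functional. If its kernel were still \<open>ker v\<close>, positivity on the orthogonal complement
  would be stable and one could move further. The limit is nonzero because \<open>b\<close> is not a
  multiple of \<open>v\<close>.\<close>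

lemma larger_kernel_aux:
  assumes v: "psd v" "v \<noteq> 0" and b: "b \<in> ann (ker v)" "b \<notin> span {v}"
    and t: "t > 0" "\<not> psd (v + t *\<^sub>R b)"
  shows "\<exists>v'. psd v' \<and> v' \<noteq> 0 \<and> ker v \<subset> ker v'"
proof -
  define T where "T = {s. 0 \<le> s \<and> psd (v + s *\<^sub>R b)}"
  have bnd: "s \<le> t" if "s \<in> T" for s
  proof (rule ccontr)
    assume s: "\<not> s \<le> t"
    \<comment> \<open>Were the cone left at \<open>t\<close> and entered again at \<open>s\<close>,
      convexity would place the point at parameter \<open>t\<close> inside it.\<close>
    have "v + t *\<^sub>R b = (1 - t / s) *\<^sub>R v + (t / s) *\<^sub>R (v + s *\<^sub>R b)"
      using s t by (simp add: algebra_simps)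
    moreover have "psd \<dots>"
      by (rule psd_add; rule psd_scale) (use v that s t in \<open>simp_all add: T_def\<close>)
    ultimately show False using t by simp
  qed
  have "closed T"
  proof -
    have "T = {0..} \<inter> (\<lambda>s. v + s *\<^sub>R b) -` {v. psd v}" by (auto simp: T_def)
    then show ?thesis
      using closed_psd by (simp only:) (intro closed_Int continuous_closed_vimage closed_atLeast ballI continuous_intros)
  qed
  moreover have "0 \<in> T" using v by (simp add: T_def)
  moreover have "bdd_above T" using bnd by (auto simp: bdd_above_def)
  ultimately have "Sup T \<in> T" using closed_contains_Sup by blast
  define s where "s = Sup T"
  define w where "w = v + s *\<^sub>R b"
  have w: "psd w" "0 \<le> s" using \<open>Sup T \<in> T\<close> by (auto simp: T_def w_def s_def)
  have sub: "ker v \<subseteq> ker (w + c *\<^sub>R b)" for c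
    using b(1) by (auto simp: w_def ker_def ann_def B_simps)
  have "w \<noteq> 0"
  proof
    assume "w = 0"
    then have "s *\<^sub>R b = - v" by (simp add: w_def add_eq_0_iff2)
    moreover have "s \<noteq> 0" using \<open>w = 0\<close> v by (auto simp: w_def)
    ultimately have "(- 1 / s) *\<^sub>R v = (1 / s) *\<^sub>R (s *\<^sub>R b)" "s \<noteq> 0" by simp_all
    then have "b = (- 1 / s) *\<^sub>R v" by simp
    moreover have "(- 1 / s) *\<^sub>R v \<in> span {v}" by (intro span_scale span_base) simp
    ultimately show False using b(2) by simp
  qed
  moreover have "ker w \<noteq> ker v"
  proof
    assume eq: "ker w = ker v"
    let ?S = "{z. \<forall>w\<in>ker v. orthogonal z w}"
    have "subspace ?S" using subspace_orthogonal_to_vectors[of "ker v"] by (simp add: orthogonal_commute)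
    moreover have "0 < B w x x" if "x \<in> ?S" "x \<noteq> 0" for x
      using that eq orthogonal_self[of x] by (intro psd_pos w) auto
    ultimately obtain e where e: "e > 0" "\<And>u x. norm (u - w) < e \<Longrightarrow> x \<in> ?S \<Longrightarrow> x \<noteq> 0 \<Longrightarrow> 0 < B u x x"
      using pd_stable by blast
    obtain d where d: "d > 0" "norm (d *\<^sub>R b) < e" using small_scaleR[OF e(1)] .
    have pd: "0 < B (w + d *\<^sub>R b) x x" if "x \<in> ?S" "x \<noteq> 0" for x
      using e(2)[of "w + d *\<^sub>R b" x] that d by simp
    have "\<exists>y z. x = y + z \<and> y \<in> ker v \<and> z \<in> ?S" for x
      by (rule orth_decomp[OF subspace_ker[of v], of x]) blast
    then have "psd (w + d *\<^sub>R b)"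
      using pd by (rule psd_from_pd(1)[OF subspace_ker[of v] sub])
    then have "s + d \<in> T" using w d by (auto simp: T_def w_def algebra_simps)
    then have "s + d \<le> s" unfolding s_def using \<open>bdd_above T\<close> by (rule cSup_upper)
    then show False using d by simp
  qed
  ultimately show ?thesis using w sub[of 0] by auto
qed

text \<open>One of the directions \<open>b\<close> and \<open>- b\<close> must leave the cone:
  otherwise \<open>B b\<close> vanishes on the diagonal, hence everywhere, and
  \<open>b = 0\<close>.\<close>

lemma larger_kernel:
  assumes v: "psd v" "v \<noteq> 0" and b: "b \<in> ann (ker v)" "b \<notin> span {v}"
  shows "\<exists>v'. psd v' \<and> v' \<noteq> 0 \<and> ker v \<subset> ker v'"
proof (cases "\<forall>t>0. psd (v + t *\<^sub>R b) \<and> psd (v + t *\<^sub>R (- b))")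
  case True
  have nonneg: "0 \<le> c" if "\<And>t. t > 0 \<Longrightarrow> 0 \<le> a + t * c" for a c :: real
  proof (rule ccontr)
    assume "\<not> 0 \<le> c"
    then have "a + ((\<bar>a\<bar> + 1) / (- c)) * c = a - \<bar>a\<bar> - 1" by simp
    then have "a + ((\<bar>a\<bar> + 1) / (- c)) * c < 0" by linarith
    moreover have "(\<bar>a\<bar> + 1) / (- c) > 0" using \<open>\<not> 0 \<le> c\<close> by (intro divide_pos_pos) auto
    ultimately show False using that[of "(\<bar>a\<bar> + 1) / (- c)"] by linarith
  qed
  have "B b x x = 0" for x
  proof -
    have "0 \<le> B v x x + t * B b x x" "0 \<le> B v x x + t * - B b x x" if "t > 0" for t
    proof -
      have "0 \<le> B (v + t *\<^sub>R b) x x" "0 \<le> B (v + t *\<^sub>R (- b)) x x"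
        using True that by (auto simp: psd_def)
      then show "0 \<le> B v x x + t * B b x x" "0 \<le> B v x x + t * - B b x x" by (simp_all add: B_simps)
    qed
    then have "0 \<le> B b x x" "0 \<le> - B b x x" using nonneg by blast+
    then show ?thesis by simp
  qed
  then have "B b x y = 0" for x y using B_polar[of b x y] by simp
  then have "b = 0" by (rule B_eq_0)
  then show ?thesis using b by (simp add: span_zero)
next
  case False
  then consider t where "t > 0" "\<not> psd (v + t *\<^sub>R b)" | t where "t > 0" "\<not> psd (v + t *\<^sub>R (- b))" by blast
  then show ?thesis
  proof cases
    case 1
    then show ?thesis using larger_kernel_aux[OF v b] by blast
  next
    case 2
    moreover have "- b \<in> ann (ker v)" "- b \<notin> span {v}"
      using b subspace_neg[OF subspace_ann] subspace_neg[OF subspace_span, of "- b" "{v}"] by auto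
    ultimately show ?thesis using larger_kernel_aux[OF v] by blast
  qed
qed

text \<open>Kernels live in dimension 10, so enlarging them stops, and it can only stop at an
  extreme functional, one for which \<open>ann (ker v)\<close> is a line.\<close>

lemma maximal_kernel:
  assumes "psd v" "v \<noteq> 0"
  obtains v' where "psd v'" "v' \<noteq> 0" "ker v \<subseteq> ker v'" "ann (ker v') = span {v'}"
proof -
  have "\<exists>v'. psd v' \<and> v' \<noteq> 0 \<and> ker v \<subseteq> ker v' \<and> ann (ker v') = span {v'}"
    using assms
  proof (induction "10 - dim (ker v)" arbitrary: v rule: less_induct)
    case less
    show ?case
    proof (cases "ann (ker v) = span {v}")
      case True
      then show ?thesis using less.prems by blast
    next
      case False
      moreover have "span {v} \<subseteq> ann (ker v)"
        by (rule span_minimal) (auto simp: ann_iff_ker subspace_ann)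
      ultimately obtain b where "b \<in> ann (ker v)" "b \<notin> span {v}" by blast
      then obtain w where w: "psd w" "w \<noteq> 0" "ker v \<subset> ker w" using larger_kernel[OF less.prems] by blast
      have "dim (ker v) < dim (ker w)"
        using w(3) by (intro dim_psubset) (simp add: span_eq_iff[THEN iffD2] subspace_ker)
      moreover have "dim (ker w) \<le> 10"
        using dim_subset_UNIV[of "ker w"] by (simp add: CARD_quad_mon)
      ultimately obtain v' where "psd v'" "v' \<noteq> 0" "ker w \<subseteq> ker v'" "ann (ker v') = span {v'}"
        using less.hyps[of w] w(1,2) diff_less_mono2[of "dim (ker v)" "dim (ker w)" 10] by (meson order_less_le_trans)
      then show ?thesis using w(3) by blast
    qed
  qed
  then show ?thesis using that by blast
qed

section \<open>Linear algebra\<close>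

lemma dim_orthogonal_complement:
  fixes K :: "'a::euclidean_space set"
  assumes "subspace K"
  shows "dim {y. \<forall>x\<in>K. orthogonal y x} + dim K = DIM('a)"
  using dim_subspace_orthogonal_to_vectors[OF assms subspace_UNIV] by (simp add: orthogonal_commute)

lemma subspace_orthogonal_complement: "subspace {y. \<forall>x\<in>K. orthogonal y x}"
  using subspace_orthogonal_to_vectors[of K] by (simp add: orthogonal_commute)

lemma rank_nullity:
  fixes f :: "'a::euclidean_space \<Rightarrow> 'b::euclidean_space"
  assumes f: "linear f"
  shows "dim (range f) + dim {x. f x = 0} = DIM('a)"
proof -
  let ?K = "{x. f x = 0}"
  let ?C = "{y. \<forall>x\<in>?K. orthogonal y x}"
  have K: "subspace ?K" using f by (rule linear_subspace_kernel)
  have C: "subspace ?C" by (rule subspace_orthogonal_complement)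
  have "x = 0" if "x \<in> ?C" "f x = 0" for x
    using that orthogonal_self[of x] by auto
  then have "inj_on f ?C" using linear_injective_on_subspace_0[OF f C] by blast
  then have "dim (f ` ?C) = dim ?C" using f C by (intro dim_image_eq) (auto simp: span_eq_iff[THEN iffD2])
  moreover have "range f = f ` ?C"
  proof -
    have "f x \<in> f ` ?C" for x
    proof -
      obtain y z where "x = y + z" "y \<in> ?K" "z \<in> ?C" using orth_decomp[OF K] .
      then have "f x = f z" by (simp add: linear_add[OF f])
      then show ?thesis using \<open>z \<in> ?C\<close> by blast
    qed
    then show ?thesis by blast
  qed
  ultimately show ?thesis using dim_orthogonal_complement[OF K] by presburger
qed

text \<open>Representing vectors are needed for the inner product that \<open>v\<close> induces on
  linear forms, not for the Euclidean one.\<close>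

lemma riesz_form:
  fixes Q :: "'a::euclidean_space \<Rightarrow> 'a \<Rightarrow> real"
  assumes Q: "bilinear Q" and nd: "\<And>x. (\<And>a. Q a x = 0) \<Longrightarrow> x = 0" and g: "linear (g :: 'a \<Rightarrow> real)"
  obtains d where "\<And>x. Q x d = g x"
proof -
  define D where "D d = (\<Sum>b\<in>Basis. Q b d *\<^sub>R b)" for d
  have lin: "linear D"
    unfolding D_def by (intro linearI)
      (simp_all add: bilinear_radd[OF Q] bilinear_rmul[OF Q] scaleR_add_left sum.distrib scaleR_sum_right)
  have lQ: "linear (\<lambda>x. Q x d)" for d using Q by (simp add: bilinear_def)
  have eq: "Q x d = D d \<bullet> x" for x d
  proof -
    have "(\<lambda>x. Q x d) = (\<lambda>x. D d \<bullet> x)"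
      by (rule linear_eq_stdbasis[OF lQ])
        (auto simp: D_def linear_iff inner_add_right)
    then show ?thesis by (rule fun_cong)
  qed
  have "inj D"
  proof (rule linear_injective_0[OF lin, THEN iffD2], intro allI impI)
    fix d assume "D d = 0"
    then show "d = 0" by (intro nd) (simp add: eq)
  qed
  then have "surj D" by (rule eucl.linear_inj_imp_surj[OF lin])
  then obtain d where d: "D d = (\<Sum>b\<in>Basis. g b *\<^sub>R b)" by (metis surjD)
  have "(\<lambda>x. Q x d) = g"
    by (rule linear_eq_stdbasis[OF lQ g]) (auto simp: eq d)
  then show ?thesis using that by metis
qed

section \<open>Real zeros of kernels of low rank\<close>

text \<open>Rigidity of an extreme \<open>v\<close>: a form obeying the exchange law comes from a
  functional, and if it kills \<open>ker v\<close> that functional lies on the line of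
  \<open>v\<close>. Below this shows that multiplication operators are scalars.\<close>

lemma indecomposable_form:
  assumes ind: "ann (ker v) = span {v}" and \<gamma>: "bilinear \<gamma>"
    and sw: "\<And>a b c d. \<gamma> (m11 a b) (m11 c d) = \<gamma> (m11 a c) (m11 b d)"
    and ker: "\<And>w y. w \<in> ker v \<Longrightarrow> \<gamma> w y = 0"
  obtains l where "\<And>x y. \<gamma> x y = l * B v x y"
proof -
  obtain u where u: "\<gamma> = B u" using symmetric_form_from_functional[OF \<gamma> sw] by blast
  then have "u \<in> ann (ker v)" using ker by (auto simp: ann_def)
  then obtain l where "u = l *\<^sub>R v" using ind by (auto simp: span_singleton)
  then show ?thesis using u that[of l] by (simp add: B_simps)
qed

text \<open>Products of linear forms span the quadrics, so being multiplicative on them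
  characterises multiples of a point evaluation. Real zeros are recognised in this way.\<close>

lemma real_zero_from_linear:
  assumes "linear f" "\<And>a b. f (m11 a b) = s * (z \<bullet> a) * (z \<bullet> b)"
  shows "f x = s * ev x z"
proof -
  have "subspace {x. f x = s * ev x z}"
    using assms(1) linear_ev[of z]
    by (auto simp: subspace_def linear_0[OF assms(1)] linear_0[OF linear_ev] linear_add[OF assms(1)]
        linear_add[OF linear_ev] linear_cmul[OF assms(1)] linear_cmul[OF linear_ev] distrib_left)
  then have "span {m11 a b | a b. True} \<subseteq> {x. f x = s * ev x z}"
    by (intro span_minimal) (auto simp: assms(2) inner_commute)
  then show ?thesis unfolding span_m11 by blast
qed

text \<open>Here \<open>l A_1\<close> has dimension 4 and codimension one in
  \<open>A_2/ker v\<close>, with \<open>nu\<close> as unit normal; so the kernel has dimension 5.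
  The locale is inconsistent with a zero-free kernel.\<close>

locale codim_one =
  fixes v :: "real ^ quartic_mon" and l :: "real ^ 4" and nu :: "real ^ quad_mon"
  assumes psd: "psd v" and ind: "ann (ker v) = span {v}"
    and inj: "\<And>a. m11 l a \<in> ker v \<Longrightarrow> a = 0"
    and noZ: "\<And>m. (\<And>a. m11 m a \<in> ker v) \<Longrightarrow> m = 0"
    and nu: "\<And>a. B v nu (m11 l a) = 0" "B v nu nu = 1"
    and decomp: "\<And>p. \<exists>a r. p - (m11 l a + r *\<^sub>R nu) \<in> ker v"
begin

text \<open>Coordinates modulo \<open>ker v\<close>: \<open>h p\<close> is the component of
  \<open>p\<close> in \<open>l A_1\<close> divided by \<open>l\<close>, and \<open>e p\<close> below
  is the coefficient of \<open>nu\<close>. The value is unique because multiplication by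
  \<open>l\<close> is injective modulo \<open>ker v\<close>.\<close>

definition h :: "real ^ quad_mon \<Rightarrow> real ^ 4" where
  "h p = (SOME a. \<exists>r. p - (m11 l a + r *\<^sub>R nu) \<in> ker v)"

definition e :: "real ^ quad_mon \<Rightarrow> real" where
  "e p = B v p nu"

text \<open>The inner product on linear forms for which multiplication by \<open>l\<close> is an
  isometry into \<open>A_2/ker v\<close>.\<close>

definition Q :: "real ^ 4 \<Rightarrow> real ^ 4 \<Rightarrow> real" where
  "Q a b = B v (m11 l a) (m11 l b)"

lemma B_cong: "p - q \<in> ker v \<Longrightarrow> B v p y = B v q y"
  using kerD(1)[of "p - q" v y] by (simp add: B_simps)

lemma h_e: "p - (m11 l (h p) + e p *\<^sub>R nu) \<in> ker v"
proof -
  obtain r where r: "p - (m11 l (h p) + r *\<^sub>R nu) \<in> ker v"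
    using someI_ex[OF decomp[of p]] unfolding h_def by blast
  then have "e p = r" unfolding e_def using nu by (simp add: B_cong[OF r] B_simps B_commute[of v "m11 l (h p)"])
  then show ?thesis using r by simp
qed

lemma e_nu_l: "e (m11 l a) = 0" "e nu = 1" "x \<in> ker v \<Longrightarrow> e x = 0"
  using nu by (auto simp: e_def B_commute[of v "m11 l a"] kerD)

lemma linear_e: "linear e"
  by (rule linearI) (auto simp: e_def B_simps)

lemma h_unique: assumes "p - (m11 l a + r *\<^sub>R nu) \<in> ker v" shows "h p = a"
proof -
  have "(p - (m11 l a + r *\<^sub>R nu)) - (p - (m11 l (h p) + e p *\<^sub>R nu)) \<in> ker v"
    by (rule subspace_diff[OF subspace_ker assms h_e])
  moreover have "r = e p"
    using B_cong[OF assms, of nu] nu by (simp add: e_def B_simps B_commute[of v "m11 l a"])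
  ultimately have "m11 l (h p - a) \<in> ker v" by (simp add: m11_simps)
  then show ?thesis using inj[of "h p - a"] by simp
qed

lemma linear_h: "linear h"
proof (rule linearI)
  fix p q
  have "(p - (m11 l (h p) + e p *\<^sub>R nu)) + (q - (m11 l (h q) + e q *\<^sub>R nu)) \<in> ker v"
    by (rule subspace_add[OF subspace_ker h_e h_e])
  then show "h (p + q) = h p + h q"
    by (intro h_unique[of _ _ "e p + e q"]) (simp add: m11_simps algebra_simps)
next
  fix c p
  have "c *\<^sub>R (p - (m11 l (h p) + e p *\<^sub>R nu)) \<in> ker v"
    by (rule subspace_scale[OF subspace_ker h_e])
  then show "h (c *\<^sub>R p) = c *\<^sub>R h p"
    by (intro h_unique[of _ _ "c * e p"]) (simp add: m11_simps algebra_simps)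
qed

lemma h_l [simp]: "h (m11 l a) = a" "h nu = 0" "x \<in> ker v \<Longrightarrow> h x = 0"
  by (auto intro!: h_unique[of _ _ 0] h_unique[of nu 0 1] simp: m11_simps subspace_0[OF subspace_ker])

lemma B_Q: "B v p q = Q (h p) (h q) + e p * e q"
proof -
  have "B v p q = B v (m11 l (h p) + e p *\<^sub>R nu) (m11 l (h q) + e q *\<^sub>R nu)"
    using B_cong[OF h_e] B_commute by metis
  then show ?thesis using nu by (simp add: B_simps Q_def B_commute[of v "m11 l _" nu])
qed

lemma bilinear_Q: "bilinear Q"
  by (auto simp: bilinear_def Q_def m11_simps B_simps intro!: linearI)

lemmas Q_simps = bilinear_ladd[OF bilinear_Q] bilinear_radd[OF bilinear_Q]
  bilinear_lmul[OF bilinear_Q] bilinear_rmul[OF bilinear_Q]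
  bilinear_lzero[OF bilinear_Q] bilinear_rzero[OF bilinear_Q]
  bilinear_lsub[OF bilinear_Q] bilinear_rsub[OF bilinear_Q]
  bilinear_lneg[OF bilinear_Q] bilinear_rneg[OF bilinear_Q]

lemma Q_commute: "Q a b = Q b a"
  by (simp add: Q_def B_commute)

lemma Q_nondeg: assumes "\<And>a. Q a x = 0" shows "x = 0"
  using assms[of x] psd by (intro inj psd_ker) (auto simp: Q_def)

lemma Q_eqI: assumes "\<And>a. Q x a = Q y a" shows "x = y"
proof -
  have "x - y = 0" by (rule Q_nondeg) (simp add: Q_simps Q_commute[of _ x] Q_commute[of _ y] assms)
  then show ?thesis by simp
qed

text \<open>Modulo \<open>ker v\<close>, the product of \<open>a\<close> and \<open>b\<close> is \<open>l T a b + C a b \<nu>\<close>, where \<open>\<nu>\<close> is a unit vector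
  orthogonal to all multiples of \<open>l\<close>.\<close>

definition T :: "real ^ 4 \<Rightarrow> real ^ 4 \<Rightarrow> real ^ 4" where "T a b = h (m11 a b)"
definition C :: "real ^ 4 \<Rightarrow> real ^ 4 \<Rightarrow> real" where "C a b = e (m11 a b)"
text \<open>The vector that represents the functional \<open>C m\<close> with respect to
  \<open>Q\<close>; it exists since \<open>Q\<close> is nondegenerate.\<close>

definition c :: "real ^ 4 \<Rightarrow> real ^ 4" where "c m = (SOME d. \<forall>x. Q x d = C m x)"

lemma Q_c: "Q (c m) x = C m x"
proof -
  have "linear (C m)"
    by (rule linearI) (auto simp: C_def m11_simps linear_add[OF linear_e] linear_cmul[OF linear_e])
  then obtain d where "\<forall>x. Q x d = C m x" using riesz_form[OF bilinear_Q Q_nondeg] by metis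
  then have "\<forall>x. Q x (c m) = C m x" unfolding c_def by (rule someI)
  then show ?thesis by (simp add: Q_commute)
qed

lemma T_simps: "T (a + b) x = T a x + T b x" "T x (a + b) = T x a + T x b"
  "T (r *\<^sub>R a) x = r *\<^sub>R T a x" "T x (r *\<^sub>R a) = r *\<^sub>R T x a" "T l x = x" "T x l = x"
  "T 0 x = 0" "T x 0 = 0" "T x (a - b) = T x a - T x b" "T x (- a) = - T x a"
  by (simp_all add: T_def m11_simps linear_add[OF linear_h] linear_cmul[OF linear_h] m11_commute[of x l]
      linear_0[OF linear_h] linear_diff[OF linear_h] linear_neg[OF linear_h])

lemma C_simps: "C (a + b) x = C a x + C b x" "C x (a + b) = C x a + C x b"
  "C (r *\<^sub>R a) x = r * C a x" "C x (r *\<^sub>R a) = r * C x a" "C l x = 0" "C x l = 0"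
  "C 0 x = 0" "C x 0 = 0" "C x (a - b) = C x a - C x b"  "C (a - b) x = C a x - C b x"
  by (simp_all add: C_def m11_simps linear_add[OF linear_e] linear_cmul[OF linear_e] m11_commute[of x l]
      linear_0[OF linear_e] linear_diff[OF linear_e] e_nu_l)

lemma C_commute: "C a b = C b a" and T_commute: "T a b = T b a"
  by (simp_all add: C_def T_def m11_commute)

lemma linear_c: "linear c"
  by (rule linearI; rule Q_eqI) (simp_all add: Q_c Q_simps C_simps)

lemmas c_simps = linear_add[OF linear_c] linear_cmul[OF linear_c] linear_0[OF linear_c]
  linear_diff[OF linear_c]

lemma c_l: "c l = 0"
  by (rule Q_eqI) (simp add: Q_c C_simps Q_simps)

text \<open>Both sides are the value of \<open>v\<close> on the quartic \<open>n l a b\<close>, so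
  \<open>T n\<close> is self-adjoint.\<close>

lemma Q_T: "Q (T n a) b = Q a (T n b)"
proof -
  have "Q (T n a) b = B v (m11 n a) (m11 l b)" by (simp add: B_Q T_def e_nu_l)
  also have "\<dots> = B v (m11 l a) (m11 n b)" using B_swap[of v a n l b] by (simp add: m11_commute)
  also have "\<dots> = Q a (T n b)" by (simp add: B_Q T_def e_nu_l)
  finally show ?thesis .
qed

text \<open>The value of \<open>v\<close> on \<open>b x d y\<close> is computed from two pairings of
  the factors.\<close>

lemma relation: "Q (T b x) (T d y) + C b x * C d y = Q (T d x) (T b y) + C d x * C b y"
proof -
  have "B v (m11 b x) (m11 d y) = B v (m11 d x) (m11 b y)"
    using B_swap[of v x b d y] by (simp add: m11_commute)
  then show ?thesis by (simp add: B_Q T_def C_def)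
qed

text \<open>Self-adjointness moves one operator in \<open>relation\<close> across \<open>Q\<close>.
  The operators thus commute up to an error of rank at most two that is governed by
  \<open>c\<close>.\<close>

lemma commutator: "T m (T n a) = T n (T m a) + C m a *\<^sub>R c n - C n a *\<^sub>R c m"
proof (rule Q_eqI)
  fix b
  show "Q (T m (T n a)) b = Q (T n (T m a) + C m a *\<^sub>R c n - C n a *\<^sub>R c m) b"
    using relation[of n a m b] by (simp add: Q_T[of m] Q_T[of n] Q_simps Q_c)
qed

text \<open>The error that has to take the form
  \<open>\<tau> m *\<^sub>R c n - \<tau> n *\<^sub>R c m\<close> before
  \<open>contradiction_from_multiplier\<close> applies; \<open>jacobi\<close> is the constraint that
  forces this form.\<close>

definition u :: "real ^ 4 \<Rightarrow> real ^ 4 \<Rightarrow> real ^ 4" where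
  "u m n = T m (c n) - T n (c m)"

text \<open>The Jacobi identity for the operators \<open>T m1\<close>, \<open>T m2\<close>, \<open>T m3\<close>.\<close>

lemma jacobi:
  "C m3 a *\<^sub>R u m1 m2 + C m1 a *\<^sub>R u m2 m3 + C m2 a *\<^sub>R u m3 m1 +
   Q (u m1 m2) a *\<^sub>R c m3 + Q (u m2 m3) a *\<^sub>R c m1 + Q (u m3 m1) a *\<^sub>R c m2 = 0"
proof -
  have 1: "T m (T n (T k a)) = T m (T k (T n a)) + C n a *\<^sub>R T m (c k) - C k a *\<^sub>R T m (c n)" for m n k
    by (simp add: commutator[of n k] T_simps)
  have 2: "T m (T n (T k a)) = T n (T m (T k a)) + Q (T k (c m)) a *\<^sub>R c n - Q (T k (c n)) a *\<^sub>R c m" for m n k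
    by (subst commutator[of m n]) (simp add: Q_c[symmetric] Q_T)
  \<comment> \<open>\<open>L\<close> compares the triple products in the orders \<open>n m k\<close>
    and \<open>m k n\<close>, reordering first the inner and then the outer pair. Under cyclic
    permutation of the indices these differences cancel.\<close>
  define L where "L m n k = C n a *\<^sub>R T m (c k) - C k a *\<^sub>R T m (c n)
    - Q (T k (c m)) a *\<^sub>R c n + Q (T k (c n)) a *\<^sub>R c m" for m n k
  have "L m n k = T n (T m (T k a)) - T m (T k (T n a))" for m n k
    using 1[of m n k] 2[of m n k] by (simp add: L_def algebra_simps)
  then have "L m1 m2 m3 + L m2 m3 m1 + L m3 m1 m2 = 0" by simp
  moreover have "C m3 a *\<^sub>R u m1 m2 + C m1 a *\<^sub>R u m2 m3 + C m2 a *\<^sub>R u m3 m1 +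
      Q (u m1 m2) a *\<^sub>R c m3 + Q (u m2 m3) a *\<^sub>R c m1 + Q (u m3 m1) a *\<^sub>R c m2
      = - (L m1 m2 m3 + L m2 m3 m1 + L m3 m1 m2)"
    by (simp add: L_def u_def Q_simps algebra_simps)
  ultimately show ?thesis by simp
qed

text \<open>\<gamma> is the symmetric form of an operator extending multiplication by
  \<open>n\<close> from \<open>l A_1\<close> to all of \<open>A_2/ker v\<close>: it sends
  \<open>l a\<close> to \<open>l (T n a) + C n a nu\<close>, and \<open>nu\<close> to
  \<open>l (c n) + k nu\<close>. The assumptions on \<open>u\<close> are what the exchange law for
  \<gamma> requires. Extremality makes the operator a scalar \<open>r\<close>, and then
  \<open>n - r l\<close> multiplies all linear forms into the kernel.\<close>

lemma contradiction_from_multiplier: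
  assumes n: "n \<notin> span {l}" and \<tau>: "\<And>m. u n m = k *\<^sub>R c m - \<tau> m *\<^sub>R c n"
    and alt: "c n = 0 \<or> (\<forall>p m. u p m = \<tau> p *\<^sub>R c m - \<tau> m *\<^sub>R c p)"
  shows False
proof -
  define \<gamma> where "\<gamma> p q = Q (T n (h p)) (h q) + e p * Q (c n) (h q) + e q * Q (c n) (h p) + k * (e p * e q)" for p q
  have "bilinear \<gamma>"
    unfolding bilinear_def \<gamma>_def
    by (auto intro!: linearI simp: linear_add[OF linear_h] linear_add[OF linear_e] linear_cmul[OF linear_h]
        linear_cmul[OF linear_e] T_simps Q_simps algebra_simps)
  moreover have "\<gamma> (m11 b x) (m11 d y) = \<gamma> (m11 d x) (m11 b y)" for b d x y
  proof -
    have ex: "\<gamma> (m11 b x) (m11 d y) = Q (T b (T n x)) (T d y) + C n x * Q (T d (c b)) y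
        + C d y * Q (T b (c n)) x + k * (C b x * C d y)" for b d
    proof -
      have "\<gamma> (m11 b x) (m11 d y) = Q (T n (T b x)) (T d y) + C b x * Q (c n) (T d y)
          + C d y * Q (c n) (T b x) + k * (C b x * C d y)"
        by (simp add: \<gamma>_def T_def C_def)
      then show ?thesis
        by (simp add: commutator[of n b x] Q_simps Q_T algebra_simps)
    qed
    have uT: "Q (T n (c m)) z = Q (T m (c n)) z + k * C m z - \<tau> m * C n z" for m z
      using arg_cong[OF \<tau>[of m], of "\<lambda>w. Q w z"] by (simp add: u_def Q_simps Q_c)
    have rel: "Q (T b (T n x)) (T d y) - Q (T d (T n x)) (T b y)
        = Q (T n (c d)) x * C b y - Q (T n (c b)) x * C d y"
      using relation[of b "T n x" d y] by (simp add: Q_c[symmetric] Q_T)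
    have "C n x * (Q (T d (c b)) y - Q (T b (c d)) y - \<tau> d * C b y + \<tau> b * C d y) = 0"
    proof (cases "c n = 0")
      case True
      then have "C n x = 0" using Q_c[of n x] by (simp add: Q_simps)
      then show ?thesis by simp
    next
      case False
      then have "u d b = \<tau> d *\<^sub>R c b - \<tau> b *\<^sub>R c d" using alt by blast
      from arg_cong[OF this, of "\<lambda>w. Q w y"] show ?thesis by (simp add: u_def Q_simps Q_c)
    qed
    then show ?thesis
      unfolding ex using rel by (simp add: uT algebra_simps)
  qed
  then have "\<gamma> (m11 a b) (m11 c' d) = \<gamma> (m11 a c') (m11 b d)" for a b c' d
    by (metis m11_commute)
  moreover have "\<gamma> w y = 0" if "w \<in> ker v" for w y
    using that by (simp add: \<gamma>_def e_nu_l T_simps Q_simps)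
  ultimately obtain r where r: "\<And>x y. \<gamma> x y = r * B v x y"
    using indecomposable_form[OF ind] by metis
  have "C n a = 0" for a
    using r[of "m11 l a" nu] by (simp add: \<gamma>_def e_nu_l Q_simps Q_c B_Q)
  moreover have "T n a = r *\<^sub>R a" for a
  proof (rule Q_eqI)
    fix b show "Q (T n a) b = Q (r *\<^sub>R a) b"
      using r[of "m11 l a" "m11 l b"] by (simp add: \<gamma>_def e_nu_l Q_simps B_Q)
  qed
  ultimately have "m11 n a - m11 l (r *\<^sub>R a) \<in> ker v" for a
    using h_e[of "m11 n a"] by (simp add: T_def C_def)
  then have "m11 (n - r *\<^sub>R l) a \<in> ker v" for a by (simp add: m11_simps)
  then have "n - r *\<^sub>R l = 0" by (rule noZ)
  then show False using n by (auto simp: span_singleton)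
qed

text \<open>The rank of \<open>c\<close> decides; it is at most 3 because \<open>c l = 0\<close>.
  With rank at most one, \<open>e\<close> is a multiple of a point evaluation and the kernel has a
  real zero. With rank two or three, the Jacobi identity supplies the multiplier that leads to a
  contradiction.\<close>

lemma not_zero_free:
  assumes z: "zero_free (ker v)"
  shows False
proof -
  have sym: "C a b = C b a" for a b by (rule C_commute)
  have e0: "\<not> (\<forall>a b. C a b = 0)"
  proof
    assume "\<forall>a b. C a b = 0"
    then have "e nu = 0 * ev nu 0"
      by (intro real_zero_from_linear[OF linear_e]) (simp add: C_def)
    then show False by (simp add: e_nu_l)
  qed
  have dual: "\<exists>d. \<forall>x\<in>S. Q x d = f x" if S: "independent S" for S f
  proof -
    obtain g where g: "linear g" "\<forall>x\<in>S. g x = f x" using linear_independent_extend[OF S] by blast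
    show ?thesis using riesz_form[OF bilinear_Q Q_nondeg g(1)] g(2) by metis
  qed
  let ?K = "{m. c m = 0}"
  have rn: "dim (range c) + dim ?K = 4" using rank_nullity[OF linear_c] by simp
  have K: "subspace ?K" by (rule linear_subspace_kernel[OF linear_c])
  have R: "subspace (range c)" using linear_subspace_image[OF linear_c subspace_UNIV] .
  have l0: "l \<noteq> 0" 
    using inj[of "axis 1 1"] by (auto simp: m11_simps subspace_0[OF subspace_ker] axis_eq_0_iff)
  have lK: "l \<in> ?K" by (simp add: c_l)
  obtain Bs where Bs: "finite Bs" "Bs \<subseteq> range c" "independent Bs" "span Bs = range c" "card Bs = dim (range c)"
    using basis_subspace_exists[OF R] by metis
  consider "dim ?K \<ge> 3" | "dim ?K = 2" | "dim ?K \<le> 1" by linarith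
  then show False
  proof cases
    case 1
    then have "card Bs \<le> 1" using rn Bs(5) by linarith
    then obtain c0 where "Bs \<subseteq> {c0}" using Bs(1) by (metis card_le_Suc0_iff_eq One_nat_def subsetI singletonI insertI1 empty_iff)
    then have "range c \<subseteq> span {c0}" using Bs(4) span_mono by metis
    then have "\<forall>m. \<exists>r. c m = r *\<^sub>R c0" by (auto simp: span_singleton)
    then obtain \<zeta> where \<zeta>: "\<And>m. c m = \<zeta> m *\<^sub>R c0" by metis
    have C: "C m a = \<zeta> m * Q c0 a" for m a using Q_c[of m a] by (simp add: \<zeta> Q_simps)
    obtain a0 where a0: "Q c0 a0 \<noteq> 0" using e0 C by force
    \<comment> \<open>Symmetry of \<open>C\<close> makes \<zeta> proportional to
      \<open>Q c0\<close>, so \<open>C\<close> is \<open>s\<close> times the product of one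
      functional with itself.\<close>
    define s where "s = \<zeta> a0 / Q c0 a0"
    have "\<zeta> m = s * Q c0 m" for m using C[of m a0] C[of a0 m] sym[of m a0] a0 by (simp add: s_def field_simps)
    then have C': "C m a = s * Q c0 m * Q c0 a" for m a by (simp add: C)
    have "linear (Q c0)" using bilinear_Q by (simp add: bilinear_def)
    define z0 where "z0 = adjoint (Q c0) 1"
    have z0: "Q c0 a = z0 \<bullet> a" for a
      using adjoint_works[OF \<open>linear (Q c0)\<close>, of a 1] by (simp add: z0_def inner_commute)
    have ez: "e p = s * ev p z0" for p
      by (rule real_zero_from_linear[OF linear_e]) (simp add: C_def[symmetric] C' z0)
    then have "s \<noteq> 0" using e_nu_l(2) by force
    then have "ev w z0 = 0" if "w \<in> ker v" for w using ez[of w] e_nu_l(3)[OF that] by simp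
    moreover have "z0 \<noteq> 0" using a0 z0 by auto
    ultimately show False using z by (auto simp: zero_free_def)
  next
    case 2
    have "dim (span {l}) = 1" using l0 by simp
    then have "\<not> ?K \<subseteq> span {l}" using 2 dim_subset[of ?K "span {l}"] by auto
    then obtain n where n: "c n = 0" "n \<notin> span {l}" by blast
    have "card Bs = 2" using rn 2 Bs(5) by linarith
    then obtain c1 c2 where c12: "Bs = {c1, c2}" "c1 \<noteq> c2" by (meson card_2_iff)
    then obtain m1 m2 where m: "c1 = c m1" "c2 = c m2" using Bs(2) by auto
    obtain d1 where d1: "Q c1 d1 = 1" "Q c2 d1 = 0"
      using dual[OF Bs(3), of "\<lambda>x. if x = c1 then 1 else 0"] c12 by auto
    obtain d2 where d2: "Q c1 d2 = 0" "Q c2 d2 = 1"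
      using dual[OF Bs(3), of "\<lambda>x. if x = c1 then 0 else 1"] c12 by auto
    define x y where "x = T n c1" and "y = T n c2"
    \<comment> \<open>As \<open>c n = 0\<close>, the Jacobi identity involves only \<open>x\<close>
      and \<open>y\<close>. Read at vectors dual to \<open>c1\<close> and \<open>c2\<close>, it
      shows that \<open>T n\<close> acts on \<open>range c\<close> as a single scalar, which is the
      multiplier \<open>k\<close>, with \<tau> zero.\<close>
    have J: "- C m1 a *\<^sub>R y + C m2 a *\<^sub>R x - Q y a *\<^sub>R c1 + Q x a *\<^sub>R c2 = 0" for a
      using jacobi[of n a m1 m2] n(1) Q_c[of n a]
      by (simp add: u_def T_simps Q_simps x_def y_def m)
    have y: "y = - Q y d1 *\<^sub>R c1 + Q x d1 *\<^sub>R c2" and x: "x = Q y d2 *\<^sub>R c1 - Q x d2 *\<^sub>R c2"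
      using J[of d1] J[of d2] d1 d2 by (simp_all add: m Q_c algebra_simps add_eq_0_iff)
    have "Q y d1 = 0" using arg_cong[OF y, of "\<lambda>w. Q w d1"] d1 by (simp add: Q_simps)
    moreover have "Q x d2 = 0" using arg_cong[OF x, of "\<lambda>w. Q w d2"] d2 by (simp add: Q_simps)
    moreover have "Q x d1 = Q y d2" using arg_cong[OF x, of "\<lambda>w. Q w d1"] d1 by (simp add: Q_simps)
    ultimately have xy: "T n c1 = Q x d1 *\<^sub>R c1" "T n c2 = Q x d1 *\<^sub>R c2"
      using x y by (simp_all add: x_def y_def)
    have "T n w = Q x d1 *\<^sub>R w" if "w \<in> range c" for w
    proof -
      have "subspace {w. T n w = Q x d1 *\<^sub>R w}" by (auto simp: subspace_def T_simps algebra_simps)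
      then have "span Bs \<subseteq> {w. T n w = Q x d1 *\<^sub>R w}"
        using xy c12 by (intro span_minimal) auto
      then show ?thesis using that Bs(4) by blast
    qed
    then have "u n m = Q x d1 *\<^sub>R c m - 0 *\<^sub>R c n" for m
      using n(1) by (simp add: u_def T_simps)
    then show False by (rule contradiction_from_multiplier[OF n(2)]) (simp add: n(1))
  next
    case 3
    \<comment> \<open>The range of \<open>c\<close> is \<open>Q\<close>-orthogonal to
      \<open>l\<close>, so it is proper; hence the rank is exactly 3 and the kernel of
      \<open>c\<close> is the line of \<open>l\<close>.\<close>
    have "Q l l \<noteq> 0" using l0 psd psd_ker[OF psd, of "m11 l l"] inj[of l] by (auto simp: Q_def)
    then have "range c \<noteq> UNIV" using Q_c[of _ l] C_simps(6) by (metis UNIV_I rangeE)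
    then have "dim (range c) \<noteq> 4"
      using R dim_eq_full[of "range c"] by (auto simp: span_eq_iff[THEN iffD2])
    moreover have "dim (range c) \<le> 4" using rn by linarith
    ultimately have "card Bs = 3" and dK: "dim ?K = 1" using rn 3 Bs(5) by linarith+
    then obtain c1 c2 c3 where c123: "Bs = {c1, c2, c3}" "c1 \<noteq> c2" "c1 \<noteq> c3" "c2 \<noteq> c3"
      by (metis card_3_iff)
    then obtain m1 m2 m3 where m: "c1 = c m1" "c2 = c m2" "c3 = c m3" using Bs(2) by auto
    have Kl: "?K = span {l}"
      using subspace_dim_equal[of "span {l}" ?K] dK l0 lK K by (simp add: span_minimal)
    obtain d1 where d1: "Q c1 d1 = 1" "Q c2 d1 = 0" "Q c3 d1 = 0"
      using dual[OF Bs(3), of "\<lambda>x. if x = c1 then 1 else 0"] c123 by auto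
    obtain d2 where d2: "Q c1 d2 = 0" "Q c2 d2 = 1" "Q c3 d2 = 0"
      using dual[OF Bs(3), of "\<lambda>x. if x = c2 then 1 else 0"] c123 by auto
    obtain d3 where d3: "Q c1 d3 = 0" "Q c2 d3 = 0" "Q c3 d3 = 1"
      using dual[OF Bs(3), of "\<lambda>x. if x = c3 then 1 else 0"] c123 by auto
    note dd = d1 d2 d3
    define x y z where "x = u m1 m2" and "y = u m2 m3" and "z = u m3 m1"
    have J: "Q c3 a *\<^sub>R x + Q c1 a *\<^sub>R y + Q c2 a *\<^sub>R z + Q x a *\<^sub>R c3 + Q y a *\<^sub>R c1 + Q z a *\<^sub>R c2 = 0" for a
      using jacobi[of m3 a m1 m2] unfolding x_def y_def z_def by (simp add: m Q_c)
    have x: "x = - (Q x d3 *\<^sub>R c3 + Q y d3 *\<^sub>R c1 + Q z d3 *\<^sub>R c2)"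
      by (rule eq_neg_iff_add_eq_0[THEN iffD2]) (use J[of d3] d3 in \<open>simp add: add.assoc\<close>)
    have y: "y = - (Q x d1 *\<^sub>R c3 + Q y d1 *\<^sub>R c1 + Q z d1 *\<^sub>R c2)"
      by (rule eq_neg_iff_add_eq_0[THEN iffD2]) (use J[of d1] d1 in \<open>simp add: add.assoc\<close>)
    have z': "z = - (Q x d2 *\<^sub>R c3 + Q y d2 *\<^sub>R c1 + Q z d2 *\<^sub>R c2)"
      by (rule eq_neg_iff_add_eq_0[THEN iffD2]) (use J[of d2] d2 in \<open>simp add: add.assoc\<close>)
    \<comment> \<open>Of the nine coefficients three vanish and the others agree in pairs up to
      sign. The three numbers that remain are, up to sign, the values of \<tau> on
      \<open>m1\<close>, \<open>m2\<close> and \<open>m3\<close>.\<close>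
    have coef: "Q x d3 = 0" "Q y d1 = 0" "Q z d2 = 0" "Q x d1 = - Q y d3" "Q x d2 = - Q z d3" "Q y d2 = - Q z d1"
      using arg_cong[OF x, of "\<lambda>w. Q w d3"] arg_cong[OF y, of "\<lambda>w. Q w d1"] arg_cong[OF z', of "\<lambda>w. Q w d2"]
        arg_cong[OF x, of "\<lambda>w. Q w d1"] arg_cong[OF x, of "\<lambda>w. Q w d2"] arg_cong[OF y, of "\<lambda>w. Q w d2"] dd
      by (simp_all add: Q_simps)
    have sp: "\<exists>r0 r1 r2 r3. a = r0 *\<^sub>R l + r1 *\<^sub>R m1 + r2 *\<^sub>R m2 + r3 *\<^sub>R m3" for a
    proof -
      have "c a \<in> span {c1, c2, c3}" using Bs(4) c123 by auto
      then obtain s1 s2 s3 where s: "c a = s1 *\<^sub>R c1 + s2 *\<^sub>R c2 + s3 *\<^sub>R c3"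
        by (auto simp: span_insert algebra_simps)
      then have "a - (s1 *\<^sub>R m1 + s2 *\<^sub>R m2 + s3 *\<^sub>R m3) \<in> ?K" by (simp add: c_simps m)
      then obtain r where "a - (s1 *\<^sub>R m1 + s2 *\<^sub>R m2 + s3 *\<^sub>R m3) = r *\<^sub>R l"
        unfolding Kl span_singleton by auto
      then have "a = r *\<^sub>R l + s1 *\<^sub>R m1 + s2 *\<^sub>R m2 + s3 *\<^sub>R m3" by (simp add: algebra_simps)
      then show ?thesis by blast
    qed
    text \<open>The correction functional \<open>\<tau>\<close> is read off from the coefficients of \<open>u\<close> in the basis of \<open>range c\<close>.\<close>
    define r where "r a = Q (c a) d1 *\<^sub>R m1 + Q (c a) d2 *\<^sub>R m2 + Q (c a) d3 *\<^sub>R m3" for a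
    define \<tau> where "\<tau> a = Q (a - r a) l / Q l l - Q (c a) d1 * Q z d3 + Q (c a) d2 * Q y d3 + Q (c a) d3 * Q z d1" for a
    have r_simps: "r (a + b) = r a + r b" "r (t *\<^sub>R a) = t *\<^sub>R r a" for a b t
      by (simp_all add: r_def c_simps Q_simps algebra_simps)
    have \<tau>_simps: "\<tau> (a + b) = \<tau> a + \<tau> b" "\<tau> (t *\<^sub>R a) = t * \<tau> a" for a b t
      by (simp_all add: \<tau>_def r_simps c_simps Q_simps algebra_simps add_divide_distrib diff_divide_distrib)
    have rs: "r l = 0" "r m1 = m1" "r m2 = m2" "r m3 = m3"
      using dd by (simp_all add: r_def c_l Q_simps m[symmetric])
    have \<rho>: "\<tau> l = 1" "\<tau> m1 = - Q z d3" "\<tau> m2 = Q y d3" "\<tau> m3 = Q z d1"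
      using dd \<open>Q l l \<noteq> 0\<close> by (simp_all add: \<tau>_def rs c_l Q_simps m[symmetric])
    have uu: "u m1 m2 = \<tau> m1 *\<^sub>R c m2 - \<tau> m2 *\<^sub>R c m1" "u m2 m3 = \<tau> m2 *\<^sub>R c m3 - \<tau> m3 *\<^sub>R c m2"
       "u m3 m1 = \<tau> m3 *\<^sub>R c m1 - \<tau> m1 *\<^sub>R c m3"
      using x y z' coef \<rho> by (simp_all add: x_def[symmetric] y_def[symmetric] z_def[symmetric] m[symmetric])
    have anti: "u a b = - u b a" for a b by (simp add: u_def)
    have ul: "u l a = \<tau> l *\<^sub>R c a - \<tau> a *\<^sub>R c l" for a using \<rho> by (simp add: u_def T_simps c_l)
    have u_simps: "u (a + b) w = u a w + u b w" "u w (a + b) = u w a + u w b" "u (r *\<^sub>R a) w = r *\<^sub>R u a w"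
      "u w (r *\<^sub>R a) = r *\<^sub>R u w a" "u a a = 0" for a b w r
      by (simp_all add: u_def c_simps T_simps algebra_simps)
    have u3: "u p q = \<tau> p *\<^sub>R c q - \<tau> q *\<^sub>R c p" if "p \<in> {l, m1, m2, m3}" "q \<in> {l, m1, m2, m3}" for p q
      using that uu ul anti[of m2 m1] anti[of m3 m2] anti[of m1 m3] anti[of _ l]
      by (auto simp: u_simps)
    have u2: "u p a = \<tau> p *\<^sub>R c a - \<tau> a *\<^sub>R c p" if "p \<in> {l, m1, m2, m3}" for p a
    proof -
      obtain r0 r1 r2 r3 where a: "a = r0 *\<^sub>R l + r1 *\<^sub>R m1 + r2 *\<^sub>R m2 + r3 *\<^sub>R m3" using sp by blast
      have f: "u p l = \<tau> p *\<^sub>R c l - \<tau> l *\<^sub>R c p" "u p m1 = \<tau> p *\<^sub>R c m1 - \<tau> m1 *\<^sub>R c p"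
        "u p m2 = \<tau> p *\<^sub>R c m2 - \<tau> m2 *\<^sub>R c p" "u p m3 = \<tau> p *\<^sub>R c m3 - \<tau> m3 *\<^sub>R c p"
        using that by (intro u3; simp)+
      show ?thesis unfolding a by (simp only: u_simps f \<tau>_simps c_simps) (simp add: algebra_simps)
    qed
    have u1: "u b a = \<tau> b *\<^sub>R c a - \<tau> a *\<^sub>R c b" for a b
    proof -
      obtain r0 r1 r2 r3 where b: "b = r0 *\<^sub>R l + r1 *\<^sub>R m1 + r2 *\<^sub>R m2 + r3 *\<^sub>R m3" using sp by blast
      have f: "u l a = \<tau> l *\<^sub>R c a - \<tau> a *\<^sub>R c l" "u m1 a = \<tau> m1 *\<^sub>R c a - \<tau> a *\<^sub>R c m1"
        "u m2 a = \<tau> m2 *\<^sub>R c a - \<tau> a *\<^sub>R c m2" "u m3 a = \<tau> m3 *\<^sub>R c a - \<tau> a *\<^sub>R c m3"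
        by (intro u2; simp)+
      show ?thesis unfolding b by (simp only: u_simps f \<tau>_simps c_simps) (simp add: algebra_simps)
    qed
    have "m1 \<notin> span {l}"
    proof
      assume "m1 \<in> span {l}"
      then have "c1 = 0" using Kl m(1) by auto
      then show False using d1 by (simp add: Q_simps)
    qed
    then show False by (rule contradiction_from_multiplier) (use u1 in blast)+
  qed
qed

end

section \<open>Linear forms in the apolar ideal, and the flat case\<close>

definition Zk :: "real ^ quartic_mon \<Rightarrow> (real ^ 4) set" where
  "Zk v = {m. \<forall>a. m11 m a \<in> ker v}"

lemma subspace_Zk: "subspace (Zk v)"
  using subspace_ker[of v] by (auto simp: subspace_def Zk_def m11_simps)

lemma ZkD: "m \<in> Zk v \<Longrightarrow> m11 m a \<in> ker v" "m \<in> Zk v \<Longrightarrow> m11 a m \<in> ker v"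
  by (auto simp: Zk_def m11_commute[of a m])

lemma ker_all:
  assumes "\<And>a b. m11 a b \<in> ker v" shows "v = 0"
proof (rule ker_eq_UNIV)
  have "span {m11 a b | a b. True} \<subseteq> ker v"
    using assms by (intro span_minimal subspace_ker) auto
  then show "ker v = UNIV" unfolding span_m11 by auto
qed

lemma subspace_Nl: "subspace {m. m11 l m \<in> ker v}"
  using subspace_ker[of v] by (auto simp: subspace_def m11_simps)

text \<open>If \<open>A_2 = l A_1 + ker v\<close>, every quadric can be divided by \<open>l\<close>
  modulo the kernel. Multiplication by \<open>n\<close> after this division obeys the exchange law,
  hence is a scalar \<open>r\<close> by extremality, and \<open>n - r l\<close> lies in
  \<open>Zk v\<close>. So \<open>l\<close> spans the linear forms modulo \<open>Zk v\<close>, and a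
  vector orthogonal to \<open>Zk v\<close> is a zero of the kernel.\<close>

lemma flat_kernel_zero:
  assumes v: "psd v" "v \<noteq> 0" and ind: "ann (ker v) = span {v}"
    and l: "\<And>m. m11 l m \<in> ker v \<Longrightarrow> m \<in> Zk v"
    and flat: "\<And>p. \<exists>a. p - m11 l a \<in> ker v"
  shows "\<not> zero_free (ker v)"
proof -
  define h where "h p = (SOME a. p - m11 l a \<in> ker v)" for p
  have h: "p - m11 l (h p) \<in> ker v" for p unfolding h_def using flat by (rule someI_ex)
  have Bh: "B v p y = B v (m11 l (h p)) y" "B v y p = B v y (m11 l (h p))" for p y
    using kerD[OF h[of p], of y] by (simp_all add: B_simps)
  have hZ: "h p - a \<in> Zk v" if "p - m11 l a \<in> ker v" for p a
    using subspace_diff[OF subspace_ker that h[of p]] by (intro l) (simp add: m11_simps)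
  \<comment> \<open>The quotient \<open>h p\<close> is determined only modulo \<open>Zk v\<close>;
    the pairing does not see this ambiguity, which is why \<gamma> is bilinear although
    \<open>h\<close> is a mere choice.\<close>
  have Bn: "B v (m11 n (h p)) q = B v (m11 n a) q" if "p - m11 l a \<in> ker v" for n p q a
    using kerD(1)[OF ZkD(2)[OF hZ[OF that], of n], of q] by (simp add: B_simps m11_simps)
  have scal: "\<exists>r. n - r *\<^sub>R l \<in> Zk v" for n
  proof -
    define \<gamma> where "\<gamma> p q = B v (m11 n (h p)) q" for p q
    have "\<gamma> (p + p') q = \<gamma> p q + \<gamma> p' q" for p p' q
      using Bn[of "p + p'" "h p + h p'" n q] subspace_add[OF subspace_ker h[of p] h[of p']]
      by (simp add: \<gamma>_def m11_simps B_simps algebra_simps)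
    moreover have "\<gamma> (s *\<^sub>R p) q = s * \<gamma> p q" for s p q
      using Bn[of "s *\<^sub>R p" "s *\<^sub>R h p" n q] subspace_scale[OF subspace_ker h[of p], of s]
      by (simp add: \<gamma>_def m11_simps B_simps algebra_simps)
    ultimately have "bilinear \<gamma>"
      unfolding bilinear_def by (auto intro!: linearI simp: \<gamma>_def B_simps)
    moreover have "\<gamma> (m11 a b) (m11 c d) = \<gamma> (m11 a c) (m11 b d)" for a b c d
    proof -
      have e: "\<gamma> (m11 a b) (m11 c d) = B v (m11 a d) (m11 b (h (m11 n c)))" for b c
      proof -
        have "\<gamma> (m11 a b) (m11 c d) = B v (m11 (h (m11 a b)) d) (m11 n c)"
          unfolding \<gamma>_def by (metis B_swap m11_commute)
        also have "\<dots> = B v (m11 (h (m11 a b)) d) (m11 l (h (m11 n c)))" by (rule Bh(2))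
        also have "\<dots> = B v (m11 l (h (m11 a b))) (m11 d (h (m11 n c)))" by (metis B_swap m11_commute)
        also have "\<dots> = B v (m11 a b) (m11 d (h (m11 n c)))" by (rule Bh(1)[symmetric])
        also have "\<dots> = B v (m11 a d) (m11 b (h (m11 n c)))" by (rule B_swap)
        finally show ?thesis .
      qed
      \<comment> \<open>Pairing either summand with \<open>l g\<close> gives the value of
        \<open>v\<close> on \<open>b c g n\<close>, so the difference pairs to zero with all of
        \<open>l A_1\<close>, hence with every quadric.\<close>
      define x where "x = m11 b (h (m11 n c)) - m11 c (h (m11 n b))"
      have "B v y x = 0" for y
      proof -
        have "B v (m11 l g) (m11 b (h (m11 n c))) = B v (m11 b g) (m11 n c)" for b c g
          using Bh(2)[of "m11 b g" "m11 n c"] by (metis B_swap m11_commute)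
        then have "B v (m11 l (h y)) x = 0"
          unfolding x_def by (simp add: B_simps) (metis B_swap m11_commute B_commute)
        then show ?thesis using Bh(1)[of y x] by simp
      qed
      then have "B v (m11 a d) x = 0" .
      then show ?thesis unfolding e[of b c] e[of c b] x_def by (simp add: B_simps)
    qed
    moreover have "\<gamma> w y = 0" if "w \<in> ker v" for w y
      using Bn[of w 0 n y] that by (simp add: \<gamma>_def m11_simps B_simps)
    ultimately obtain r where r: "\<And>x y. \<gamma> x y = r * B v x y" using indecomposable_form[OF ind] by metis
    have "m11 (n - r *\<^sub>R l) a \<in> ker v" for a
    proof -
      have "B v (m11 n a) y = r * B v (m11 l a) y" for y
        using r[of "m11 l a" y] Bn[of "m11 l a" a n y] subspace_0[OF subspace_ker] by (simp add: \<gamma>_def)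
      then show ?thesis by (simp add: ker_def B_simps m11_simps)
    qed
    then show ?thesis by (auto simp: Zk_def)
  qed
  have "Zk v \<noteq> UNIV" using ker_all v(2) by (auto simp: Zk_def)
  then obtain z where z: "z \<noteq> 0" "\<And>y. y \<in> Zk v \<Longrightarrow> orthogonal z y"
    using orthogonal_to_subspace_exists_gen[of "Zk v" UNIV] span_eq_iff[THEN iffD2, OF subspace_Zk[of v]] by auto
  have "z \<bullet> l \<noteq> 0"
  proof
    assume "z \<bullet> l = 0"
    moreover obtain r where "z - r *\<^sub>R l \<in> Zk v" using scal by blast
    ultimately have "z \<bullet> z = 0" using z(2)[of "z - r *\<^sub>R l"] by (simp add: orthogonal_def inner_simps)
    then show False using z(1) by simp
  qed
  \<comment> \<open>\<open>k p\<close> is \<open>p\<close> minus the multiple of the square of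
    \<open>l\<close> with the same value at \<open>z\<close>; it lies in the kernel on products,
    hence always. An element of the kernel not vanishing at \<open>z\<close> would put the square of
    \<open>l\<close>, and then \<open>l\<close> itself, in the wrong space.\<close>
  define k where "k p = p - (ev p z / (z \<bullet> l)\<^sup>2) *\<^sub>R m11 l l" for p
  have lin: "linear k"
    unfolding k_def by (rule linearI)
      (simp_all add: linear_add[OF linear_ev] linear_cmul[OF linear_ev] algebra_simps add_divide_distrib)
  have "k (m11 a b) \<in> ker v" for a b
  proof -
    have *: "x - ((z \<bullet> x) / (z \<bullet> l)) *\<^sub>R l \<in> Zk v" for x
    proof -
      obtain r where r: "x - r *\<^sub>R l \<in> Zk v" using scal by blast
      then have "r = (z \<bullet> x) / (z \<bullet> l)"
        using z(2)[OF r] \<open>z \<bullet> l \<noteq> 0\<close> by (simp add: orthogonal_def inner_simps field_simps)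
      then show ?thesis using r by simp
    qed
    define r s where "r = (z \<bullet> a) / (z \<bullet> l)" and "s = (z \<bullet> b) / (z \<bullet> l)"
    have "k (m11 a b) = m11 (a - r *\<^sub>R l) b + r *\<^sub>R m11 l (b - s *\<^sub>R l)"
      using \<open>z \<bullet> l \<noteq> 0\<close>
      by (simp add: k_def m11_simps r_def s_def inner_commute power2_eq_square algebra_simps)
    also have "\<dots> \<in> ker v"
      using *[of a] *[of b] unfolding r_def s_def
      by (intro subspace_add[OF subspace_ker] subspace_scale[OF subspace_ker] ZkD)
    finally show ?thesis .
  qed
  then have "{m11 a b | a b. True} \<subseteq> {p. k p \<in> ker v}" by auto
  moreover have "subspace {p. k p \<in> ker v}"
    using linear_subspace_vimage[OF lin subspace_ker[of v]] by (simp add: vimage_def)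
  ultimately have "span {m11 a b | a b. True} \<subseteq> {p. k p \<in> ker v}" by (intro span_minimal)
  then have k: "k p \<in> ker v" for p unfolding span_m11 by auto
  have "ev w z = 0" if w: "w \<in> ker v" for w
  proof (rule ccontr)
    assume ne: "ev w z \<noteq> 0"
    have "(ev w z / (z \<bullet> l)\<^sup>2) *\<^sub>R m11 l l \<in> ker v"
      using subspace_diff[OF subspace_ker w k[of w]] by (simp add: k_def)
    from subspace_scale[OF subspace_ker this, of "(z \<bullet> l)\<^sup>2 / ev w z"]
    have "m11 l l \<in> ker v" using ne \<open>z \<bullet> l \<noteq> 0\<close> by simp
    then have "l \<in> Zk v" by (rule l)
    then show False using z(2)[of l] \<open>z \<bullet> l \<noteq> 0\<close> by (simp add: orthogonal_def)
  qed
  then show ?thesis using z(1) by (auto simp: zero_free_def)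
qed

text \<open>If the kernel of \<open>a \<mapsto> l a\<close> modulo \<open>ker v\<close> has minimal dimension, a perturbation \<open>l + t a\<close>
  of \<open>l\<close> shows that it consists of linear forms all of whose multiples lie in \<open>ker v\<close>.\<close>

lemma generic_linear_form:
  assumes v: "psd v"
  obtains l where "\<And>m. m11 l m \<in> ker v \<Longrightarrow> m \<in> Zk v"
proof -
  define N where "N l = {m. m11 l m \<in> ker v}" for l
  have sN: "subspace (N l)" for l unfolding N_def by (rule subspace_Nl)
  obtain l where min: "\<And>l'. dim (N l) \<le> dim (N l')"
    using ex_has_least_nat[of "\<lambda>_. True" undefined "\<lambda>l. dim (N l)"] by blast
  have "m11 m a \<in> ker v" if m: "m \<in> N l" for m a
  proof (rule ccontr)
    assume am: "m11 m a \<notin> ker v"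
    let ?C = "{y. \<forall>x\<in>N l. orthogonal y x}"
    have C: "subspace ?C" by (rule subspace_orthogonal_complement)
    define A where "A = B v (m11 a m) (m11 a m)"
    have A: "A > 0" unfolding A_def using psd_pos[OF v am] by (simp add: m11_commute)
    define Q where "Q x y = B v (m11 l x) (m11 l y)" for x y
    have Q: "bilinear Q" by (auto simp: bilinear_def Q_def m11_simps B_simps intro!: linearI)
    have "0 < Q x x" if "x \<in> ?C" "x \<noteq> 0" for x
      unfolding Q_def using that orthogonal_self[of x] by (intro psd_pos v) (auto simp: N_def)
    then obtain q where q: "q > 0" "\<And>x. x \<in> ?C \<Longrightarrow> q * (norm x)\<^sup>2 \<le> Q x x"
      using pd_bound[OF Q C] by blast
    define Q1 where "Q1 x y = B v (m11 l x) (m11 a y)" for x y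
    have "bilinear Q1" by (auto simp: bilinear_def Q1_def m11_simps B_simps intro!: linearI)
    then obtain M where M: "M > 0" "\<And>x y. norm (Q1 x y) \<le> norm x * norm y * M"
      using bounded_bilinear.pos_bounded[OF bilinear_conv_bounded_bilinear[THEN iffD1]] by metis
    define Q2 where "Q2 y = B v (m11 a m) (m11 a y)" for y
    have "linear Q2" by (rule linearI) (auto simp: Q2_def m11_simps B_simps)
    then obtain K where K: "K > 0" "\<And>y. \<bar>Q2 y\<bar> \<le> norm y * K"
      using bounded_linear.pos_bounded[OF linear_conv_bounded_linear[THEN iffD1]] by (metis real_norm_def)
    \<comment> \<open>The bounds leave a quarter of \<open>q |y|^2\<close> for each of the estimates
      2 and 3, and half of \<open>r^2 t^2 A\<close> for the latter; the remaining halves are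
      positive.\<close>
    define t where "t = min 1 (min (q / (8 * M)) (q * A / (8 * K\<^sup>2)))"
    have t: "0 < t" "t \<le> 1" "8 * M * t \<le> q" "8 * K\<^sup>2 * t \<le> q * A"
    proof -
      show "0 < t" using q(1) M(1) K(1) A by (simp add: t_def)
      show "t \<le> 1" by (simp add: t_def)
      have "t \<le> q / (8 * M)" "t \<le> q * A / (8 * K\<^sup>2)" by (auto simp: t_def)
      then show "8 * M * t \<le> q" "8 * K\<^sup>2 * t \<le> q * A"
        using M(1) K(1) by (simp_all add: field_simps)
    qed
    let ?l = "l + t *\<^sub>R a"
    have key: "r = 0 \<and> y = 0" if y: "y \<in> ?C" and z: "y + r *\<^sub>R m \<in> N ?l" for y r
    proof -
      have lm: "B v (m11 l m) x = 0" "B v x (m11 l m) = 0" for x using m kerD by (auto simp: N_def)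
      \<comment> \<open>Since \<open>l m\<close> is in the radical, the interaction of
        \<open>r m\<close> with \<open>y\<close> has no term of first order in \<open>t\<close>.
        What is left has order \<open>t^2\<close>, as has the positive term \<open>r^2 t^2 A\<close>
        that must dominate it.\<close>
      have mix: "B v (m11 a m) (m11 l y) = 0"
        using lm(1)[of "m11 a y"] B_swap[of v m a l y] by (simp add: m11_commute)
      have "0 = B v (m11 ?l (y + r *\<^sub>R m)) (m11 ?l (y + r *\<^sub>R m))"
        using z kerD(1) by (simp add: N_def)
      also have "\<dots> = r\<^sup>2 * t\<^sup>2 * A + 2 * r * t\<^sup>2 * Q2 y + Q y y + 2 * t * Q1 y y + t\<^sup>2 * B v (m11 a y) (m11 a y)"
      proof -
        have c: "B v (m11 l y) (m11 a m) = 0" "B v (m11 a y) (m11 l y) = B v (m11 l y) (m11 a y)"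
            "B v (m11 a y) (m11 a m) = B v (m11 a m) (m11 a y)"
          using mix by (simp_all only: B_commute)
        show ?thesis
          by (simp add: m11_simps B_simps lm mix c Q2_def Q_def Q1_def A_def power2_eq_square algebra_simps)
      qed
      finally have eq: "0 = r\<^sup>2 * t\<^sup>2 * A + 2 * r * t\<^sup>2 * Q2 y + Q y y + 2 * t * Q1 y y + t\<^sup>2 * B v (m11 a y) (m11 a y)" .
      let ?n = "norm y"
      have 1: "q * ?n\<^sup>2 \<le> Q y y" using q y by simp
      have 2: "- (q / 4 * ?n\<^sup>2) \<le> 2 * t * Q1 y y"
      proof -
        have "\<bar>2 * t * Q1 y y\<bar> \<le> 2 * t * (?n * ?n * M)"
          using M(2)[of y y] t(1) by (simp add: abs_mult)
        also have "\<dots> = (8 * M * t) / 4 * ?n\<^sup>2" by (simp add: power2_eq_square)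
        also have "\<dots> \<le> q / 4 * ?n\<^sup>2" using t(3) by (intro mult_right_mono) auto
        finally show ?thesis by linarith
      qed
      have 3: "- (r\<^sup>2 * t\<^sup>2 * A / 2 + q / 4 * ?n\<^sup>2) \<le> 2 * r * t\<^sup>2 * Q2 y"
      proof -
        have "\<bar>2 * r * t\<^sup>2 * Q2 y\<bar> = t\<^sup>2 * (2 * \<bar>r\<bar> * \<bar>Q2 y\<bar>)" by (simp add: abs_mult)
        also have "\<dots> \<le> t\<^sup>2 * (r\<^sup>2 * A / 2 + 2 * (Q2 y)\<^sup>2 / A)"
        proof (rule mult_left_mono)
          have "0 \<le> (\<bar>r\<bar> * A - 2 * \<bar>Q2 y\<bar>)\<^sup>2" by simp
          then have "4 * \<bar>r\<bar> * A * \<bar>Q2 y\<bar> \<le> r\<^sup>2 * A\<^sup>2 + 4 * (Q2 y)\<^sup>2"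
            by (simp add: power2_eq_square algebra_simps)
          then show "2 * \<bar>r\<bar> * \<bar>Q2 y\<bar> \<le> r\<^sup>2 * A / 2 + 2 * (Q2 y)\<^sup>2 / A"
            using A by (simp add: field_simps power2_eq_square)
        qed simp
        also have "\<dots> \<le> r\<^sup>2 * t\<^sup>2 * A / 2 + q / 4 * ?n\<^sup>2"
        proof -
          have "t\<^sup>2 * (2 * (Q2 y)\<^sup>2 / A) \<le> t * (2 * (?n * K)\<^sup>2 / A)"
          proof (rule mult_mono)
            show "t\<^sup>2 \<le> t" using t by (simp add: power2_eq_square mult_left_le)
            have "(Q2 y)\<^sup>2 \<le> (?n * K)\<^sup>2" using K(2)[of y] K(1) by (intro abs_le_square_iff[THEN iffD1]) simp
            then show "2 * (Q2 y)\<^sup>2 / A \<le> 2 * (?n * K)\<^sup>2 / A" using A by (simp add: divide_right_mono)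
          qed (use t A in auto)
          also have "\<dots> = (8 * K\<^sup>2 * t) / (4 * A) * ?n\<^sup>2" by (simp add: power2_eq_square)
          also have "\<dots> \<le> (q * A) / (4 * A) * ?n\<^sup>2"
            using t(4) A by (intro mult_right_mono divide_right_mono) auto
          also have "\<dots> = q / 4 * ?n\<^sup>2" using A by simp
          finally show ?thesis by (simp add: algebra_simps)
        qed
        finally show ?thesis by linarith
      qed
      have "0 \<le> t\<^sup>2 * B v (m11 a y) (m11 a y)" using v by (simp add: psd_def)
      then have "r\<^sup>2 * t\<^sup>2 * A / 2 + q / 2 * ?n\<^sup>2 \<le> 0" using 1 2 3 eq by (simp add: field_simps)
      moreover have "0 \<le> r\<^sup>2 * t\<^sup>2 * A / 2" "0 \<le> q / 2 * ?n\<^sup>2" using A q by auto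
      ultimately have "r\<^sup>2 * t\<^sup>2 * A / 2 = 0" "q / 2 * ?n\<^sup>2 = 0" by linarith+
      then show ?thesis using A q t by simp
    qed
    have m0: "m \<noteq> 0" using am by (auto simp: m11_simps subspace_0[OF subspace_ker])
    have "dim (span (insert m ?C)) = dim ?C + 1"
    proof -
      have "m \<notin> span ?C" using m m0 orthogonal_self[of m] by (auto simp: span_eq_iff[THEN iffD2, OF C])
      then show ?thesis by (simp add: dim_insert)
    qed
    \<comment> \<open>A space one dimension larger than the complement of \<open>N l\<close> misses
      \<open>N (l + t a)\<close>, so the latter has smaller dimension than \<open>N l\<close>,
      contrary to minimality.\<close>
    moreover have "span (insert m ?C) \<inter> N ?l = {0}"
    proof -
      have "x = 0" if x: "x \<in> span (insert m ?C)" "x \<in> N ?l" for x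
      proof -
        obtain r where "x - r *\<^sub>R m \<in> ?C" using x(1) by (auto simp: span_insert span_eq_iff[THEN iffD2, OF C])
        then show ?thesis using key[of "x - r *\<^sub>R m" r] x(2) by auto
      qed
      then show ?thesis using subspace_0[OF sN] span_zero by blast
    qed
    ultimately have "dim {x + y |x y. x \<in> span (insert m ?C) \<and> y \<in> N ?l} = dim ?C + 1 + dim (N ?l)"
      using dim_sums_Int[OF subspace_span sN, of "insert m ?C" ?l] by simp
    moreover have "dim {x + y |x y. x \<in> span (insert m ?C) \<and> y \<in> N ?l} \<le> 4"
      using dim_subset_UNIV[of "{x + y |x y. x \<in> span (insert m ?C) \<and> y \<in> N ?l}"] by simp
    moreover have "dim ?C + dim (N l) = 4" using dim_orthogonal_complement[OF sN, of l] by simp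
    ultimately show False using min[of ?l] by linarith
  qed
  then show ?thesis using that[of l] by (auto simp: N_def Zk_def)
qed

lemma forms_expansion:
  fixes p :: "('v::finite, real) mpoly"
  assumes "p \<in> forms d"
  shows "p = (\<Sum>n\<in>{n. mon_degree n = d}. Poly_Mapping.lookup p n *\<^sub>R Poly_Mapping.single n 1)"
proof (rule poly_mapping_eqI)
  fix m
  show "Poly_Mapping.lookup p m = Poly_Mapping.lookup
      (\<Sum>n\<in>{n. mon_degree n = d}. Poly_Mapping.lookup p n *\<^sub>R Poly_Mapping.single n 1) m"
    using assms finite_mon_degree[of d, where 'v = 'v]
    by (auto simp: lookup_sum lookup_single when_def if_distrib sum.delta forms_iff cong: if_cong)
qed

section \<open>Dimension counts for products and the bound on zero-free kernels\<close>

lemma ann_orthogonal: "b \<in> ann U \<longleftrightarrow> (\<forall>y \<in> {m22 u y | u y. u \<in> U}. orthogonal b y)"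
  by (auto simp: ann_def B_def orthogonal_def)

lemma ann_nontrivial:
  assumes "dim {m22 u y | u y. u \<in> U} < 35"
  obtains b where "b \<noteq> 0" "b \<in> ann U"
proof -
  have "dim {m22 u y | u y. u \<in> U} < DIM(real ^ quartic_mon)"
    using assms by (simp add: CARD_quartic_mon)
  then obtain b where "b \<noteq> 0" "\<And>y. y \<in> span {m22 u y | u y. u \<in> U} \<Longrightarrow> orthogonal b y"
    using orthogonal_to_subspace_exists by blast
  then have "b \<in> ann U" by (auto simp: ann_orthogonal intro: span_base)
  with \<open>b \<noteq> 0\<close> show ?thesis by (rule that)
qed

text \<open>At most 33 dimensions of products leave room to choose the functional orthogonal to
  \<open>v\<close> as well.\<close>

lemma ann_not_line:
  assumes "dim {m22 u y | u y. u \<in> U} < 34"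
  obtains b where "b \<in> ann U" "b \<notin> span {v}"
proof -
  let ?S = "insert v {m22 u y | u y. u \<in> U}"
  have "dim ?S < DIM(real ^ quartic_mon)"
    using assms dim_insert[of v "{m22 u y | u y. u \<in> U}"] by (simp add: CARD_quartic_mon split: if_splits)
  then obtain b where b: "b \<noteq> 0" "\<And>y. y \<in> span ?S \<Longrightarrow> orthogonal b y"
    using orthogonal_to_subspace_exists by blast
  have "b \<notin> span {v}"
  proof
    assume "b \<in> span {v}"
    then have "b \<in> span ?S" using span_mono[of "{v}" ?S] by auto
    then show False using b orthogonal_self[of b] by blast
  qed
  moreover have "b \<in> ann U" using b(2) by (auto simp: ann_orthogonal intro: span_base)
  ultimately show ?thesis using that by blast
qed

text \<open>Quartics divisible by \<open>m\<close> lie in \<open>m A_3\<close>, and cubics have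
  dimension 20.\<close>

lemma m22_multiples_span:
  obtains M where "finite M" "card M \<le> 20" "\<And>a y. m22 (m11 m a) y \<in> span M"
proof
  let ?M = "(\<lambda>n. vec4 (lf m * Poly_Mapping.single n 1)) ` {n. mon_degree n = 3}"
  show "finite ?M" by (intro finite_imageI finite_mon_degree)
  show "card ?M \<le> 20" using card_image_le[OF finite_mon_degree] card_mon_degree_3 by metis
  fix a y
  have "lf a * qf y \<in> forms (1 + 2)" by (intro forms_mult i1.form_of_forms i2.form_of_forms)
  then have "lf a * qf y \<in> forms 3" by (simp add: numeral_3_eq_3)
  then have "lf a * qf y = (\<Sum>n\<in>{n. mon_degree n = 3}. Poly_Mapping.lookup (lf a * qf y) n *\<^sub>R Poly_Mapping.single n 1)"
    by (rule forms_expansion)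
  then have "lf m * (lf a * qf y) = (\<Sum>n\<in>{n. mon_degree n = 3}. Poly_Mapping.lookup (lf a * qf y) n *\<^sub>R (lf m * Poly_Mapping.single n 1))"
    by (metis (no_types, lifting) scaleR_mult_right sum.cong sum_distrib_left)
  then have "m22 (m11 m a) y = (\<Sum>n\<in>{n. mon_degree n = 3}. Poly_Mapping.lookup (lf a * qf y) n *\<^sub>R vec4 (lf m * Poly_Mapping.single n 1))"
    by (simp add: m22_def mult.assoc linear_sum[OF linear_coords] linear_cmul[OF linear_coords])
  also have "\<dots> \<in> span ?M" by (intro span_sum span_scale span_base) auto
  finally show "m22 (m11 m a) y \<in> span ?M" .
qed

lemma dim_range_m11:
  assumes "m \<noteq> 0" shows "dim (range (m11 m)) = 4"
  using rank_nullity[OF linear_m11_right, of m] assms by (simp add: m11_eq_0)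

lemma bilinear_span_span:
  assumes f: "bilinear f" and "x \<in> span S" "y \<in> span T"
  shows "f x y \<in> span {f s t | s t. s \<in> S \<and> t \<in> T}"
proof -
  let ?R = "span {f s t | s t. s \<in> S \<and> t \<in> T}"
  have "f s y \<in> ?R" if "s \<in> S" for s
  proof -
    have "subspace {y. f s y \<in> ?R}"
      by (auto simp: subspace_def bilinear_rzero[OF f] bilinear_radd[OF f] bilinear_rmul[OF f]
          span_zero span_add span_scale)
    then have "span T \<subseteq> {y. f s y \<in> ?R}"
      using that by (intro span_minimal) (auto intro: span_base)
    then show ?thesis using assms by auto
  qed
  moreover have "subspace {x. f x y \<in> ?R}"
    by (auto simp: subspace_def bilinear_lzero[OF f] bilinear_ladd[OF f] bilinear_lmul[OF f]
        span_zero span_add span_scale)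
  ultimately have "span S \<subseteq> {x. f x y \<in> ?R}" by (intro span_minimal) auto
  then show ?thesis using assms by auto
qed

text \<open>Modulo \<open>m A_3\<close> only products of complements of \<open>m A_1\<close> matter,
  which have dimension at most 2 in \<open>K\<close> and 6 in the quadrics. The total is at most 20
  + 2 * 6 = 32.\<close>

lemma dim_products_with_multiples:
  assumes K: "subspace K" "range (m11 m) \<subseteq> K" and m: "m \<noteq> 0" and d: "dim K \<le> 6"
  shows "dim {m22 u y | u y. u \<in> K} < 34"
proof -
  let ?M = "range (m11 m)"
  have sM: "subspace ?M" using linear_subspace_image[OF linear_m11_right subspace_UNIV] .
  let ?D = "{y \<in> UNIV. \<forall>x\<in>?M. orthogonal x y}" and ?K = "{y \<in> K. \<forall>x\<in>?M. orthogonal x y}"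
  have dims: "dim ?D = 6" "dim ?K \<le> 2"
    using dim_subspace_orthogonal_to_vectors[OF sM subspace_UNIV] dim_range_m11[OF m]
      dim_subspace_orthogonal_to_vectors[OF sM K] d by (simp_all add: CARD_quad_mon)
  have sD: "subspace ?D" using subspace_orthogonal_to_vectors[of ?M] by simp
  have sK: "subspace ?K" using subspace_inter[OF K(1) subspace_orthogonal_to_vectors[of ?M]] by (simp add: Int_def)
  obtain BD where BD: "finite BD" "span BD = ?D" "card BD = dim ?D"
    by (rule basis_subspace_exists[OF sD])
  obtain BK where BK: "finite BK" "span BK = ?K" "card BK = dim ?K"
    by (rule basis_subspace_exists[OF sK])
  obtain M where M: "finite M" "card M \<le> 20" "\<And>a y. m22 (m11 m a) y \<in> span M"
    using m22_multiples_span[of m] by blast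
  let ?P = "(\<lambda>(u, y). m22 u y) ` (BK \<times> BD)"
  have "m22 w y \<in> span (M \<union> ?P)" if w: "w \<in> K" for w y
  proof -
    have dec: "\<exists>a k. w = m11 m a + k \<and> (\<forall>x\<in>?M. orthogonal k x)" for w
      by (rule orth_decomp[OF sM, of w]) blast
    obtain a k where wk: "w = m11 m a + k" "\<forall>x\<in>?M. orthogonal k x" using dec by blast
    obtain b q where yq: "y = m11 m b + q" "\<forall>x\<in>?M. orthogonal q x" using dec by blast
    have "w - m11 m a \<in> K" using w K by (intro subspace_diff) auto
    then have "k \<in> span BK" "q \<in> span BD" using wk yq BD BK by (auto simp: orthogonal_commute)
    then have "m22 k q \<in> span {m22 s t | s t. s \<in> BK \<and> t \<in> BD}" by (intro bilinear_span_span bilinear_m22)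
    also have "{m22 s t | s t. s \<in> BK \<and> t \<in> BD} = ?P" by auto
    finally have "m22 k q \<in> span (M \<union> ?P)" using span_mono[of ?P "M \<union> ?P"] by auto
    moreover have "m22 (m11 m a) y \<in> span (M \<union> ?P)" "m22 k (m11 m b) \<in> span (M \<union> ?P)"
      using M(3) m22_commute[of k] span_mono[of M "M \<union> ?P"] by auto
    moreover have "m22 w y = m22 (m11 m a) y + m22 k (m11 m b) + m22 k q"
      by (simp add: wk(1) m22_simps) (simp add: yq(1) m22_simps)
    ultimately show ?thesis by (simp add: span_add)
  qed
  then have "dim {m22 u y | u y. u \<in> K} \<le> card (M \<union> ?P)"
    using M BK BD by (intro dim_le_card) auto
  also have "\<dots> \<le> card M + card ?P" by (rule card_Un_le)
  also have "card ?P \<le> card (BK \<times> BD)" using BK BD by (intro card_image_le) auto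
  also have "\<dots> \<le> 2 * 6" using BK BD dims by (simp add: card_cartesian_product)
  finally show ?thesis using M by linarith
qed

text \<open>Put \<open>S = ker v + l A_1\<close> for a generic \<open>l\<close>. It is proper since
  the flat case yields a real zero, and \<open>dim S + dim (Zk v) = dim (ker v) + 4\<close>. If
  \<open>Zk v\<close> has dimension at least 2, the kernel is generated by \<open>Zk v\<close> and
  has a zero; in dimension 1 the kernel has dimension at most 6 and too few products; in dimension 0
  the kernel has dimension 5, which is the situation of \<open>codim_one\<close>.\<close>

lemma indecomposable_kernel_dim:
  assumes v: "psd v" "v \<noteq> 0" and ind: "ann (ker v) = span {v}" and zf: "zero_free (ker v)"
  shows "dim (ker v) \<le> 4"
proof (rule ccontr)
  assume k: "\<not> dim (ker v) \<le> 4"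
  obtain l where l: "\<And>m. m11 l m \<in> ker v \<Longrightarrow> m \<in> Zk v"
    using generic_linear_form[OF v(1)] by blast
  have ZU: "Zk v \<noteq> UNIV" using ker_all v(2) by (auto simp: Zk_def)
  have lZ: "l \<notin> Zk v" using l ZU ZkD by blast
  then have l0: "l \<noteq> 0" using subspace_0[OF subspace_Zk] by auto
  obtain p0 where p0: "\<And>a. p0 - m11 l a \<notin> ker v"
    using flat_kernel_zero[OF v ind l] zf by blast
  let ?L = "range (m11 l)"
  have sL: "subspace ?L" using linear_subspace_image[OF linear_m11_right subspace_UNIV] .
  define S where "S = {x + y | x y. x \<in> ker v \<and> y \<in> ?L}"
  have sS: "subspace S" unfolding S_def by (rule subspace_sums[OF subspace_ker sL])
  have kerS: "ker v \<subseteq> S" "?L \<subseteq> S"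
    unfolding S_def using subspace_0[OF sL] subspace_0[OF subspace_ker] by force+
  have p0S: "p0 \<notin> S"
  proof
    assume "p0 \<in> S"
    then obtain x a where "p0 = x + m11 l a" "x \<in> ker v" by (auto simp: S_def)
    then show False using p0[of a] by simp
  qed
  have "ker v \<inter> ?L = m11 l ` Zk v"
  proof (intro subset_antisym subsetI)
    show "x \<in> m11 l ` Zk v" if "x \<in> ker v \<inter> ?L" for x using that l by blast
    show "x \<in> ker v \<inter> ?L" if "x \<in> m11 l ` Zk v" for x using that ZkD(2)[of _ v l] by blast
  qed
  moreover have "dim (m11 l ` Zk v) = dim (Zk v)"
    using l0 by (intro dim_image_eq[OF linear_m11_right] inj_onI)
      (metis eq_iff_diff_eq_0 m11_eq_0 m11_simps(8))
  ultimately have dS: "dim S + dim (Zk v) = dim (ker v) + 4"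
    using dim_sums_Int[OF subspace_ker sL, of v] dim_range_m11[OF l0] by (simp add: S_def)
  have SU: "span S \<noteq> UNIV" using p0S sS by (metis UNIV_I span_eq_iff)
  then have "dim S \<noteq> 10" using dim_eq_full[of S] by (simp add: CARD_quad_mon)
  moreover have "dim S \<le> 10" using dim_subset_UNIV[of S] by (simp add: CARD_quad_mon)
  ultimately have S9: "dim S \<le> 9" by linarith
  consider "dim (Zk v) \<ge> 2" | "dim (Zk v) = 1" | "dim (Zk v) = 0" by linarith
  then show False
  proof cases
    case 1
    have d1: "dim (insert l (Zk v)) \<ge> 3"
      using 1 lZ by (simp add: dim_insert span_eq_iff[THEN iffD2, OF subspace_Zk])
    obtain y where y: "span (insert y (insert l (Zk v))) = UNIV"
    proof (cases "span (insert l (Zk v)) = UNIV")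
      case True
      then show ?thesis using that[of 0] by simp
    next
      case False
      then obtain y where "y \<notin> span (insert l (Zk v))" by auto
      then have "dim (insert y (insert l (Zk v))) \<ge> 4" using d1 by (simp add: dim_insert)
      moreover have "dim (insert y (insert l (Zk v))) \<le> 4"
        using dim_subset_UNIV[of "insert y (insert l (Zk v))"] by simp
      ultimately have "dim (insert y (insert l (Zk v))) = DIM(real ^ 4)" by simp
      then show ?thesis using that dim_eq_full by blast
    qed
    define D where "D = span {m11 z a | z a. z \<in> Zk v}"
    have Dker: "D \<subseteq> ker v" unfolding D_def using ZkD by (intro span_minimal subspace_ker) auto
    have Dz: "m11 z a \<in> D" "m11 a z \<in> D" if "z \<in> Zk v" for z a
      using that by (auto simp: D_def m11_commute[of a] intro: span_base)
    have sD: "subspace D" by (simp add: D_def)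
    have dec: "\<exists>r s. a - (r *\<^sub>R l + s *\<^sub>R y) \<in> Zk v" for a
    proof -
      have "a \<in> span (insert y (insert l (Zk v)))" using y by simp
      then obtain s where "a - s *\<^sub>R y \<in> span (insert l (Zk v))" by (auto simp: span_insert)
      then obtain r where "a - s *\<^sub>R y - r *\<^sub>R l \<in> Zk v"
        by (auto simp: span_insert[of l] span_eq_iff[THEN iffD2, OF subspace_Zk])
      then show ?thesis by (intro exI[of _ r] exI[of _ s]) (simp add: algebra_simps)
    qed
    have repr: "\<exists>r s t. p - (m11 l (r *\<^sub>R l + s *\<^sub>R y) + t *\<^sub>R m11 y y) \<in> D" for p
    proof -
      let ?R = "{p. \<exists>r s t. p - (m11 l (r *\<^sub>R l + s *\<^sub>R y) + t *\<^sub>R m11 y y) \<in> D}"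
      have "subspace ?R"
      proof (unfold subspace_def, intro conjI ballI allI)
        show "0 \<in> ?R"
          using subspace_0[OF sD] by (auto intro!: exI[of _ 0] simp: m11_simps)
      next
        fix p q assume "p \<in> ?R" "q \<in> ?R"
        then obtain r s t r' s' t' where "p - (m11 l (r *\<^sub>R l + s *\<^sub>R y) + t *\<^sub>R m11 y y) \<in> D"
          "q - (m11 l (r' *\<^sub>R l + s' *\<^sub>R y) + t' *\<^sub>R m11 y y) \<in> D" by blast
        from subspace_add[OF sD this] show "p + q \<in> ?R"
          by (intro CollectI exI[of _ "r + r'"] exI[of _ "s + s'"] exI[of _ "t + t'"])
            (simp add: m11_simps algebra_simps)
      next
        fix c p assume "p \<in> ?R"
        then obtain r s t where "p - (m11 l (r *\<^sub>R l + s *\<^sub>R y) + t *\<^sub>R m11 y y) \<in> D" by blast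
        from subspace_scale[OF sD this, of c] show "c *\<^sub>R p \<in> ?R"
          by (intro CollectI exI[of _ "c * r"] exI[of _ "c * s"] exI[of _ "c * t"])
            (simp add: m11_simps algebra_simps)
      qed
      moreover have "m11 a b \<in> ?R" for a b
      proof -
        obtain r s where a: "a - (r *\<^sub>R l + s *\<^sub>R y) \<in> Zk v" using dec by blast
        obtain r' s' where b: "b - (r' *\<^sub>R l + s' *\<^sub>R y) \<in> Zk v" using dec by blast
        have "m11 (a - (r *\<^sub>R l + s *\<^sub>R y)) b + m11 (r *\<^sub>R l + s *\<^sub>R y) (b - (r' *\<^sub>R l + s' *\<^sub>R y)) \<in> D"
          by (intro subspace_add[OF sD] Dz a b)
        then show ?thesis
          by (intro CollectI exI[of _ "r * r'"] exI[of _ "r * s' + s * r'"] exI[of _ "s * s'"])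
            (simp add: m11_simps m11_commute[of y l] algebra_simps)
      qed
      ultimately have "span {m11 a b | a b. True} \<subseteq> ?R" by (intro span_minimal) auto
      then show ?thesis unfolding span_m11 by blast
    qed
    \<comment> \<open>Modulo \<open>D\<close> every quadric is a combination of \<open>l l\<close>,
      \<open>l y\<close> and \<open>y y\<close>. As the first two lie in the proper space
      \<open>S\<close>, the third cannot; so an element of the kernel has no \<open>y y\<close> part
      and is, modulo \<open>D\<close>, a multiple of \<open>l\<close>.\<close>
    have yS: "m11 y y \<notin> S"
    proof
      assume yS: "m11 y y \<in> S"
      obtain r s t where p: "p0 - (m11 l (r *\<^sub>R l + s *\<^sub>R y) + t *\<^sub>R m11 y y) \<in> D" using repr by blast
      have "(p0 - (m11 l (r *\<^sub>R l + s *\<^sub>R y) + t *\<^sub>R m11 y y)) + (m11 l (r *\<^sub>R l + s *\<^sub>R y) + t *\<^sub>R m11 y y) \<in> S"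
        using p Dker kerS yS by (intro subspace_add[OF sS] subspace_scale[OF sS]) auto
      then show False using p0S by simp
    qed
    have "ker v \<subseteq> D"
    proof
      fix w assume w: "w \<in> ker v"
      obtain r s t where p: "w - (m11 l (r *\<^sub>R l + s *\<^sub>R y) + t *\<^sub>R m11 y y) \<in> D" using repr by blast
      define d where "d = w - (m11 l (r *\<^sub>R l + s *\<^sub>R y) + t *\<^sub>R m11 y y)"
      have p: "d \<in> D" using p by (simp add: d_def)
      have wd: "w - d = m11 l (r *\<^sub>R l + s *\<^sub>R y) + t *\<^sub>R m11 y y" by (simp add: d_def)
      have wdS: "w - d \<in> ker v" using w p Dker by (intro subspace_diff[OF subspace_ker]) auto
      have "t = 0"
      proof (rule ccontr)
        assume t: "t \<noteq> 0"
        have "(1 / t) *\<^sub>R (w - d - m11 l (r *\<^sub>R l + s *\<^sub>R y)) \<in> S"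
          by (rule subspace_scale[OF sS]; rule subspace_diff[OF sS]) (use wdS kerS in auto)
        then show False using yS t by (simp add: wd)
      qed
      then have wd0: "w - d = m11 l (r *\<^sub>R l + s *\<^sub>R y)" using wd by simp
      then have "m11 l (r *\<^sub>R l + s *\<^sub>R y) \<in> D" using wdS l Dz(2) by metis
      then have "d + (w - d) \<in> D" unfolding wd0 using p by (intro subspace_add[OF sD])
      then show "w \<in> D" by simp
    qed
    moreover obtain z where z: "z \<noteq> 0" "\<And>y. y \<in> Zk v \<Longrightarrow> orthogonal z y"
      using orthogonal_to_subspace_exists_gen[of "Zk v" UNIV] ZU span_eq_iff[THEN iffD2, OF subspace_Zk[of v]] by auto
    moreover have "D \<subseteq> {x. ev x z = 0}"
      unfolding D_def using z(2) linear_subspace_kernel[OF linear_ev]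
      by (intro span_minimal) (auto simp: orthogonal_def inner_commute)
    ultimately show False using zf unfolding zero_free_def by blast
  next
    case 2
    then obtain m where m: "m \<in> Zk v" "m \<noteq> 0" by (metis dim_eq_0 one_neq_zero singletonI subsetI)
    have "dim (ker v) \<le> 6" using dS S9 2 by linarith
    then have "dim {m22 u y | u y. u \<in> ker v} < 34"
      using m ZkD by (intro dim_products_with_multiples[OF subspace_ker _ m(2)]) auto
    then show False using ann_not_line[of "ker v" v] ind by blast
  next
    case 3
    then have Z0: "m = 0" if "m \<in> Zk v" for m using that by auto
    have S9': "dim S = 9" using dS S9 3 k by linarith
    define Q where "Q a b = B v (m11 l a) (m11 l b)" for a b
    have Q: "bilinear Q" by (auto simp: bilinear_def Q_def m11_simps B_simps intro!: linearI)
    have nd: "x = 0" if "\<And>a. Q a x = 0" for x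
      using that[of x] psd_ker[OF v(1), of "m11 l x"] l Z0 by (auto simp: Q_def)
    have "linear (\<lambda>t. B v (m11 l t) p0)" by (rule linearI) (auto simp: m11_simps B_simps)
    then obtain h where h: "\<And>t. Q t h = B v (m11 l t) p0" using riesz_form[OF Q nd] by metis
    \<comment> \<open>The projection of \<open>p0\<close> to \<open>l A_1\<close> with respect to
      \<open>B v\<close> is removed, so that \<open>n0\<close>, once normalised, serves as
      \<open>nu\<close>.\<close>
    define n0 where "n0 = p0 - m11 l h"
    have n0: "B v (m11 l t) n0 = 0" for t using h[of t] by (simp add: n0_def Q_def B_simps)
    have "n0 \<notin> S"
    proof
      assume "n0 \<in> S"
      then have "n0 + m11 l h \<in> S" using kerS by (intro subspace_add[OF sS]) auto
      then show False using p0S by (simp add: n0_def)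
    qed
    then have nk: "n0 \<notin> ker v" using kerS by auto
    have pos: "B v n0 n0 > 0" by (rule psd_pos[OF v(1) nk])
    define nu where "nu = (1 / sqrt (B v n0 n0)) *\<^sub>R n0"
    have full: "span (insert n0 S) = UNIV"
    proof -
      have "dim (insert n0 S) = DIM(real ^ quad_mon)"
        using \<open>n0 \<notin> S\<close> S9' by (simp add: dim_insert span_eq_iff[THEN iffD2, OF sS] CARD_quad_mon)
      then show ?thesis using dim_eq_full by blast
    qed
    interpret codim_one v l nu
    proof
      show "psd v" "ann (ker v) = span {v}" by fact+
      show "\<And>a. m11 l a \<in> ker v \<Longrightarrow> a = 0" using l Z0 by blast
      show "\<And>m. (\<And>a. m11 m a \<in> ker v) \<Longrightarrow> m = 0" using Z0 by (auto simp: Zk_def)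
      show "B v nu (m11 l a) = 0" for a 
        using n0[of a] B_commute[of v n0 "m11 l a"] by (simp add: nu_def B_simps)
      show "B v nu nu = 1" using pos by (simp add: nu_def B_simps)
      show "\<exists>a r. p - (m11 l a + r *\<^sub>R nu) \<in> ker v" for p
      proof -
        have "p \<in> span (insert n0 S)" using full by simp
        then obtain r where "p - r *\<^sub>R n0 \<in> S" by (auto simp: span_insert span_eq_iff[THEN iffD2, OF sS])
        then obtain x a where xa: "p - r *\<^sub>R n0 = x + m11 l a" "x \<in> ker v" by (auto simp: S_def)
        moreover have "r *\<^sub>R n0 = (r * sqrt (B v n0 n0)) *\<^sub>R nu" using pos by (simp add: nu_def)
        ultimately have "p - (m11 l a + (r * sqrt (B v n0 n0)) *\<^sub>R nu) = x" by (simp add: algebra_simps)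
        then show ?thesis using xa(2) by metis
      qed
    qed
    show False using not_zero_free zf by blast
  qed
qed

lemma kernel_dim_le_4:
  assumes v: "psd v" "v \<noteq> 0" and zf: "zero_free (ker v)"
  shows "dim (ker v) \<le> 4"
proof -
  obtain v' where v': "psd v'" "v' \<noteq> 0" "ker v \<subseteq> ker v'" "ann (ker v') = span {v'}"
    by (rule maximal_kernel[OF v])
  have "dim (ker v) \<le> dim (ker v')" using v'(3) by (rule dim_subset)
  also have "\<dots> \<le> 4" using v' zero_free_mono[OF zf] by (intro indecomposable_kernel_dim) auto
  finally show ?thesis .
qed

text \<open>Passing to an extreme functional cannot enlarge a kernel that already has the largest
  possible dimension, so \<open>v\<close> is itself extreme.\<close>

lemma ann_kernel_dim_4:
  assumes v: "psd v" "v \<noteq> 0" and zf: "zero_free (ker v)" and d: "dim (ker v) = 4"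
  shows "ann (ker v) = span {v}"
proof -
  obtain v' where v': "psd v'" "v' \<noteq> 0" "ker v \<subseteq> ker v'" "ann (ker v') = span {v'}"
    by (rule maximal_kernel[OF v])
  have "dim (ker v') \<le> 4" using v' zero_free_mono[OF zf] by (intro kernel_dim_le_4) auto
  then have "ker v = ker v'" using v'(3) d by (intro subspace_dim_equal) (auto simp: subspace_ker)
  moreover have "v \<in> ann (ker v)" by (simp add: ann_iff_ker)
  ultimately have "v \<in> span {v'}" "ann (ker v) = span {v'}" using v'(4) by auto
  then obtain r where r: "v = r *\<^sub>R v'" by (auto simp: span_singleton)
  then have "v' = (1 / r) *\<^sub>R v" using v(2) by auto
  then have "v' \<in> span {v}" by (metis insertI1 span_base span_scale)
  then have "span {v'} = span {v}" using \<open>v \<in> span {v'}\<close> by (intro subset_antisym span_minimal) auto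
  then show ?thesis using \<open>ann (ker v) = span {v'}\<close> by simp
qed

section \<open>Products of four quadrics\<close>

definition adapted_basis :: "(nat \<Rightarrow> real ^ quad_mon) \<Rightarrow> nat \<Rightarrow> (real ^ quad_mon) set \<Rightarrow> bool" where
  "adapted_basis b k U \<longleftrightarrow> inj_on b {..<10} \<and> independent (b ` {..<10}) \<and>
    span (b ` {..<10}) = UNIV \<and> span (b ` {..<k}) = U"

lemma adapted_basis_exists:
  assumes "subspace U" "dim U = k"
  obtains b where "adapted_basis b k U"
proof -
  obtain A where A: "finite A" "A \<subseteq> U" "independent A" "span A = U" "card A = dim U"
    by (rule basis_subspace_exists[OF assms(1)])
  obtain Bs where Bs: "A \<subseteq> Bs" "independent Bs" "UNIV \<subseteq> span Bs"
    by (rule maximal_independent_subset_extend[OF subset_UNIV A(3)])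
  have fB: "finite Bs" using Bs(2) by (rule independent_imp_finite)
  have cB: "card Bs = 10" using Bs(3) dim_eq_card_independent[OF Bs(2)] dim_eq_full[of Bs] by (simp add: CARD_quad_mon top_unique)
  obtain f where f: "bij_betw f {..<k} A" using ex_bij_betw_nat_finite[OF A(1)] A(5) assms(2) by (auto simp: lessThan_atLeast0)
  have "card (Bs - A) = 10 - k" using Bs(1) A fB cB assms(2) by (simp add: card_Diff_subset)
  then obtain g where g: "bij_betw g {..<10 - k} (Bs - A)"
    using ex_bij_betw_nat_finite[of "Bs - A"] fB by (auto simp: lessThan_atLeast0)
  have k: "k \<le> 10" using card_mono[OF fB Bs(1)] A cB assms(2) by simp
  have "bij_betw (\<lambda>i. i - k) {k..<10} {..<10 - k}"
    by (rule bij_betw_byWitness[where f' = "\<lambda>i. i + k"]) (use k in auto)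
  then have g': "bij_betw (\<lambda>i. g (i - k)) {k..<10} (Bs - A)"
    using bij_betw_trans[OF _ g] by (auto simp: comp_def)
  define b where "b i = (if i < k then f i else g (i - k))" for i
  have b1: "bij_betw b {..<k} A" using f by (rule bij_betw_cong[THEN iffD1, rotated]) (auto simp: b_def)
  have b2: "bij_betw b {k..<10} (Bs - A)" using g' by (rule bij_betw_cong[THEN iffD1, rotated]) (auto simp: b_def)
  have "bij_betw b ({..<k} \<union> {k..<10}) (A \<union> (Bs - A))"
    by (rule bij_betw_combine[OF b1 b2]) auto
  moreover have "{..<k} \<union> {k..<10} = {..<10}" "A \<union> (Bs - A) = Bs" using k Bs(1) by auto
  ultimately have "bij_betw b {..<10} Bs" by simp
  then have "adapted_basis b k U"
    unfolding adapted_basis_def using b1 Bs A by (simp add: bij_betw_def top_unique)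
  then show ?thesis by (rule that)
qed

definition prod_index :: "nat \<Rightarrow> (nat \<times> nat) set" where
  "prod_index k = (SIGMA i:{..<k}. {i..<10})"

lemma finite_prod_index [simp]: "finite (prod_index k)"
  by (simp add: prod_index_def)

lemma card_prod_index: "card (prod_index k) = (\<Sum>i<k. 10 - i)"
  by (simp add: prod_index_def)

text \<open>Commutativity accounts for the Koszul relations: only the products with \<open>i \<le> j\<close> are needed.\<close>

lemma span_products:
  assumes "adapted_basis b k U" "k \<le> 10"
  shows "{m22 u y | u y. u \<in> U} \<subseteq> span ((\<lambda>(i, j). m22 (b i) (b j)) ` prod_index k)"
proof clarify
  fix u y assume "u \<in> U"
  then have "u \<in> span (b ` {..<k})" "y \<in> span (b ` {..<10})" using assms by (auto simp: adapted_basis_def)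
  then have "m22 u y \<in> span {m22 s t | s t. s \<in> b ` {..<k} \<and> t \<in> b ` {..<10}}"
    by (intro bilinear_span_span bilinear_m22)
  also have "\<dots> \<subseteq> span ((\<lambda>(i, j). m22 (b i) (b j)) ` prod_index k)"
  proof (rule span_mono, clarify)
    fix i j :: nat assume ij: "i < k" "j < 10"
    show "m22 (b i) (b j) \<in> (\<lambda>(i, j). m22 (b i) (b j)) ` prod_index k"
    proof (cases "i \<le> j")
      case True
      then show ?thesis using ij by (intro image_eqI[of _ _ "(i, j)"]) (auto simp: prod_index_def)
    next
      case False
      then show ?thesis using ij assms(2)
        by (intro image_eqI[of _ _ "(j, i)"]) (auto simp: prod_index_def m22_commute)
    qed
  qed
  finally show "m22 u y \<in> span ((\<lambda>(i, j). m22 (b i) (b j)) ` prod_index k)" .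
qed

lemma dim_products_le:
  assumes "subspace U"
  shows "dim {m22 u y | u y. u \<in> U} \<le> (\<Sum>i<dim U. 10 - i)"
proof -
  obtain b where b: "adapted_basis b (dim U) U" using adapted_basis_exists[OF assms] by blast
  have "dim U \<le> 10" using dim_subset_UNIV[of U] by (simp add: CARD_quad_mon)
  then have "dim {m22 u y | u y. u \<in> U} \<le> card ((\<lambda>(i, j). m22 (b i) (b j)) ` prod_index (dim U))"
    using span_products[OF b] by (intro dim_le_card) auto
  also have "\<dots> \<le> card (prod_index (dim U))" by (intro card_image_le) simp
  finally show ?thesis by (simp add: card_prod_index)
qed

lemma ann_nontrivial_4:
  assumes "subspace U" "dim U = 4"
  obtains b where "b \<noteq> 0" "b \<in> ann U"
proof -
  have "dim {m22 u y | u y. u \<in> U} < 35"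
    using dim_products_le[OF assms(1)] assms(2) by (simp add: eval_nat_numeral)
  then show ?thesis using ann_nontrivial that by blast
qed

lemma ann_not_line_3:
  assumes "subspace U" "dim U \<le> 3"
  obtains b where "b \<in> ann U" "b \<notin> span {v}"
proof -
  have "(\<Sum>i<dim U. 10 - i) \<le> (\<Sum>i<3. 10 - i :: nat)" using assms(2) by (intro sum_mono2) auto
  then have "dim {m22 u y | u y. u \<in> U} < 34"
    using dim_products_le[OF assms(1)] by (simp add: eval_nat_numeral)
  then show ?thesis using ann_not_line that by blast
qed

text \<open>A unique annihilating functional leaves at least 34 dimensions for the span of 34
  products, so they are independent: there are only Koszul relations.\<close>

lemma products_independent:
  assumes b: "adapted_basis b 4 U" and v: "ann U = span {v}"
    and s: "(\<Sum>(i, j)\<in>prod_index 4. c i j *\<^sub>R m22 (b i) (b j)) = 0"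
    and ij: "(i, j) \<in> prod_index 4"
  shows "c i j = 0"
proof -
  let ?f = "\<lambda>(i, j). m22 (b i) (b j)"
  have c34: "card (prod_index 4) = 34" by (simp add: card_prod_index eval_nat_numeral)
  have "\<not> dim {m22 u y | u y. u \<in> U} < 34" using ann_not_line[of U v] v by metis
  moreover have "dim {m22 u y | u y. u \<in> U} \<le> dim (?f ` prod_index 4)"
    using span_products[OF b] by (intro dim_mono) auto
  ultimately have d: "34 \<le> dim (?f ` prod_index 4)" by linarith
  have cI: "card (?f ` prod_index 4) \<le> 34" using card_image_le[of "prod_index 4" ?f] c34 by simp
  have ind: "independent (?f ` prod_index 4)"
    by (rule card_le_dim_spanning[of _ "?f ` prod_index 4"]) (use d cI in \<open>auto intro: span_base\<close>)
  then have "card (?f ` prod_index 4) = 34" using dim_eq_card_independent[OF ind] d cI by simp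
  then have inj: "inj_on ?f (prod_index 4)" using c34 by (intro eq_card_imp_inj_on) auto
  have "(\<Sum>x\<in>?f ` prod_index 4. case_prod c (inv_into (prod_index 4) ?f x) *\<^sub>R x) = 0"
  proof -
    have "(\<Sum>x\<in>?f ` prod_index 4. case_prod c (inv_into (prod_index 4) ?f x) *\<^sub>R x) =
        (\<Sum>x\<in>prod_index 4. case_prod c x *\<^sub>R ?f x)"
      unfolding sum.reindex[OF inj] comp_def by (rule sum.cong) (simp_all only: inv_into_f_f[OF inj])
    also have "\<dots> = 0" using s by (simp add: case_prod_beta)
    finally show ?thesis .
  qed
  then have "case_prod c (inv_into (prod_index 4) ?f (?f (i, j))) = 0"
    by (rule independentD[OF ind finite_imageI[OF finite_prod_index] subset_refl _ imageI[OF ij]])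
  then show ?thesis using inv_into_f_f[OF inj ij] by simp
qed

section \<open>Three quadrics without a common real zero\<close>

lemma kernel_dim_4_above:
  assumes v: "psd v" "v \<noteq> 0" and zf: "zero_free (ker v)"
  obtains v' where "psd v'" "v' \<noteq> 0" "ker v \<subseteq> ker v'" "dim (ker v') = 4" "ann (ker v') = span {v'}"
proof -
  obtain v' where v': "psd v'" "v' \<noteq> 0" "ker v \<subseteq> ker v'" "ann (ker v') = span {v'}"
    by (rule maximal_kernel[OF v])
  have "dim (ker v') \<le> 4" using v' zero_free_mono[OF zf] by (intro kernel_dim_le_4) auto
  moreover have "\<not> dim (ker v') \<le> 3" using ann_not_line_3[OF subspace_ker, of v' v'] v'(4) by metis
  ultimately show ?thesis using that v' by simp
qed

text \<open>The square of \<open>l a\<close> is also the product of the squares of \<open>l\<close>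
  and \<open>a\<close>, on which \<open>v\<close> vanishes.\<close>

lemma square_ker_multiples:
  assumes "psd v" "m11 l l \<in> ker v" shows "m11 l a \<in> ker v"
  using B_swap[of v l l a a] kerD(1)[OF assms(2)] by (intro psd_ker assms(1)) (simp add: m11_commute)

text \<open>The set of \<open>q\<close> such that some functional annihilates \<open>U + \<real> q\<close> is open and closed, so it
  contains the square of a linear form, which is impossible.\<close>

lemma no_three_aux:
  assumes U: "subspace U" "dim U = 3" "zero_free U"
    and v0: "psd v0" "v0 \<noteq> 0" "q \<in> ker v0" "U \<subseteq> ker v0" "dim (ker v0) = 4" "q \<notin> U"
  shows False
proof -
  have ex: "\<exists>l. m11 l l \<notin> ker v0"
  proof (rule ccontr)
    assume "\<nexists>l. m11 l l \<notin> ker v0"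
    then have *: "m11 l l \<in> ker v0" for l by blast
    have "m11 a b = (1 / 4) *\<^sub>R (m11 (a + b) (a + b) - m11 (a - b) (a - b))" for a b
      by (simp add: m11_simps m11_commute[of b a] vec_eq_iff)
    then have "m11 a b \<in> ker v0" for a b
      using * by (metis subspace_diff subspace_ker subspace_scale)
    then show False using ker_all v0(2) by blast
  qed
  then obtain l where l: "m11 l l \<notin> ker v0" by blast
  \<comment> \<open>The segment from \<open>q\<close> to the square of \<open>l\<close> avoids
    \<open>U\<close>: it leaves \<open>ker v0\<close> as soon as \<open>t\<close> is nonzero, so
    \<open>W t\<close> always has dimension 4.\<close>
  define qt where "qt t = (1 - t) *\<^sub>R q + t *\<^sub>R m11 l l" for t :: real
  have qtU: "qt t \<notin> U" for t
  proof
    assume qU: "qt t \<in> U"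
    show False
    proof (cases "t = 0")
      case True
      then show False using qU v0 by (simp add: qt_def)
    next
      case False
      have "(1 / t) *\<^sub>R (qt t - (1 - t) *\<^sub>R q) \<in> ker v0"
        using qU v0 by (intro subspace_scale[OF subspace_ker] subspace_diff[OF subspace_ker]) auto
      then show False using l False by (simp add: qt_def)
    qed
  qed
  define W where "W t = span (insert (qt t) U)" for t
  have sW: "subspace (W t)" for t by (simp add: W_def)
  have dW: "dim (W t) = 4" for t
    using qtU[of t] U by (simp add: W_def dim_insert span_eq_iff[THEN iffD2])
  have zW: "zero_free (W t)" for t
    by (rule zero_free_mono[OF U(3)]) (auto simp: W_def intro: span_base)
  have annW: "v \<in> ann (W t) \<longleftrightarrow> v \<in> ann U \<and> (\<forall>y. B v (qt t) y = 0)" for v t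
    unfolding W_def ann_span by (auto simp: ann_def)
  have lim: "v \<in> ann (W t)"
    if "vs \<longlonglongrightarrow> v" "ts \<longlonglongrightarrow> t" "\<And>n. vs n \<in> ann (W (ts n))" for vs v ts t
  proof -
    have "B v x y = 0" if "x \<in> U" for x y
    proof -
      have "(\<lambda>n. B (vs n) x y) \<longlonglongrightarrow> B v x y" by (intro tendsto_B \<open>vs \<longlonglongrightarrow> v\<close> tendsto_const)
      moreover have "B (vs n) x y = 0" for n using that \<open>\<And>n. vs n \<in> ann (W (ts n))\<close>[of n] unfolding annW by (auto simp: ann_def)
      ultimately show ?thesis by (simp add: LIMSEQ_const_iff)
    qed
    moreover have "B v (qt t) y = 0" for y
    proof -
      have "(\<lambda>n. B (vs n) (qt (ts n)) y) \<longlonglongrightarrow> B v (qt t) y"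
        unfolding qt_def by (intro tendsto_B \<open>vs \<longlonglongrightarrow> v\<close> tendsto_intros \<open>ts \<longlonglongrightarrow> t\<close>)
      moreover have "B (vs n) (qt (ts n)) y = 0" for n using that(3)[of n] by (auto simp: annW)
      ultimately show ?thesis by (simp add: LIMSEQ_const_iff)
    qed
    ultimately show ?thesis unfolding annW by (simp add: ann_def)
  qed
  define S where "S = {t \<in> {0..1}. \<exists>v. psd v \<and> norm v = 1 \<and> v \<in> ann (W t)}"
  have SI: "t \<in> S" if "t \<in> {0..1}" "psd v" "v \<noteq> 0" "v \<in> ann (W t)" for t v
    unfolding S_def using that psd_scale[of v "1 / norm v"] subspace_scale[OF subspace_ann, of v "W t" "1 / norm v"]
    by (intro CollectI conjI exI[of _ "(1 / norm v) *\<^sub>R v"]) auto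
  have subseq: "\<exists>v r. strict_mono r \<and> (vs \<circ> r) \<longlonglongrightarrow> v \<and> norm v = 1" if "\<And>n. norm (vs n) = 1" for vs :: "nat \<Rightarrow> real ^ quartic_mon"
  proof -
    have "seq_compact (sphere (0 :: real ^ quartic_mon) 1)" by (simp add: compact_imp_seq_compact)
    moreover have "\<forall>n. vs n \<in> sphere 0 1" using that by simp
    ultimately obtain v r where "v \<in> sphere 0 1" "strict_mono r" "(vs \<circ> r) \<longlonglongrightarrow> v"
      by (rule seq_compactE)
    then show ?thesis by auto
  qed
  have "closed S"
  proof (unfold closed_sequential_limits, intro allI impI, elim conjE)
    fix ts t assume ts: "\<forall>n. ts n \<in> S" "ts \<longlonglongrightarrow> t"
    have "\<forall>n. \<exists>v. psd v \<and> norm v = 1 \<and> v \<in> ann (W (ts n))" using ts(1) by (simp add: S_def)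
    then obtain vs where "\<forall>n. psd (vs n) \<and> norm (vs n) = 1 \<and> vs n \<in> ann (W (ts n))"
      by (rule choice[THEN exE])
    then have vs: "psd (vs n)" "norm (vs n) = 1" "vs n \<in> ann (W (ts n))" for n by auto
    obtain v r where r: "strict_mono r" "(vs \<circ> r) \<longlonglongrightarrow> v" "norm v = 1"
      using subseq[of vs, OF vs(2)] by blast
    have "v \<in> {v. psd v}"
      by (rule closed_sequentially[OF closed_psd _ r(2)]) (simp add: vs)
    then have "psd v" by simp
    moreover have "v \<in> ann (W t)"
      using lim[OF r(2) LIMSEQ_subseq_LIMSEQ[OF ts(2) r(1)]] vs by simp
    moreover have "t \<in> {0..1}"
      using closed_sequentially[of "{0..1::real}" ts t] ts by (auto simp: S_def)
    ultimately show "t \<in> S" using r(3) by (auto simp: S_def)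
  qed
  moreover have "openin (top_of_set {0..1}) S"
  proof (rule ccontr)
    assume "\<not> openin (top_of_set {0..1}) S"
    moreover have "S \<subseteq> {0..1}" by (auto simp: S_def)
    ultimately obtain t0 where t0: "t0 \<in> S" "\<forall>e>0. \<exists>t\<in>{0..1}. dist t t0 < e \<and> t \<notin> S"
      unfolding openin_euclidean_subtopology_iff by blast
    have "\<forall>n. \<exists>t. t \<in> {0..1} \<and> dist t t0 < 1 / (real n + 1) \<and> t \<notin> S"
    proof
      fix n :: nat
      have "1 / (real n + 1) > 0" by (simp add: add_nonneg_pos)
      then show "\<exists>t. t \<in> {0..1} \<and> dist t t0 < 1 / (real n + 1) \<and> t \<notin> S" using t0(2) by blast
    qed
    then obtain ts where "\<forall>n. ts n \<in> {0..1} \<and> dist (ts n) t0 < 1 / (real n + 1) \<and> ts n \<notin> S"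
      by (rule choice[THEN exE])
    then have ts: "ts n \<in> {0..1}" "dist (ts n) t0 < 1 / (real n + 1)" "ts n \<notin> S" for n by auto
    have "(\<lambda>n. dist (ts n) t0) \<longlonglongrightarrow> 0"
    proof (rule tendsto_sandwich[OF _ _ tendsto_const])
      show "(\<lambda>n. 1 / (real n + 1)) \<longlonglongrightarrow> 0" using LIMSEQ_inverse_real_of_nat by (simp add: inverse_eq_divide add.commute)
    qed (use ts(2) in \<open>auto intro!: always_eventually less_imp_le\<close>)
    then have tst: "ts \<longlonglongrightarrow> t0" by (rule tendsto_dist_iff[THEN iffD2])
    obtain v1 where v1: "psd v1" "norm v1 = 1" "v1 \<in> ann (W t0)" "t0 \<in> {0..1}" using t0(1) by (auto simp: S_def)
    have sub: "W t0 \<subseteq> ker v1" using v1(3) by (simp add: ann_iff_ker)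
    have v1n: "v1 \<noteq> 0" using v1(2) by auto
    have "zero_free (ker v1)" using zero_free_mono[OF zW sub] .
    then have "dim (ker v1) \<le> 4" using v1 v1n by (intro kernel_dim_le_4)
    then have kW: "W t0 = ker v1" using sub dW sW subspace_ker by (intro subspace_dim_equal) auto
    have line: "ann (W t0) = span {v1}"
      unfolding kW using \<open>zero_free (ker v1)\<close> dW[of t0] kW v1 v1n by (intro ann_kernel_dim_4) auto
    \<comment> \<open>The count 34 < 35 provides a functional near \<open>t0\<close>, not known to
      be semidefinite. A limit of such functionals lies on the line of \<open>v1\<close>, so up to
      the sign \<open>c\<close> they approach \<open>v1\<close> and inherit its positivity on a
      complement of \<open>W t0\<close>.\<close>
    have "\<forall>n. \<exists>b. norm b = 1 \<and> b \<in> ann (W (ts n))"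
    proof
      fix n
      obtain b where "b \<noteq> 0" "b \<in> ann (W (ts n))" by (rule ann_nontrivial_4[OF sW dW])
      then show "\<exists>b. norm b = 1 \<and> b \<in> ann (W (ts n))"
        using subspace_scale[OF subspace_ann, of b "W (ts n)" "1 / norm b"]
        by (intro exI[of _ "(1 / norm b) *\<^sub>R b"]) auto
    qed
    then obtain bs where "\<forall>n. norm (bs n) = 1 \<and> bs n \<in> ann (W (ts n))" by (rule choice[THEN exE])
    then have bs: "norm (bs n) = 1" "bs n \<in> ann (W (ts n))" for n by auto
    obtain b r where r: "strict_mono r" "(bs \<circ> r) \<longlonglongrightarrow> b" "norm b = 1" using subseq[of bs, OF bs(1)] by blast
    have "b \<in> ann (W t0)" using lim[OF r(2) LIMSEQ_subseq_LIMSEQ[OF tst r(1)]] bs by simp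
    then obtain c where c: "b = c *\<^sub>R v1" unfolding line by (auto simp: span_singleton)
    have c1: "\<bar>c\<bar> = 1" using r(3) v1(2) c by simp
    then have cc: "c * c = 1" by (metis abs_mult_self_eq mult_1)
    have conv: "(\<lambda>n. c *\<^sub>R bs (r n)) \<longlonglongrightarrow> v1"
      using tendsto_scaleR[OF tendsto_const r(2), of c] cc by (simp add: c comp_def)
    let ?C = "{y. \<forall>x\<in>W t0. orthogonal y x}"
    have sC: "subspace ?C" by (rule subspace_orthogonal_complement)
    have "0 < B v1 x x" if "x \<in> ?C" "x \<noteq> 0" for x
      using that kW orthogonal_self[of x] by (intro psd_pos v1) auto
    then obtain e where e: "e > 0" "\<And>w x. norm (w - v1) < e \<Longrightarrow> x \<in> ?C \<Longrightarrow> x \<noteq> 0 \<Longrightarrow> 0 < B w x x"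
      using pd_stable[OF sC] by blast
    obtain n where n: "norm (c *\<^sub>R bs (r n) - v1) < e"
      using LIMSEQ_D[OF conv e(1)] by blast
    define w where "w = c *\<^sub>R bs (r n)"
    have wW: "w \<in> ann (W (ts (r n)))" unfolding w_def by (rule subspace_scale[OF subspace_ann bs(2)])
    have pd: "0 < B w x x" if "x \<in> ?C" "x \<noteq> 0" for x using e(2) n that by (simp add: w_def)
    have "W (ts (r n)) \<inter> ?C = {0}"
    proof -
      have "x = 0" if "x \<in> W (ts (r n))" "x \<in> ?C" for x
        using pd[OF that(2)] wW that(1) by (force simp: ann_def)
      then show ?thesis using subspace_0[OF sC] subspace_0[OF sW] by blast
    qed
    moreover have "dim ?C = 6"
      using dim_orthogonal_complement[OF sW, of t0] dW by (simp add: CARD_quad_mon)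
    ultimately have "dim {x + y | x y. x \<in> W (ts (r n)) \<and> y \<in> ?C} = DIM(real ^ quad_mon)"
      using dim_sums_Int[OF sW sC, of "ts (r n)"] dW by (simp add: CARD_quad_mon)
    then have "span {x + y | x y. x \<in> W (ts (r n)) \<and> y \<in> ?C} = UNIV"
      using dim_eq_full by blast
    then have "{x + y | x y. x \<in> W (ts (r n)) \<and> y \<in> ?C} = UNIV"
      using subspace_sums[OF sW sC] by (simp add: span_eq_iff[THEN iffD2])
    then have "\<exists>y z. x = y + z \<and> y \<in> W (ts (r n)) \<and> z \<in> ?C" for x by blast
    then have "psd w" using pd wW by (intro psd_from_pd(1)[OF sW, of _ w ?C]) (auto simp: ann_iff_ker)
    moreover have "w \<noteq> 0" using bs(1)[of "r n"] c1 by (auto simp: w_def)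
    ultimately show False using SI[OF ts(1) _ _ wW] ts(3) by blast
  qed
  moreover have "0 \<in> S"
  proof (rule SI[of 0 v0])
    have "qt 0 = q" by (simp add: qt_def)
    then show "v0 \<in> ann (W 0)" unfolding annW using v0 kerD(1) by (simp add: ann_iff_ker)
  qed (use v0 in auto)
  moreover have "S \<subseteq> {0..1}" by (auto simp: S_def)
  ultimately have "S = {0..1}"
    using connected_clopen[of "{0..1::real}"] closed_subset[of S "{0..1}"] by auto
  then have "1 \<in> S" by simp
  then obtain v where v: "psd v" "norm v = 1" "v \<in> ann (W 1)" by (auto simp: S_def)
  have vn: "v \<noteq> 0" using v(2) by auto
  have sub: "W 1 \<subseteq> ker v" using v(3) by (simp add: ann_iff_ker)
  then have dk: "dim (ker v) \<le> 4" using zero_free_mono[OF zW sub] v vn by (intro kernel_dim_le_4)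
  \<comment> \<open>All multiples of \<open>l\<close> now lie in a kernel of dimension at most 4 and
    hence fill it. Then \<open>U\<close> consists of multiples of \<open>l\<close> and vanishes at
    any point orthogonal to \<open>l\<close>.\<close>
  have "m11 l l \<in> W 1" by (simp add: W_def qt_def span_base)
  then have "range (m11 l) \<subseteq> ker v" using square_ker_multiples[OF v(1)] sub by blast
  moreover have "l \<noteq> 0" using l subspace_0[OF subspace_ker] by (auto simp: m11_simps)
  ultimately have "range (m11 l) = ker v"
    using dk dim_range_m11[of l] subspace_ker linear_subspace_image[OF linear_m11_right subspace_UNIV]
    by (intro subspace_dim_equal) auto
  then have Ul: "U \<subseteq> range (m11 l)" using sub by (auto simp: W_def intro: span_base)
  have "dim {l} < DIM(real ^ 4)" by simp
  then obtain z where z: "z \<noteq> 0" "\<And>y. y \<in> span {l} \<Longrightarrow> orthogonal z y"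
    using orthogonal_to_subspace_exists by blast
  have "l \<bullet> z = 0" using z(2)[of l] by (simp add: orthogonal_def span_base inner_commute)
  then have "ev x z = 0" if "x \<in> U" for x using Ul that by auto
  then show False using U(3) z(1) by (auto simp: zero_free_def)
qed

text \<open>A basis of a smaller \<open>U\<close> extends to one of a four-dimensional kernel;
  dropping a new basis vector gives a three-dimensional space containing \<open>U\<close>, to which
  \<open>no_three_aux\<close> applies.\<close>

lemma zero_free_dim_ge_4:
  assumes v: "psd v" "v \<noteq> 0" and U: "subspace U" "U \<subseteq> ker v" "zero_free U"
  shows "dim U \<ge> 4"
proof (rule ccontr)
  assume d: "\<not> 4 \<le> dim U"
  obtain w where w: "psd w" "w \<noteq> 0" "ker v \<subseteq> ker w" "dim (ker w) = 4" "ann (ker w) = span {w}"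
    using kernel_dim_4_above[OF v zero_free_mono[OF U(3,2)]] by blast
  obtain A where A: "A \<subseteq> U" "independent A" "U \<subseteq> span A" "card A = dim U" using basis_exists by blast
  have "A \<subseteq> ker w" using A U w by blast
  then obtain C where C: "A \<subseteq> C" "C \<subseteq> ker w" "independent C" "ker w \<subseteq> span C"
    using maximal_independent_subset_extend[of A "ker w"] A(2) by blast
  have cC: "card C = 4" using basis_card_eq_dim[OF C(2,4,3)] w(4) by simp
  have "A \<noteq> C" using A(4) cC d by auto
  then obtain q where q: "q \<in> C" "q \<notin> A" using C(1) by blast
  let ?U = "span (C - {q})"
  have "independent (C - {q})" using independent_mono[OF C(3)] by auto
  then have "dim ?U = 3" using cC q(1) dim_eq_card_independent[of "C - {q}"] by simp
  moreover have "U \<subseteq> ?U" using A(3) span_mono[of A "C - {q}"] C(1) q(2) by auto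
  moreover have "?U \<subseteq> ker w" using C(2) by (intro span_minimal subspace_ker) auto
  moreover have "q \<notin> ?U" using C(3) q(1) by (auto simp: dependent_def)
  ultimately show False
    using no_three_aux[of ?U w q] zero_free_mono[OF U(3)] w C(2) q(1) by auto
qed

section \<open>The cone of sums of squares and its normal cones\<close>

definition sq_cone :: "(real ^ quartic_mon) set" where
  "sq_cone = {\<Sum>x\<leftarrow>xs. m22 x x | xs. True}"

lemma pf_sq_sum: "pf (\<Sum>x\<leftarrow>xs. m22 x x) = (\<Sum>p\<leftarrow>map qf xs. p\<^sup>2)"
  by (induction xs) (auto simp: linear_0[OF linear_form_of] linear_add[OF linear_form_of] power2_eq_square)

lemma sos_rep_vec: assumes "sos_rep f ps"
  shows "f \<in> forms 4" "vec4 f = (\<Sum>x\<leftarrow>map (coords quad_exps) ps. m22 x x)" "map qf (map (coords quad_exps) ps) = ps"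
proof -
  have ps: "p \<in> forms 2" if "p \<in> set ps" for p using assms that by (auto simp: sos_rep_def)
  show m: "map qf (map (coords quad_exps) ps) = ps"
    using ps by (simp add: i2.form_of_coords map_idI)
  have "f = pf (\<Sum>x\<leftarrow>map (coords quad_exps) ps. m22 x x)"
    using assms unfolding pf_sq_sum m by (simp add: sos_rep_def)
  then show "vec4 f = (\<Sum>x\<leftarrow>map (coords quad_exps) ps. m22 x x)" "f \<in> forms 4" by simp_all
qed

lemma sos_rep_map_qf: "sos_rep (pf (\<Sum>x\<leftarrow>xs. m22 x x)) (map qf xs)"
  using pf_sq_sum[of xs] by (auto simp: sos_rep_def)

lemma Sigma4_subset: "Sigma4 \<subseteq> forms 4"
  using sos_rep_vec(1) by (auto simp: Sigma4_def)

lemma vec4_Sigma4: "vec4 ` Sigma4 = sq_cone"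
proof
  show "vec4 ` Sigma4 \<subseteq> sq_cone"
  proof
    fix y assume "y \<in> vec4 ` Sigma4"
    then obtain f ps where "sos_rep f ps" "y = vec4 f" by (auto simp: Sigma4_def)
    then show "y \<in> sq_cone" unfolding sq_cone_def using sos_rep_vec(2) by blast
  qed
  show "sq_cone \<subseteq> vec4 ` Sigma4"
  proof
    fix y assume "y \<in> sq_cone"
    then obtain xs where y: "y = (\<Sum>x\<leftarrow>xs. m22 x x)" by (auto simp: sq_cone_def)
    have "pf y \<in> Sigma4" unfolding y Sigma4_def using sos_rep_map_qf by blast
    then show "y \<in> vec4 ` Sigma4" using i4.coords_form_of[of y] by (metis imageI)
  qed
qed

lemma sq_cone_add: "a \<in> sq_cone \<Longrightarrow> b \<in> sq_cone \<Longrightarrow> a + b \<in> sq_cone"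
proof -
  assume "a \<in> sq_cone" "b \<in> sq_cone"
  then obtain xs ys where "a = (\<Sum>x\<leftarrow>xs. m22 x x)" "b = (\<Sum>x\<leftarrow>ys. m22 x x)" by (auto simp: sq_cone_def)
  then have "a + b = (\<Sum>x\<leftarrow>xs @ ys. m22 x x)" by simp
  then show ?thesis unfolding sq_cone_def by blast
qed

lemma sq_cone_square: "m22 x x \<in> sq_cone"
  unfolding sq_cone_def by (intro CollectI exI[of _ "[x]"]) simp

lemma sq_cone_0: "0 \<in> sq_cone"
  using sq_cone_square[of 0] by (simp add: m22_simps)

lemma sq_cone_scale: assumes "0 \<le> c" "a \<in> sq_cone" shows "c *\<^sub>R a \<in> sq_cone"
proof -
  obtain xs where a: "a = (\<Sum>x\<leftarrow>xs. m22 x x)" using assms(2) by (auto simp: sq_cone_def)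
  have "c *\<^sub>R a = (\<Sum>x\<leftarrow>map (\<lambda>x. sqrt c *\<^sub>R x) xs. m22 x x)"
    unfolding a by (induction xs) (use assms(1) in \<open>auto simp: m22_simps scaleR_add_right\<close>)
  then show ?thesis unfolding sq_cone_def by blast
qed

lemma convex_sq_cone: "convex sq_cone"
  by (auto simp: convex_def intro!: sq_cone_add sq_cone_scale)

lemma ev_axis:
  assumes "quad_exps m = lin_exps i + lin_exps j" shows "ev (axis m 1) a = a $ i * a $ j"
  unfolding m11_axis[OF assms, symmetric] by (simp add: inner_axis_axis inner_axis' mult.commute)

text \<open>Polarisation isolates a coefficient: at the two coordinate vectors of a monomial
  \<open>m0\<close>, the polar form of every other quadratic monomial vanishes.\<close>

lemma ev_zero_imp:
  assumes "\<And>a. ev x a = 0" shows "x = 0"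
proof -
  have x: "x = (\<Sum>m\<in>UNIV. x $ m *\<^sub>R axis m 1)"
    by (simp add: vec_eq_iff axis_def if_distrib sum.delta cong: if_cong)
  have "\<exists>s. \<forall>m. quad_exps m = lin_exps (fst (s m)) + lin_exps (snd (s m))"
    by (rule choice) (use quad_exps_split in fastforce)
  then obtain s where s: "\<And>m. quad_exps m = lin_exps (fst (s m)) + lin_exps (snd (s m))" by blast
  define g where "g m a b = a $ fst (s m) * b $ snd (s m) + b $ fst (s m) * a $ snd (s m)" for m and a b :: "real ^ 4"
  have evx: "ev x a = (\<Sum>m\<in>UNIV. x $ m * (a $ fst (s m) * a $ snd (s m)))" for a
    by (subst x) (simp add: linear_sum[OF linear_ev] linear_cmul[OF linear_ev] ev_axis[OF s])
  have pol: "(\<Sum>m\<in>UNIV. x $ m * g m a b) = 0" for a b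
  proof -
    have "(\<Sum>m\<in>UNIV. x $ m * g m a b) = ev x (a + b) - ev x a - ev x b"
      unfolding evx g_def sum_subtractf[symmetric] by (rule sum.cong) (auto simp: algebra_simps)
    then show ?thesis by (simp add: assms)
  qed
  have "x $ m0 = 0" for m0
  proof -
    let ?a = "axis (fst (s m0)) 1 :: real ^ 4" and ?b = "axis (snd (s m0)) 1 :: real ^ 4"
    have z: "g m ?a ?b = 0" if "m \<noteq> m0" for m
    proof (rule ccontr)
      assume "g m ?a ?b \<noteq> 0"
      then have "(fst (s m) = fst (s m0) \<and> snd (s m) = snd (s m0)) \<or> (fst (s m) = snd (s m0) \<and> snd (s m) = fst (s m0))"
        by (auto simp: g_def axis_def split: if_splits)
      then have "quad_exps m = quad_exps m0" using s[of m] s[of m0] by (auto simp: add.commute)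
      then show False using that by (simp add: quad_exps_inject)
    qed
    have "(\<Sum>m\<in>UNIV. x $ m * g m ?a ?b) = (\<Sum>m\<in>{m0}. x $ m * g m ?a ?b)"
      by (rule sum.mono_neutral_right) (use z in auto)
    then have "x $ m0 * g m0 ?a ?b = 0" using pol by simp
    moreover have "g m0 ?a ?b \<noteq> 0" by (auto simp: g_def axis_def)
    ultimately show ?thesis by simp
  qed
  then show ?thesis by (simp add: vec_eq_iff)
qed

definition ev4 :: "real ^ quartic_mon \<Rightarrow> real ^ 4 \<Rightarrow> real" where
  "ev4 y a = mpoly_eval (pf y) (\<lambda>i. a $ i)"

lemma linear_ev4: "linear (\<lambda>y. ev4 y a)"
  by (rule linearI) (auto simp: ev4_def linear_add[OF linear_form_of] linear_cmul[OF linear_form_of])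

lemma ev4_m22 [simp]: "ev4 (m22 x y) a = ev x a * ev y a"
  by (simp add: ev4_def ev_def)

text \<open>The cone over a compact convex set is closed if the set avoids 0. Here point evaluations
  are nonnegative on the convex hull, so a combination equal to 0 would contain a square vanishing
  at all points, although its root has norm 1.\<close>

lemma closed_sq_cone: "closed sq_cone"
proof -
  let ?C = "(\<lambda>x. m22 x x) ` sphere 0 1"
  let ?K = "convex hull ?C"
  have "compact ?C"
    by (intro compact_continuous_image compact_sphere
        bounded_bilinear.continuous_on[OF bilinear_m22[unfolded bilinear_conv_bounded_bilinear]] continuous_on_id)
  then have cK: "compact ?K" by (rule compact_convex_hull)
  have nonneg: "?K \<subseteq> {y. \<forall>a. 0 \<le> ev4 y a}"
    by (rule hull_minimal)
      (auto simp: convex_def linear_add[OF linear_ev4] linear_cmul[OF linear_ev4])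
  have "0 \<notin> ?K"
  proof
    assume "0 \<in> ?K"
    then obtain S u where S: "finite S" "S \<subseteq> ?C" "\<forall>y\<in>S. 0 \<le> u y" "sum u S = 1" "(\<Sum>y\<in>S. u y *\<^sub>R y) = 0"
      unfolding convex_hull_explicit by auto
    have e: "(\<Sum>y\<in>S. u y * ev4 y a) = 0" for a
      using arg_cong[OF S(5), of "\<lambda>y. ev4 y a"]
      by (simp add: linear_sum[OF linear_ev4] linear_cmul[OF linear_ev4] linear_0[OF linear_ev4])
    have nn: "0 \<le> ev4 y a" if "y \<in> S" for y a using that S(2) by auto
    have "\<exists>y\<in>S. u y \<noteq> 0" using S(4) by (metis sum.neutral zero_neq_one)
    then obtain y where y: "y \<in> S" "u y \<noteq> 0" by blast
    have "ev4 y a = 0" for a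
      using e[of a] sum_nonneg_eq_0_iff[OF S(1), of "\<lambda>y. u y * ev4 y a"] nn S(3) y by auto
    moreover obtain x where x: "y = m22 x x" "norm x = 1" using S(2) y(1) by auto
    ultimately have "x = 0" by (intro ev_zero_imp) simp
    then show False using x by simp
  qed
  then have cl: "closed (conic hull ?K)" using cK by (intro closed_conic_hull) auto
  have "conic hull ?K = sq_cone"
  proof
    have "?K \<subseteq> sq_cone" using sq_cone_square by (intro hull_minimal convex_sq_cone) auto
    then show "conic hull ?K \<subseteq> sq_cone"
      by (rule hull_minimal) (auto simp: conic_def intro: sq_cone_scale)
    have con: "conic (conic hull ?K)" by (rule conic_conic_hull)
    have cvx: "convex (conic hull ?K)" by (intro convex_conic_hull convex_convex_hull)
    have add: "a + b \<in> conic hull ?K" if "a \<in> conic hull ?K" "b \<in> conic hull ?K" for a b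
    proof -
      have "(1/2) *\<^sub>R a + (1/2) *\<^sub>R b \<in> conic hull ?K" using cvx that by (simp add: convex_def)
      from conicD[OF con this, of 2] show ?thesis by (simp add: scaleR_add_right)
    qed
    have unit: "m22 x x \<in> conic hull ?K" if "norm x = 1" for x
      using that by (intro hull_inc) auto
    have sq: "m22 x x \<in> conic hull ?K" for x
    proof (cases "x = 0")
      case True
      obtain e :: "real ^ quad_mon" where e: "norm e = 1" using vector_choose_size[of 1] by auto
      show ?thesis using conicD[OF con unit[OF e], of 0] True by (simp add: m22_simps)
    next
      case False
      have "m22 ((1 / norm x) *\<^sub>R x) ((1 / norm x) *\<^sub>R x) \<in> conic hull ?K" using False by (intro unit) simp
      from conicD[OF con this, of "(norm x)\<^sup>2"] show ?thesis
        using False by (simp add: m22_simps power2_eq_square)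
    qed
    have "(\<Sum>x\<leftarrow>xs. m22 x x) \<in> conic hull ?K" for xs
      by (induction xs) (use sq[of 0] add sq in \<open>auto simp: m22_simps\<close>)
    then show "sq_cone \<subseteq> conic hull ?K" by (auto simp: sq_cone_def)
  qed
  then show ?thesis using cl by simp
qed

lemma span_sq_cone: "span sq_cone = UNIV"
proof -
  have "m22 x y = (1 / 4) *\<^sub>R (m22 (x + y) (x + y) - m22 (x - y) (x - y))" for x y
    by (simp add: m22_simps m22_commute[of y x] vec_eq_iff)
  then have "m22 x y \<in> span sq_cone" for x y
    using sq_cone_square by (metis span_base span_diff span_scale)
  then have "span {m22 a b | a b. True} \<subseteq> span sq_cone" by (intro span_minimal) auto
  then show ?thesis unfolding span_m22 by auto
qed

text \<open>Squares span the quartics, so a noninterior point lies on the relative boundary.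
  Comparing \<open>y\<close> with 0 and with \<open>2 y\<close> shows that the supporting hyperplane
  passes through the origin.\<close>

lemma supporting_functional:
  assumes "y \<in> sq_cone" "y \<notin> interior sq_cone"
  obtains v where "v \<noteq> 0" "psd v" "v \<bullet> y = 0"
proof -
  have "affine hull sq_cone = UNIV"
    using affine_hull_span_0[of sq_cone] hull_inc[OF sq_cone_0] span_sq_cone by auto
  then have "y \<notin> rel_interior sq_cone" using assms(2) by (simp add: rel_interior_interior)
  then obtain v where v: "v \<noteq> 0" "\<And>z. z \<in> sq_cone \<Longrightarrow> v \<bullet> y \<le> v \<bullet> z"
    using supporting_hyperplane_rel_boundary[OF convex_sq_cone assms(1)] by metis
  have "v \<bullet> y \<le> 0" using v(2)[OF sq_cone_0] by simp
  moreover have "0 \<le> v \<bullet> y" using v(2)[OF sq_cone_scale[of 2, OF _ assms(1)]] by simp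
  ultimately have vy: "v \<bullet> y = 0" by simp
  have "psd v" using v(2)[OF sq_cone_square] vy by (simp add: psd_def B_def)
  then show ?thesis using that v(1) vy by blast
qed

section \<open>Topology of the space of quartics and its dual functionals\<close>

lemma homeomorphic_map_vec4: "homeomorphic_map A4_topology euclidean vec4"
proof -
  have top: "topspace A4_topology = forms 4"
    by (simp add: A4_topology_def topspace_pullback_topology)
  have "homeomorphic_maps A4_topology euclidean vec4 pf"
    unfolding homeomorphic_maps_def
  proof (intro conjI)
    have "continuous_map euclidean euclidean (\<lambda>g :: (4 \<Rightarrow>\<^sub>0 nat) \<Rightarrow> real. \<chi> m. g (exponents m))"
      by (simp add: continuous_on_vec_lambda)
    from continuous_map_pullback[OF this, of "forms 4" Poly_Mapping.lookup]
    show "continuous_map A4_topology euclidean vec4"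
      by (simp add: A4_topology_def coords_def[abs_def] comp_def)
    have "continuous_map euclidean euclidean (Poly_Mapping.lookup \<circ> pf)"
    proof -
      have "continuous_on UNIV (\<lambda>x :: real ^ quartic_mon. if exponents m = k then x $ m else 0)" for m k
        by (cases "exponents m = k") (auto intro: continuous_intros)
      then have "continuous_on UNIV (\<lambda>x. Poly_Mapping.lookup (pf x) k)" for k
        unfolding form_of_def lookup_sum lookup_single when_def by (intro continuous_on_sum)
      then show ?thesis by (auto intro: continuous_on_coordinatewise_then_product simp: comp_def)
    qed
    then show "continuous_map euclidean A4_topology pf"
      unfolding A4_topology_def by (rule continuous_map_pullback') auto
  qed (auto simp: top i4.form_of_coords)
  then show ?thesis by (simp add: homeomorphic_maps_map)
qed

lemma boundary_iff: "f \<in> boundary_Sigma4 \<longleftrightarrow> f \<in> Sigma4 \<and> vec4 f \<notin> interior sq_cone"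
proof -
  have top: "topspace A4_topology = forms 4"
    by (simp add: A4_topology_def topspace_pullback_topology)
  have fr: "frontier sq_cone = vec4 ` boundary_Sigma4"
    using homeomorphic_map_frontier_of[OF homeomorphic_map_vec4, of Sigma4] Sigma4_subset
    by (simp add: top vec4_Sigma4 boundary_Sigma4_def)
  have fr2: "frontier sq_cone = sq_cone - interior sq_cone"
    using closed_sq_cone by (simp add: frontier_def)
  have sub: "boundary_Sigma4 \<subseteq> forms 4"
    unfolding boundary_Sigma4_def using frontier_of_subset_topspace[of A4_topology] top by auto
  have inj: "f = g" if "f \<in> forms 4" "g \<in> forms 4" "vec4 f = vec4 g" for f g
    using that i4.form_of_coords by metis
  show ?thesis
  proof
    assume f: "f \<in> boundary_Sigma4"
    then have "vec4 f \<in> sq_cone - interior sq_cone" using fr fr2 by auto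
    moreover obtain g where "g \<in> Sigma4" "vec4 g = vec4 f" using calculation vec4_Sigma4 by (metis Diff_iff imageE)
    then have "f = g" using inj[of f g] f sub Sigma4_subset by auto
    ultimately show "f \<in> Sigma4 \<and> vec4 f \<notin> interior sq_cone" using \<open>g \<in> Sigma4\<close> by simp
  next
    assume f: "f \<in> Sigma4 \<and> vec4 f \<notin> interior sq_cone"
    then have "vec4 f \<in> vec4 ` boundary_Sigma4" unfolding fr[symmetric] fr2 using vec4_Sigma4 by auto
    then obtain g where "g \<in> boundary_Sigma4" "vec4 f = vec4 g" by auto
    then show "f \<in> boundary_Sigma4" using inj[of f g] f sub Sigma4_subset by auto
  qed
qed

definition functional_of :: "real ^ quartic_mon \<Rightarrow> quaternary \<Rightarrow> real" where
  "functional_of v p = v \<bullet> vec4 p"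

lemma vec4_other: "p \<in> forms d \<Longrightarrow> d \<noteq> 4 \<Longrightarrow> vec4 p = 0"
  using exponents by (auto simp: coords_def vec_eq_iff forms_iff)

lemma functional_of_dual: "functional_of v \<in> A4_dual"
  unfolding A4_dual_def functional_of_def
  by (auto intro!: linearI simp: linear_add[OF linear_coords] linear_cmul[OF linear_coords]
      inner_add_right vec4_other)

lemma functional_of_pf [simp]: "functional_of v (pf y) = v \<bullet> y"
  by (simp add: functional_of_def)

lemma A4_dual_functional:
  assumes "\<alpha> \<in> A4_dual" obtains v where "\<alpha> = functional_of v"
proof -
  have lin: "linear \<alpha>" and z: "\<And>d p. d \<noteq> 4 \<Longrightarrow> p \<in> forms d \<Longrightarrow> \<alpha> p = 0"
    using assms by (auto simp: A4_dual_def)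
  define v where "v = adjoint (\<lambda>y. \<alpha> (pf y)) 1"
  have lin': "linear (\<lambda>y. \<alpha> (pf y))"
    by (rule linearI) (simp_all add: linear_add[OF linear_form_of] linear_cmul[OF linear_form_of] linear_add[OF lin] linear_cmul[OF lin])
  have v: "\<alpha> (pf y) = v \<bullet> y" for y using adjoint_works[OF lin', of y 1] by (simp add: v_def inner_commute)
  have "\<alpha> p = functional_of v p" for p
  proof (induction p rule: poly_mapping_single_add_induct)
    case zero
    show ?case using linear_0[OF lin] by (simp add: functional_of_def linear_0[OF linear_coords])
  next
    case (single m c)
    have s: "Poly_Mapping.single m c \<in> forms (mon_degree m)" by simp
    show ?case
    proof (cases "mon_degree m = 4")
      case True
      then have "pf (vec4 (Poly_Mapping.single m c)) = Poly_Mapping.single m c" by (intro i4.form_of_coords) simp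
      then show ?thesis using v[of "vec4 (Poly_Mapping.single m c)"] by (simp add: functional_of_def)
    next
      case False
      then show ?thesis using z[OF False s] vec4_other[OF s False] by (simp add: functional_of_def)
    qed
  next
    case (add p q)
    then show ?case by (simp add: linear_add[OF lin] functional_of_def linear_add[OF linear_coords] inner_add_right)
  qed
  then show ?thesis using that by blast
qed

lemma functional_of_dual_cone: "functional_of v \<in> Sigma4_dual_cone \<longleftrightarrow> psd v"
proof
  assume "functional_of v \<in> Sigma4_dual_cone"
  then have "0 \<le> functional_of v g" if "g \<in> Sigma4" for g using that by (auto simp: Sigma4_dual_cone_def)
  moreover have "pf (m22 x x) \<in> Sigma4" for x
    using sos_rep_map_qf[of "[x]"] by (auto simp: Sigma4_def)
  ultimately show "psd v" unfolding psd_def B_def by (metis functional_of_pf)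
next
  assume v: "psd v"
  have "0 \<le> functional_of v g" if g: "g \<in> Sigma4" for g
  proof -
    have "vec4 g \<in> sq_cone" using g vec4_Sigma4 by blast
    then obtain xs where "vec4 g = (\<Sum>x\<leftarrow>xs. m22 x x)" by (auto simp: sq_cone_def)
    moreover have "0 \<le> v \<bullet> (\<Sum>x\<leftarrow>xs. m22 x x)"
      by (induction xs) (use v in \<open>auto simp: inner_add_right psd_def B_def\<close>)
    ultimately show ?thesis by (simp add: functional_of_def)
  qed
  then show "functional_of v \<in> Sigma4_dual_cone" by (simp add: Sigma4_dual_cone_def functional_of_dual)
qed

lemma inner_sum_list: "v \<bullet> (\<Sum>x\<leftarrow>xs. f x) = (\<Sum>x\<leftarrow>xs. v \<bullet> f x)"
  by (induction xs) (auto simp: inner_add_right)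

lemma squares_in_kernel:
  assumes v: "psd v" "v \<bullet> (\<Sum>x\<leftarrow>xs. m22 x x) = 0" shows "set xs \<subseteq> ker v"
proof -
  have "(\<Sum>x\<leftarrow>xs. B v x x) = 0" using v(2) by (simp add: inner_sum_list B_def)
  moreover have "\<forall>y\<in>set (map (\<lambda>x. B v x x) xs). 0 \<le> y" using v(1) by (auto simp: psd_def)
  ultimately have "\<forall>x\<in>set xs. B v x x = 0" using sum_list_nonneg_eq_0_iff[of "map (\<lambda>x. B v x x) xs"] by auto
  then show ?thesis using psd_ker[OF v(1)] by blast
qed

lemma zero_free_representation:
  assumes "strictly_positive (pf (\<Sum>x\<leftarrow>xs. m22 x x))" shows "zero_free (span (set xs))"
  unfolding zero_free_def
proof (intro allI impI)
  fix a :: "real ^ 4" assume "a \<noteq> 0"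
  then have "ev4 (\<Sum>x\<leftarrow>xs. m22 x x) a > 0" using assms by (auto simp: strictly_positive_def ev4_def)
  moreover have "ev4 (\<Sum>x\<leftarrow>xs. m22 x x) a = (\<Sum>x\<leftarrow>xs. (ev x a)\<^sup>2)"
    by (induction xs) (auto simp: linear_0[OF linear_ev4] linear_add[OF linear_ev4] power2_eq_square)
  ultimately have "\<exists>x\<in>set xs. ev x a \<noteq> 0"
    by (metis (no_types, lifting) less_irrefl map_eq_conv power_zero_numeral sum_list_0)
  then show "\<exists>x\<in>span (set xs). ev x a \<noteq> 0" using span_base by blast
qed

text \<open>For each supporting functional \<open>w\<close> and each representation
  \<open>xs\<close>, the dimensions satisfy 4 <= dim span <= dim kernel <= 4. So the kernel of
  \<open>w\<close> is the span of \<open>xs\<close> and does not depend on \<open>w\<close>, which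
  makes all supporting functionals proportional.\<close>

lemma boundary_functional:
  assumes "f \<in> boundary_Sigma4" "strictly_positive f"
  obtains v where "psd v" "v \<noteq> 0" "dim (ker v) = 4" "ann (ker v) = span {v}"
    "is_ray (normal_cone f)" "\<And>xs. vec4 f = (\<Sum>x\<leftarrow>xs. m22 x x) \<Longrightarrow> span (set xs) = ker v"
proof -
  have f: "f \<in> Sigma4" "vec4 f \<notin> interior sq_cone" using assms(1) by (simp_all add: boundary_iff)
  then have "vec4 f \<in> sq_cone" using vec4_Sigma4 by blast
  then obtain v where v: "v \<noteq> 0" "psd v" "v \<bullet> vec4 f = 0" using supporting_functional f(2) by blast
  have pff: "pf (vec4 f) = f" using f(1) Sigma4_subset by (intro i4.form_of_coords) auto
  have gen: "span (set xs) = ker w \<and> dim (ker w) = 4 \<and> ann (ker w) = span {w}"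
    if w: "w \<noteq> 0" "psd w" "w \<bullet> vec4 f = 0" and xs: "vec4 f = (\<Sum>x\<leftarrow>xs. m22 x x)" for w xs
  proof -
    have sub: "span (set xs) \<subseteq> ker w"
      using squares_in_kernel[OF w(2)] w(3) xs by (intro span_minimal subspace_ker) auto
    have zf: "zero_free (span (set xs))" using zero_free_representation[of xs] assms(2) pff xs by simp
    have zf': "zero_free (ker w)" by (rule zero_free_mono[OF zf sub])
    have "dim (span (set xs)) \<ge> 4" by (rule zero_free_dim_ge_4[OF w(2,1) subspace_span sub zf])
    moreover have "dim (ker w) \<le> 4" by (rule kernel_dim_le_4[OF w(2,1) zf'])
    moreover have "dim (span (set xs)) \<le> dim (ker w)" using sub by (rule dim_subset)
    ultimately have "dim (ker w) = 4" "dim (ker w) \<le> dim (span (set xs))" by linarith+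
    then show ?thesis
      using ann_kernel_dim_4[OF w(2,1) zf'] subspace_dim_equal[OF subspace_span subspace_ker sub] by blast
  qed
  obtain xs where xs: "vec4 f = (\<Sum>x\<leftarrow>xs. m22 x x)" using \<open>vec4 f \<in> sq_cone\<close> by (auto simp: sq_cone_def)
  note g = gen[OF v xs]
  have nc: "normal_cone f = {functional_of w | w. psd w \<and> w \<bullet> vec4 f = 0}"
  proof
    show "normal_cone f \<subseteq> {functional_of w | w. psd w \<and> w \<bullet> vec4 f = 0}"
    proof
      fix \<alpha> assume \<alpha>: "\<alpha> \<in> normal_cone f"
      then have "\<alpha> \<in> A4_dual" by (simp add: normal_cone_def Sigma4_dual_cone_def)
      then obtain w where w: "\<alpha> = functional_of w" by (rule A4_dual_functional)
      then have "psd w" "w \<bullet> vec4 f = 0"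
        using \<alpha> functional_of_dual_cone[of w] by (auto simp: normal_cone_def functional_of_def)
      then show "\<alpha> \<in> {functional_of w | w. psd w \<and> w \<bullet> vec4 f = 0}" using w by blast
    qed
    show "{functional_of w | w. psd w \<and> w \<bullet> vec4 f = 0} \<subseteq> normal_cone f"
      by (auto simp: normal_cone_def functional_of_dual_cone functional_of_def)
  qed
  have "normal_cone f = {\<lambda>p. c * functional_of v p | c. c \<ge> 0}"
  proof
    show "normal_cone f \<subseteq> {\<lambda>p. c * functional_of v p | c. c \<ge> 0}"
    proof
      fix \<alpha> assume "\<alpha> \<in> normal_cone f"
      then obtain w where w: "\<alpha> = functional_of w" "psd w" "w \<bullet> vec4 f = 0" unfolding nc by blast
      have "\<exists>c\<ge>0. w = c *\<^sub>R v"
      proof (cases "w = 0")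
        case False
        then have "ker w = ker v" using gen[OF False w(2,3) xs] g by simp
        then have "w \<in> span {v}" using g ann_iff_ker[of w "ker v"] by auto
        then obtain c where c: "w = c *\<^sub>R v" by (auto simp: span_singleton)
        obtain y where "y \<notin> ker v" using ker_eq_UNIV v(1) by blast
        then have "0 < B v y y" using psd_pos[OF v(2)] by blast
        moreover have "0 \<le> c * B v y y" using w(2) by (simp add: c psd_def B_simps)
        ultimately have "0 \<le> c" by (simp add: zero_le_mult_iff)
        then show ?thesis using c by blast
      qed (auto intro: exI[of _ 0])
      then obtain c where "0 \<le> c" "w = c *\<^sub>R v" by blast
      then have "\<alpha> = (\<lambda>p. c * functional_of v p)" using w(1) by (auto simp: functional_of_def)
      then show "\<alpha> \<in> {\<lambda>p. c * functional_of v p | c. c \<ge> 0}" using \<open>0 \<le> c\<close> by blast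
    qed
    show "{\<lambda>p. c * functional_of v p | c. c \<ge> 0} \<subseteq> normal_cone f"
    proof clarify
      fix c :: real assume "0 \<le> c"
      then have "psd (c *\<^sub>R v)" "(c *\<^sub>R v) \<bullet> vec4 f = 0" using v psd_scale by auto
      moreover have "(\<lambda>p. c * functional_of v p) = functional_of (c *\<^sub>R v)" by (auto simp: functional_of_def)
      ultimately show "(\<lambda>p. c * functional_of v p) \<in> normal_cone f" unfolding nc by blast
    qed
  qed
  moreover have "functional_of v \<noteq> (\<lambda>_. 0)"
  proof
    assume "functional_of v = (\<lambda>_. 0)"
    then have "v \<bullet> v = 0" using functional_of_pf[of v v] by metis
    then show False using v(1) by simp
  qed
  ultimately have "is_ray (normal_cone f)" unfolding is_ray_def using functional_of_dual by blast
  then show ?thesis using that[OF v(2,1)] g gen[OF v] by blast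
qed

section \<open>Orthogonal equivalence\<close>

definition dot :: "nat \<Rightarrow> (nat \<Rightarrow> real) \<Rightarrow> (nat \<Rightarrow> real) \<Rightarrow> real" where
  "dot r x y = (\<Sum>k<r. x k * y k)"

definition mat_app :: "nat \<Rightarrow> (nat \<Rightarrow> nat \<Rightarrow> real) \<Rightarrow> (nat \<Rightarrow> real) \<Rightarrow> nat \<Rightarrow> real" where
  "mat_app r a x i = (\<Sum>k<r. a i k * x k)"

lemma sum_delta_mult: "i < (r :: nat) \<Longrightarrow> (\<Sum>k<r. (if i = k then 1 else 0) * f k) = (f i :: real)"
proof -
  assume "i < r"
  have "(\<Sum>k<r. (if i = k then 1 else 0) * f k) = (\<Sum>k<r. if k = i then f k else 0)"
    by (rule sum.cong) auto
  then show ?thesis using \<open>i < r\<close> by (simp add: sum.delta)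
qed

lemma dot_commute: "dot r x y = dot r y x"
  by (simp add: dot_def mult.commute)

lemma orthogonal_mat_id: "orthogonal_mat r (\<lambda>i j. if i = j then 1 else 0)"
proof -
  have "(\<Sum>k<r. (if i = k then 1 else 0) * (if j = k then 1 else 0)) = (if i = j then 1 else (0 :: real))"
    if "i < r" for i j using sum_delta_mult[OF that, of "\<lambda>k. if j = k then 1 else 0"] by auto
  moreover have "(\<Sum>k<r. (if k = i then 1 else 0) * (if k = j then 1 else 0)) =
      (\<Sum>k<r. (if i = k then 1 else 0) * (if j = k then 1 else (0 :: real)))" for i j
    by (rule sum.cong) auto
  ultimately show ?thesis unfolding orthogonal_mat_def by simp
qed

lemma orthogonal_mat_transpose: "orthogonal_mat r a \<Longrightarrow> orthogonal_mat r (\<lambda>i j. a j i)"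
  by (simp add: orthogonal_mat_def)

lemma orthogonal_mat_rows_mult:
  fixes a b :: "nat \<Rightarrow> nat \<Rightarrow> real"
  assumes a: "\<forall>i<r. \<forall>j<r. (\<Sum>k<r. a i k * a j k) = (if i = j then 1 else 0)"
    and b: "\<forall>i<r. \<forall>j<r. (\<Sum>k<r. b i k * b j k) = (if i = j then 1 else (0 :: real))"
    and ij: "i < r" "j < r"
  shows "(\<Sum>k<r. (\<Sum>l<r. a i l * b l k) * (\<Sum>l<r. a j l * b l k)) = (if i = j then 1 else 0)"
proof -
  have "(\<Sum>k<r. (\<Sum>l<r. a i l * b l k) * (\<Sum>l<r. a j l * b l k)) =
      (\<Sum>k<r. \<Sum>l<r. \<Sum>m<r. (a i l * a j m) * (b l k * b m k))"
    by (simp add: sum_product mult_ac)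
  also have "\<dots> = (\<Sum>l<r. \<Sum>m<r. \<Sum>k<r. (a i l * a j m) * (b l k * b m k))"
    by (subst sum.swap, rule sum.cong[OF refl], subst sum.swap) simp
  also have "\<dots> = (\<Sum>l<r. \<Sum>m<r. (a i l * a j m) * (if l = m then 1 else 0))"
    by (intro sum.cong refl) (simp add: sum_distrib_left[symmetric] b)
  also have "\<dots> = (\<Sum>l<r. a i l * a j l)"
  proof (rule sum.cong[OF refl])
    fix l assume "l \<in> {..<r}"
    then show "(\<Sum>m<r. (a i l * a j m) * (if l = m then 1 else 0)) = a i l * a j l"
      using sum_delta_mult[of l r "\<lambda>m. a i l * a j m"] by (simp add: mult.commute)
  qed
  finally show ?thesis using a ij by simp
qed

lemma orthogonal_mat_mult:
  assumes "orthogonal_mat r a" "orthogonal_mat r b"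
  shows "orthogonal_mat r (\<lambda>i k. \<Sum>l<r. a i l * b l k)"
proof -
  have "(\<Sum>k<r. (\<Sum>l<r. a k l * b l i) * (\<Sum>l<r. a k l * b l j)) = (if i = j then 1 else 0)" if "i < r" "j < r" for i j
    using orthogonal_mat_rows_mult[of r "\<lambda>i j. b j i" "\<lambda>i j. a j i" i j] assms that
    by (simp add: orthogonal_mat_def mult.commute)
  then show ?thesis
    using orthogonal_mat_rows_mult[of r a b] assms by (simp add: orthogonal_mat_def)
qed

lemma mat_app_mult: "mat_app r (\<lambda>i k. \<Sum>l<r. a i l * b l k) x i = mat_app r a (mat_app r b x) i"
proof -
  have "(\<Sum>k<r. \<Sum>l<r. a i l * b l k * x k) = (\<Sum>l<r. \<Sum>k<r. a i l * b l k * x k)" by (rule sum.swap)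
  then show ?thesis by (simp add: mat_app_def sum_distrib_left sum_distrib_right mult.assoc)
qed

lemma dot_mat_app:
  assumes "orthogonal_mat r a" shows "dot r (mat_app r a x) (mat_app r a y) = dot r x y"
proof -
  have "dot r (mat_app r a x) (mat_app r a y) = (\<Sum>i<r. \<Sum>k<r. \<Sum>l<r. (x k * y l) * (a i k * a i l))"
    by (simp add: dot_def mat_app_def sum_product mult_ac)
  also have "\<dots> = (\<Sum>k<r. \<Sum>l<r. \<Sum>i<r. (x k * y l) * (a i k * a i l))"
    by (subst sum.swap, rule sum.cong[OF refl], subst sum.swap) simp
  also have "\<dots> = (\<Sum>k<r. \<Sum>l<r. (x k * y l) * (if k = l then 1 else 0))"
    by (intro sum.cong refl) (use assms in \<open>simp add: sum_distrib_left[symmetric] orthogonal_mat_def\<close>)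
  also have "\<dots> = (\<Sum>k<r. x k * y k)"
  proof (rule sum.cong[OF refl])
    fix k assume "k \<in> {..<r}"
    then show "(\<Sum>l<r. (x k * y l) * (if k = l then 1 else 0)) = x k * y k"
      using sum_delta_mult[of k r "\<lambda>l. x k * y l"] by (simp add: mult.commute)
  qed
  finally show ?thesis by (simp add: dot_def)
qed

definition householder :: "nat \<Rightarrow> (nat \<Rightarrow> real) \<Rightarrow> nat \<Rightarrow> nat \<Rightarrow> real" where
  "householder r u i k = (if i = k then 1 else 0) - 2 * u i * u k / dot r u u"

lemma mat_app_householder:
  "i < r \<Longrightarrow> mat_app r (householder r u) x i = x i - 2 * dot r u x / dot r u u * u i"
proof -
  assume i: "i < r"
  have "mat_app r (householder r u) x i =
      (\<Sum>k<r. (if i = k then 1 else 0) * x k) - (\<Sum>k<r. (2 * u i / dot r u u) * (u k * x k))"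
    unfolding mat_app_def householder_def sum_subtractf[symmetric]
    by (rule sum.cong) (auto simp: algebra_simps)
  also have "\<dots> = x i - 2 * u i / dot r u u * dot r u x"
    unfolding sum_delta_mult[OF i] by (simp add: dot_def[of _ _ x] sum_distrib_left)
  finally show ?thesis by simp
qed

lemma orthogonal_householder:
  assumes "dot r u u \<noteq> 0" shows "orthogonal_mat r (householder r u)"
proof -
  have sym: "householder r u i k = householder r u k i" for i k by (simp add: householder_def)
  have "(\<Sum>k<r. householder r u i k * householder r u j k) = (if i = j then 1 else 0)" if "i < r" "j < r" for i j
  proof -
    have "dot r u (\<lambda>k. householder r u j k) = mat_app r (householder r u) u j"
      by (simp add: dot_def mat_app_def mult.commute)
    also have "\<dots> = - u j" using assms by (simp add: mat_app_householder[OF that(2)])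
    finally have *: "dot r u (householder r u j) = - u j" by (simp add: eta_contract_eq)
    have "(\<Sum>k<r. householder r u i k * householder r u j k) = mat_app r (householder r u) (householder r u j) i"
      by (simp add: mat_app_def)
    also have "\<dots> = householder r u j i + 2 * u j / dot r u u * u i"
      by (simp add: mat_app_householder[OF that(1)] *)
    also have "\<dots> = (if i = j then 1 else 0)" by (simp add: householder_def)
    finally show ?thesis .
  qed
  moreover have "(\<Sum>k<r. householder r u k i * householder r u k j) =
      (\<Sum>k<r. householder r u i k * householder r u j k)" for i j
    by (intro sum.cong refl arg_cong2[where f = "(*)"] sym)
  ultimately show ?thesis unfolding orthogonal_mat_def by simp
qed

text \<open>Induction by Householder reflections: when the first \<open>n\<close> vectors are
  matched, the reflection along \<open>v' - w n\<close> carries the image \<open>v'\<close> of the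
  next vector to \<open>w n\<close>. It fixes the earlier \<open>w j\<close>, since equal inner
  products make them orthogonal to this difference.\<close>

lemma isometry_extension:
  fixes v w :: "nat \<Rightarrow> nat \<Rightarrow> real"
  assumes "\<forall>i<n. \<forall>j<n. dot r (v i) (v j) = dot r (w i) (w j)"
  shows "\<exists>a. orthogonal_mat r a \<and> (\<forall>j<n. \<forall>i<r. w j i = mat_app r a (v j) i)"
  using assms
proof (induction n)
  case 0
  then show ?case using orthogonal_mat_id by auto
next
  case (Suc n)
  then obtain a where a: "orthogonal_mat r a" "\<And>j i. j < n \<Longrightarrow> i < r \<Longrightarrow> w j i = mat_app r a (v j) i"
    by (metis less_SucI)
  define v' where "v' = mat_app r a (v n)"
  define u where "u k = v' k - w n k" for k
  have vv: "dot r v' v' = dot r (w n) (w n)" unfolding v'_def dot_mat_app[OF a(1)] using Suc.prems by simp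
  have dot_cong: "dot r x y = dot r x y'" if "\<And>i. i < r \<Longrightarrow> y i = y' i" for x y y'
    unfolding dot_def using that by (intro sum.cong) auto
  have vw: "dot r v' (w j) = dot r (w n) (w j)" if "j < n" for j
  proof -
    have "dot r v' (w j) = dot r v' (mat_app r a (v j))" using a(2)[OF that] by (rule dot_cong)
    then show ?thesis using Suc.prems that by (simp add: v'_def dot_mat_app[OF a(1)])
  qed
  have lin: "dot r u x = dot r v' x - dot r (w n) x" for x
    unfolding dot_def u_def sum_subtractf[symmetric] by (rule sum.cong) (auto simp: algebra_simps)
  show ?case
  proof (cases "dot r u u = 0")
    case True
    then have "\<forall>k<r. u k * u k = 0"
      unfolding dot_def using sum_nonneg_eq_0_iff[of "{..<r}" "\<lambda>k. u k * u k"] by simp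
    then have "w n i = mat_app r a (v n) i" if "i < r" for i using that by (simp add: u_def v'_def)
    then show ?thesis using a by (metis less_antisym)
  next
    case False
    let ?H = "householder r u"
    have uu: "dot r u u = 2 * dot r u v'"
      using lin[of u] lin[of v'] lin[of "w n"] vv
        dot_commute[of r v' u] dot_commute[of r "w n" u] dot_commute[of r "w n" v'] by linarith
    have "w n i = mat_app r ?H v' i" if "i < r" for i
      using False uu by (simp add: mat_app_householder[OF that] u_def)
    moreover have "w j i = mat_app r ?H (mat_app r a (v j)) i" if "i < r" "j < n" for i j
    proof -
      have "dot r u (mat_app r a (v j)) = dot r u (w j)" using a(2)[OF that(2)] by (intro dot_cong) simp
      also have "\<dots> = 0" using vw[OF that(2)] lin by simp
      finally show ?thesis by (simp add: mat_app_householder[OF that(1)] a(2)[OF that(2,1)])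
    qed
    ultimately have "\<forall>j<Suc n. \<forall>i<r. w j i = mat_app r (\<lambda>i k. \<Sum>l<r. ?H i l * a l k) (v j) i"
      unfolding mat_app_mult v'_def less_Suc_eq by blast
    then show ?thesis using orthogonal_mat_mult[OF orthogonal_householder[OF False] a(1)] by blast
  qed
qed

section \<open>Gram matrices and lengths of representations\<close>

lemma m22_sum_sum:
  assumes "finite I" "finite J"
  shows "m22 (\<Sum>i\<in>I. f i *\<^sub>R x i) (\<Sum>j\<in>J. g j *\<^sub>R y j) = (\<Sum>i\<in>I. \<Sum>j\<in>J. (f i * g j) *\<^sub>R m22 (x i) (y j))"
  using linear_sum[OF linear_m22_right, of _ "\<lambda>j. g j *\<^sub>R y j" J]
    linear_sum[OF linear_m22_right, of _ "\<lambda>i. f i *\<^sub>R x i" I]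
  by (simp add: m22_commute[of "\<Sum>i\<in>I. f i *\<^sub>R x i"] m22_simps)
     (simp add: m22_commute m22_simps scaleR_sum_right mult.commute sum.swap[of _ J I] )

lemma sum_squares_orthogonal:
  assumes "orthogonal_mat r a"
  shows "(\<Sum>i<r. m22 (\<Sum>k<r. a i k *\<^sub>R x k) (\<Sum>k<r. a i k *\<^sub>R x k)) = (\<Sum>k<r. m22 (x k) (x k))"
proof -
  have "(\<Sum>i<r. m22 (\<Sum>k<r. a i k *\<^sub>R x k) (\<Sum>k<r. a i k *\<^sub>R x k)) =
      (\<Sum>i<r. \<Sum>k<r. \<Sum>l<r. (a i k * a i l) *\<^sub>R m22 (x k) (x l))"
    by (simp add: m22_sum_sum)
  also have "\<dots> = (\<Sum>k<r. \<Sum>l<r. \<Sum>i<r. (a i k * a i l) *\<^sub>R m22 (x k) (x l))"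
    by (subst sum.swap, rule sum.cong[OF refl], subst sum.swap) simp
  also have "\<dots> = (\<Sum>k<r. \<Sum>l<r. if k = l then m22 (x k) (x l) else 0)"
    by (intro sum.cong refl) (use assms in \<open>simp add: scaleR_sum_left[symmetric] orthogonal_mat_def\<close>)
  also have "\<dots> = (\<Sum>k<r. m22 (x k) (x k))" by (intro sum.cong refl) simp
  finally show ?thesis .
qed

lemma sum_list_nth: "(\<Sum>x\<leftarrow>xs. f x) = (\<Sum>i<length xs. f (xs ! i))"
  by (simp add: sum_list_sum_nth atLeast0LessThan)

text \<open>The list may repeat an entry, in which case the relation comes from the two equal
  positions and not from the underlying set.\<close>

lemma dependent_list:
  fixes xs :: "(real ^ quad_mon) list"
  assumes "subspace U" "dim U < length xs" "set xs \<subseteq> U"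
  obtains d where "(\<Sum>i<length xs. d i *\<^sub>R xs ! i) = 0" "\<exists>i<length xs. d i \<noteq> 0"
proof (cases "distinct xs")
  case True
  have "dependent (set xs)"
  proof (rule ccontr)
    assume "\<not> dependent (set xs)"
    then have "card (set xs) \<le> dim U" using independent_card_le_dim[OF assms(3)] by simp
    then show False using distinct_card[OF True] assms(2) by simp
  qed
  then obtain u v where u: "v \<in> set xs" "u v \<noteq> 0" "(\<Sum>v\<in>set xs. u v *\<^sub>R v) = 0"
    unfolding dependent_finite[OF finite_set] by blast
  then obtain i where i: "i < length xs" "xs ! i = v" by (metis in_set_conv_nth)
  have "(\<Sum>i<length xs. u (xs ! i) *\<^sub>R xs ! i) = (\<Sum>x\<leftarrow>xs. u x *\<^sub>R x)" by (simp add: sum_list_nth)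
  also have "\<dots> = (\<Sum>v\<in>set xs. u v *\<^sub>R v)" using True by (simp add: sum_list_distinct_conv_sum_set)
  finally show ?thesis using that[of "\<lambda>i. u (xs ! i)"] u i by auto
next
  case False
  then obtain i j where ij: "i < length xs" "j < length xs" "i \<noteq> j" "xs ! i = xs ! j" by (auto simp: distinct_conv_nth)
  define d :: "nat \<Rightarrow> real" where "d k = (if k = i then 1 else if k = j then - 1 else 0)" for k
  have "(\<Sum>k<length xs. d k *\<^sub>R xs ! k) = (\<Sum>k\<in>{i, j}. d k *\<^sub>R xs ! k)"
    by (rule sum.mono_neutral_right) (use ij in \<open>auto simp: d_def\<close>)
  also have "\<dots> = 0" using ij by (simp add: d_def)
  finally have "(\<Sum>k<length xs. d k *\<^sub>R xs ! k) = 0" .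
  moreover have "d i \<noteq> 0" by (simp add: d_def)
  ultimately show ?thesis using that[of d] ij(1) by blast
qed

text \<open>An orthogonal change of summands preserves the sum of squares; it is chosen so that one
  new summand is the given vanishing linear combination.\<close>

lemma shorten_representation:
  assumes U: "subspace U" "dim U < length xs" "set xs \<subseteq> U"
  obtains ys where "length ys = length xs - 1" "set ys \<subseteq> U" "(\<Sum>x\<leftarrow>ys. m22 x x) = (\<Sum>x\<leftarrow>xs. m22 x x)"
proof -
  define n where "n = length xs - 1"
  have len: "length xs = Suc n" using U(2) by (simp add: n_def)
  obtain d where d: "(\<Sum>i<length xs. d i *\<^sub>R xs ! i) = 0" "\<exists>i<length xs. d i \<noteq> 0"
    using dependent_list[OF U] by blast
  let ?r = "Suc n"
  have pos: "dot ?r d d > 0"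
  proof -
    obtain i where "i < ?r" "d i \<noteq> 0" using d(2) len by auto
    then have "0 < d i * d i" by (metis not_real_square_gt_zero)
    then show ?thesis unfolding dot_def using \<open>i < ?r\<close> by (intro sum_pos2[of _ i]) auto
  qed
  define w where "w i = d i / sqrt (dot ?r d d)" for i
  have ww: "dot ?r w w = 1"
  proof -
    have "dot ?r w w = (\<Sum>k<?r. d k * d k / dot ?r d d)"
      unfolding dot_def[of _ w w] w_def using pos by (intro sum.cong refl) (simp add: real_sqrt_mult_self)
    also have "\<dots> = dot ?r d d / dot ?r d d" unfolding sum_divide_distrib[symmetric] dot_def ..
    finally show ?thesis using pos by simp
  qed
  \<comment> \<open>A matrix carrying the last unit vector to the normalised coefficients
    \<open>w\<close> has \<open>w\<close> as its last column, so its transpose makes the last new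
    summand zero.\<close>
  define e where "e i = (if i = n then 1 else 0 :: real)" for i
  have "dot ?r e e = 1" by (simp add: dot_def e_def if_distrib sum.delta cong: if_cong)
  then have "\<forall>i<Suc 0. \<forall>j<Suc 0. dot ?r ((\<lambda>_. e) i) ((\<lambda>_. e) j) = dot ?r ((\<lambda>_. w) i) ((\<lambda>_. w) j)"
    using ww by simp
  from isometry_extension[OF this] obtain a where a: "orthogonal_mat ?r a" "\<forall>i<?r. w i = mat_app ?r a e i" by auto
  have an: "a i n = w i" if "i < ?r" for i
    using a(2) that by (simp add: mat_app_def e_def if_distrib sum.delta cong: if_cong)
  define y where "y k = (\<Sum>i<?r. a i k *\<^sub>R xs ! i)" for k
  have "y n = (\<Sum>i<?r. (1 / sqrt (dot ?r d d)) *\<^sub>R (d i *\<^sub>R xs ! i))"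
    unfolding y_def by (intro sum.cong refl) (simp add: an w_def)
  also have "\<dots> = 0" unfolding scaleR_sum_right[symmetric] using d(1) len by simp
  finally have yn: "y n = 0" .
  have "(\<Sum>k<?r. m22 (y k) (y k)) = (\<Sum>k<?r. m22 (xs ! k) (xs ! k))"
    unfolding y_def using sum_squares_orthogonal[OF orthogonal_mat_transpose[OF a(1)]] .
  then have "(\<Sum>k<n. m22 (y k) (y k)) = (\<Sum>x\<leftarrow>xs. m22 x x)"
    using yn by (simp add: sum_list_nth len m22_simps)
  moreover have "(\<Sum>x\<leftarrow>map y [0..<n]. m22 x x) = (\<Sum>k<n. m22 (y k) (y k))"
    by (simp add: interv_sum_list_conv_sum_set_nat atLeast0LessThan comp_def)
  moreover have "y k \<in> U" for k
    unfolding y_def using U(3) len by (intro subspace_sum[OF U(1)] subspace_scale[OF U(1)]) (auto intro: nth_mem)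
  ultimately show ?thesis using that[of "map y [0..<n]"] len by auto
qed

lemma representation_of_length_dim:
  assumes "subspace U" "dim U \<le> length xs" "set xs \<subseteq> U"
  obtains ys where "length ys = dim U" "(\<Sum>x\<leftarrow>ys. m22 x x) = (\<Sum>x\<leftarrow>xs. m22 x x)"
proof -
  have "\<exists>ys. length ys = dim U \<and> (\<Sum>x\<leftarrow>ys. m22 x x) = (\<Sum>x\<leftarrow>xs. m22 x x)"
    using assms
  proof (induction "length xs" arbitrary: xs rule: less_induct)
    case less
    show ?case
    proof (cases "length xs = dim U")
      case False
      then have "dim U < length xs" using less.prems(2) by simp
      then obtain ys where ys: "length ys = length xs - 1" "set ys \<subseteq> U" "(\<Sum>x\<leftarrow>ys. m22 x x) = (\<Sum>x\<leftarrow>xs. m22 x x)"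
        using shorten_representation[OF less.prems(1) _ less.prems(3)] by blast
      then show ?thesis using less.hyps[of ys] less.prems(1) \<open>dim U < length xs\<close> by auto
    qed blast
  qed
  then show ?thesis using that by blast
qed

text \<open>The ten products of the four basis quadrics are among the 34 independent ones; hence a
  Gram matrix in this basis is unique.\<close>

lemma symmetric_products_zero:
  assumes b: "adapted_basis b 4 U" "ann U = span {v}"
    and D: "\<And>j k. D j k = D k j" and z: "(\<Sum>j<4. \<Sum>k<4. D j k *\<^sub>R m22 (b j) (b k)) = 0"
    and jk: "j < 4" "k < (4 :: nat)"
  shows "D j k = 0"
proof -
  \<comment> \<open>Each unordered pair occurs once in \<open>prod_index 4\<close>, so entries off
    the diagonal are doubled; products with a quadric outside \<open>U\<close> get coefficient
    0.\<close>
  define c where "c j k = (if 4 \<le> k then 0 else if j = k then D j k else 2 * D j k)" for j k :: nat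
  let ?T = "{(0,0), (0,1), (0,2), (0,3), (1,1), (1,2), (1,3), (2,2), (2,3), (3, 3 :: nat)} :: (nat \<times> nat) set"
  have T1: "?T \<subseteq> prod_index 4" by (auto simp: prod_index_def)
  have T2: "c i j *\<^sub>R m22 (b i) (b j) = 0" if "(i, j) \<in> prod_index 4 - ?T" for i j
  proof -
    have "4 \<le> j"
    proof (rule ccontr)
      assume "\<not> 4 \<le> j"
      then have j: "j = 0 \<or> j = 1 \<or> j = 2 \<or> j = 3" by linarith
      have le: "i \<le> j" and nT: "(i, j) \<notin> ?T" using that by (simp_all add: prod_index_def)
      then have "i = 0 \<or> i = 1 \<or> i = 2 \<or> i = 3" using j by linarith
      with j show False using le nT by (elim disjE) simp_all
    qed
    then show ?thesis by (simp add: c_def)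
  qed
  have "(\<Sum>(i, j)\<in>prod_index 4. c i j *\<^sub>R m22 (b i) (b j)) = (\<Sum>(i, j)\<in>?T. c i j *\<^sub>R m22 (b i) (b j))"
  proof (rule sum.mono_neutral_right[OF finite_prod_index T1], rule ballI)
    fix x assume x: "x \<in> prod_index 4 - ?T"
    obtain i j where xij: "x = (i, j)" by (cases x)
    show "(case x of (i, j) \<Rightarrow> c i j *\<^sub>R m22 (b i) (b j)) = 0"
      unfolding xij case_prod_conv using x unfolding xij by (rule T2)
  qed
  also have "\<dots> = (\<Sum>j<4. \<Sum>k<4. D j k *\<^sub>R m22 (b j) (b k))"
  proof -
    have two: "(2 * x) *\<^sub>R m = x *\<^sub>R m + x *\<^sub>R m" for x and m :: "real ^ quartic_mon"
      by (simp add: scaleR_add_left[symmetric])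
    have sw: "D 1 0 = D 0 1" "D 2 0 = D 0 2" "D 3 0 = D 0 3" "D 2 1 = D 1 2" "D 3 1 = D 1 3" "D 3 2 = D 2 3"
        by (rule D)+
    have sw': "m22 (b 1) (b 0) = m22 (b 0) (b 1)" "m22 (b 2) (b 0) = m22 (b 0) (b 2)" "m22 (b 3) (b 0) = m22 (b 0) (b 3)"
        "m22 (b 2) (b 1) = m22 (b 1) (b 2)" "m22 (b 3) (b 1) = m22 (b 1) (b 3)" "m22 (b 3) (b 2) = m22 (b 2) (b 3)"
        by (rule m22_commute)+
    have s4: "(\<Sum>i<4. f i) = f 0 + f 1 + f 2 + f 3" for f :: "nat \<Rightarrow> real ^ quartic_mon"
      by (simp add: eval_nat_numeral)
    show ?thesis unfolding s4 sw sw' by (simp add: c_def two del: scaleR_left_distrib One_nat_def)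
  qed
  finally have s: "(\<Sum>(i, j)\<in>prod_index 4. c i j *\<^sub>R m22 (b i) (b j)) = 0" using z by simp
  have "D i l = 0" if "i \<le> l" "l < 4" for i l
    using products_independent[OF b s, of i l] that by (auto simp: prod_index_def c_def split: if_splits)
  then show ?thesis using jk D by (metis nat_le_linear)
qed

lemma adapted_basis_coords:
  assumes b: "adapted_basis b k U" and x: "x \<in> U" and k: "k \<le> 10"
  obtains c where "x = (\<Sum>j<k. c j *\<^sub>R b j)"
proof -
  have "x \<in> span (b ` {..<k})" using assms by (simp add: adapted_basis_def)
  then obtain u where u: "x = (\<Sum>v\<in>b ` {..<k}. u v *\<^sub>R v)" by (auto simp: span_finite)
  have "inj_on b {..<k}" using b k by (auto simp: adapted_basis_def intro: inj_on_subset)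
  then have "x = (\<Sum>j<k. u (b j) *\<^sub>R b j)" unfolding u by (simp add: sum.reindex)
  then show ?thesis by (rule that)
qed

text \<open>Uniqueness of the Gram matrix says that the columns of the two coefficient matrices have
  equal inner products; \<open>isometry_extension\<close> then relates them by an orthogonal
  matrix.\<close>

lemma equal_sums_orthogonal:
  assumes b: "adapted_basis b 4 U" and v: "ann U = span {v}"
    and x: "\<And>i. i < r \<Longrightarrow> x i \<in> U" and y: "\<And>i. i < r \<Longrightarrow> y i \<in> U"
    and eq: "(\<Sum>i<r. m22 (x i) (x i)) = (\<Sum>i<r. m22 (y i) (y i))"
  obtains a where "orthogonal_mat r a" "\<And>i. i < r \<Longrightarrow> y i = (\<Sum>k<r. a i k *\<^sub>R x k)"
proof -
  have "\<exists>c. \<forall>i<r. z i = (\<Sum>j<4. c i j *\<^sub>R b j)" if "\<And>i. i < r \<Longrightarrow> z i \<in> U" for z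
  proof -
    have "\<forall>i. \<exists>c. i < r \<longrightarrow> z i = (\<Sum>j<4. c j *\<^sub>R b j)"
      using adapted_basis_coords[OF b] that by (metis numeral_le_iff semiring_norm(68,69,71,72))
    then show ?thesis by (rule choice[THEN exE]) blast
  qed
  from this[of x, OF x] this[of y, OF y] obtain \<alpha> \<beta> where \<alpha>: "\<And>i. i < r \<Longrightarrow> x i = (\<Sum>j<4. \<alpha> i j *\<^sub>R b j)"
      and \<beta>: "\<And>i. i < r \<Longrightarrow> y i = (\<Sum>j<4. \<beta> i j *\<^sub>R b j)" by blast
  have gram: "(\<Sum>i<r. m22 (z i) (z i)) = (\<Sum>j<4. \<Sum>k<4. dot r (\<lambda>i. c i j) (\<lambda>i. c i k) *\<^sub>R m22 (b j) (b k))"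
    if z: "\<And>i. i < r \<Longrightarrow> z i = (\<Sum>j<4. c i j *\<^sub>R b j)" for z c
  proof -
    have "(\<Sum>i<r. m22 (z i) (z i)) = (\<Sum>i<r. \<Sum>j<4. \<Sum>k<4. (c i j * c i k) *\<^sub>R m22 (b j) (b k))"
      by (intro sum.cong refl) (simp add: z m22_sum_sum)
    also have "\<dots> = (\<Sum>j<4. \<Sum>k<4. \<Sum>i<r. (c i j * c i k) *\<^sub>R m22 (b j) (b k))"
      by (subst sum.swap, rule sum.cong[OF refl], subst sum.swap) simp
    finally show ?thesis by (simp add: dot_def scaleR_sum_left)
  qed
  define D where "D j k = dot r (\<lambda>i. \<alpha> i j) (\<lambda>i. \<alpha> i k) - dot r (\<lambda>i. \<beta> i j) (\<lambda>i. \<beta> i k)" for j k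
  have "(\<Sum>j<4. \<Sum>k<4. D j k *\<^sub>R m22 (b j) (b k)) = 0"
    unfolding D_def using gram[OF \<alpha>] gram[OF \<beta>] eq by (simp add: scaleR_diff_left sum_subtractf)
  moreover have "D j k = D k j" for j k by (simp add: D_def dot_commute)
  ultimately have "D j k = 0" if "j < 4" "k < 4" for j k using symmetric_products_zero[OF b v] that by blast
  then have "\<forall>j<4. \<forall>k<4. dot r (\<lambda>i. \<alpha> i j) (\<lambda>i. \<alpha> i k) = dot r (\<lambda>i. \<beta> i j) (\<lambda>i. \<beta> i k)"
    by (simp add: D_def)
  from isometry_extension[of 4 r "\<lambda>j i. \<alpha> i j" "\<lambda>j i. \<beta> i j", OF this]
  obtain a where a: "orthogonal_mat r a" "\<And>j i. j < 4 \<Longrightarrow> i < r \<Longrightarrow> \<beta> i j = mat_app r a (\<lambda>i. \<alpha> i j) i" by blast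
  have "y i = (\<Sum>k<r. a i k *\<^sub>R x k)" if i: "i < r" for i
  proof -
    have "y i = (\<Sum>j<4. (\<Sum>k<r. a i k * \<alpha> k j) *\<^sub>R b j)"
      unfolding \<beta>[OF i] by (intro sum.cong refl) (simp add: a(2) i mat_app_def)
    also have "\<dots> = (\<Sum>k<r. \<Sum>j<4. (a i k * \<alpha> k j) *\<^sub>R b j)"
      by (simp add: scaleR_sum_left) (rule sum.swap)
    also have "\<dots> = (\<Sum>k<r. a i k *\<^sub>R x k)"
      by (intro sum.cong refl) (simp add: \<alpha> scaleR_sum_right)
    finally show ?thesis .
  qed
  then show ?thesis using that a(1) by blast
qed

lemma boundary_orthogonally_equivalent:
  assumes f: "f \<in> boundary_Sigma4" "strictly_positive f" and ps: "sos_rep f ps" and qs: "sos_rep f qs"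
  shows "orthogonally_equivalent ps qs"
proof -
  obtain v where v: "dim (ker v) = 4" "ann (ker v) = span {v}"
      "\<And>xs. vec4 f = (\<Sum>x\<leftarrow>xs. m22 x x) \<Longrightarrow> span (set xs) = ker v"
    using boundary_functional[OF f] by metis
  obtain b where b: "adapted_basis b 4 (ker v)" using adapted_basis_exists[OF subspace_ker v(1)] by blast
  define r where "r = max (length ps) (length qs)"
  let ?c = "coords quad_exps"
  have c0: "?c 0 = 0" by (rule linear_0[OF linear_coords])
  have pad: "length (pad r ts) = r" "(\<Sum>i<r. m22 (?c (pad r ts ! i)) (?c (pad r ts ! i))) = vec4 f"
      "\<And>i. i < r \<Longrightarrow> ?c (pad r ts ! i) \<in> ker v" "\<And>i. i < r \<Longrightarrow> qf (?c (pad r ts ! i)) = pad r ts ! i"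
    if ts: "sos_rep f ts" "length ts \<le> r" for ts
  proof -
    show len: "length (pad r ts) = r" using ts(2) by (simp add: pad_def)
    have "(\<Sum>i<r. m22 (?c (pad r ts ! i)) (?c (pad r ts ! i))) = (\<Sum>p\<leftarrow>pad r ts. m22 (?c p) (?c p))"
      unfolding sum_list_nth len ..
    also have "\<dots> = (\<Sum>x\<leftarrow>map ?c ts. m22 x x)" by (simp add: pad_def c0 m22_simps sum_list_replicate comp_def)
    also have "\<dots> = vec4 f" using sos_rep_vec(2)[OF ts(1)] by simp
    finally show "(\<Sum>i<r. m22 (?c (pad r ts ! i)) (?c (pad r ts ! i))) = vec4 f" .
    have sp: "span (set (map ?c ts)) = ker v" by (rule v(3)[OF sos_rep_vec(2)[OF ts(1)]])
    fix i assume "i < r"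
    then have mem: "pad r ts ! i \<in> set (pad r ts)" using len by simp
    then have "pad r ts ! i \<in> set ts \<or> pad r ts ! i = 0" by (auto simp: pad_def)
    moreover have "set ts \<subseteq> forms 2" using ts(1) by (simp add: sos_rep_def)
    ultimately show "?c (pad r ts ! i) \<in> ker v" "qf (?c (pad r ts ! i)) = pad r ts ! i"
      using sp c0 subspace_0[OF subspace_ker] linear_0[OF linear_form_of] by (auto simp: i2.form_of_coords intro: span_base)
  qed
  have lr: "length ps \<le> r" "length qs \<le> r" by (simp_all add: r_def)
  have eqs: "(\<Sum>i<r. m22 (?c (pad r ps ! i)) (?c (pad r ps ! i))) = (\<Sum>i<r. m22 (?c (pad r qs ! i)) (?c (pad r qs ! i)))"
    using pad(2)[OF ps lr(1)] pad(2)[OF qs lr(2)] by simp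
  obtain a where a: "orthogonal_mat r a"
      "\<And>i. i < r \<Longrightarrow> ?c (pad r qs ! i) = (\<Sum>k<r. a i k *\<^sub>R ?c (pad r ps ! k))"
    using equal_sums_orthogonal[of b "ker v" v r "\<lambda>i. ?c (pad r ps ! i)" "\<lambda>i. ?c (pad r qs ! i)",
        OF b v(2) pad(3)[OF ps lr(1)] pad(3)[OF qs lr(2)] eqs] by blast
  have "pad r qs ! i = (\<Sum>k<r. a i k *\<^sub>R pad r ps ! k)" if "i < r" for i
  proof -
    have "pad r qs ! i = qf (\<Sum>k<r. a i k *\<^sub>R ?c (pad r ps ! k))"
      using pad(4)[OF qs lr(2) that] a(2)[OF that] by simp
    also have "\<dots> = (\<Sum>k<r. a i k *\<^sub>R pad r ps ! k)"
      by (simp add: linear_sum[OF linear_form_of] linear_cmul[OF linear_form_of] pad(4)[OF ps lr(1)])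
    finally show ?thesis .
  qed
  then show ?thesis unfolding orthogonally_equivalent_def Let_def r_def[symmetric] using a(1) by blast
qed

lemma boundary_four_squares:
  assumes f: "f \<in> boundary_Sigma4" "strictly_positive f"
  shows "\<exists>ps. length ps = 4 \<and> sos_rep f ps"
proof -
  obtain v where v: "dim (ker v) = 4" "\<And>xs. vec4 f = (\<Sum>x\<leftarrow>xs. m22 x x) \<Longrightarrow> span (set xs) = ker v"
    using boundary_functional[OF f] by metis
  have fS: "f \<in> Sigma4" using f(1) by (simp add: boundary_iff)
  then have "vec4 f \<in> sq_cone" using vec4_Sigma4 by blast
  then obtain xs where xs: "vec4 f = (\<Sum>x\<leftarrow>xs. m22 x x)" by (auto simp: sq_cone_def)
  have sp: "span (set xs) = ker v" by (rule v(2)[OF xs])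
  then have "dim (ker v) \<le> card (set xs)" by (intro dim_le_card) auto
  also have "\<dots> \<le> length xs" by (rule card_length)
  finally have "dim (ker v) \<le> length xs" .
  moreover have "set xs \<subseteq> ker v" using sp span_superset by blast
  ultimately obtain ys where ys: "length ys = dim (ker v)" "(\<Sum>x\<leftarrow>ys. m22 x x) = (\<Sum>x\<leftarrow>xs. m22 x x)"
    using representation_of_length_dim[OF subspace_ker] by blast
  have "pf (vec4 f) = f" using fS Sigma4_subset by (intro i4.form_of_coords) auto
  then have "sos_rep f (map qf ys)" using sos_rep_map_qf[of ys] ys(2) xs by simp
  then show ?thesis using ys(1) v(1) by (intro exI[of _ "map qf ys"]) simp
qed

section \<open>Homogeneous components and ideals\<close>

lemma module_mult: "module ((*) :: 'a::comm_ring_1 \<Rightarrow> 'a \<Rightarrow> 'a)"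
  by unfold_locales (auto simp: algebra_simps)

lemma ideal_base: "p \<in> S \<Longrightarrow> p \<in> ideal_generated S"
  by (rule module.span_base[OF module_mult])

lemma ideal_add: "p \<in> ideal_generated S \<Longrightarrow> q \<in> ideal_generated S \<Longrightarrow> p + q \<in> ideal_generated S"
  by (rule module.span_add[OF module_mult])

lemma ideal_mult: "p \<in> ideal_generated S \<Longrightarrow> g * p \<in> ideal_generated S"
  by (rule module.span_scale[OF module_mult])

lemma ideal_zero: "0 \<in> ideal_generated S"
  by (rule module.span_zero[OF module_mult])

lemma ideal_sum: "(\<And>i. i \<in> A \<Longrightarrow> f i \<in> ideal_generated S) \<Longrightarrow> sum f A \<in> ideal_generated S"
  by (rule module.span_sum[OF module_mult])

lemma ideal_minimal:
  assumes "S \<subseteq> T" "0 \<in> T" "\<And>p q. p \<in> T \<Longrightarrow> q \<in> T \<Longrightarrow> p + q \<in> T" "\<And>g p. p \<in> T \<Longrightarrow> g * p \<in> T"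
  shows "ideal_generated S \<subseteq> T"
  by (rule module.span_minimal[OF module_mult assms(1)])
     (use assms in \<open>auto simp: module.subspace_def[OF module_mult]\<close>)

lemma scaleR_eq_mult: "c *\<^sub>R p = Poly_Mapping.single 0 c * p"
  for p :: "('v, real) mpoly"
  unfolding mult_map_scale_conv_mult[symmetric] scaleR_poly_mapping_def
  by (simp add: scaleR_conv_of_real[abs_def])

lemma ideal_scaleR: "p \<in> ideal_generated S \<Longrightarrow> c *\<^sub>R p \<in> ideal_generated S"
  for p :: "('v, real) mpoly"
  unfolding scaleR_eq_mult by (rule ideal_mult)

lemma subspace_ideal: "subspace (ideal_generated S :: ('v, real) mpoly set)"
  unfolding subspace_def using ideal_zero ideal_add ideal_scaleR by blast

definition hom_comp :: "nat \<Rightarrow> ('v::finite, 'a::comm_monoid_add) mpoly \<Rightarrow> ('v, 'a) mpoly" where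
  "hom_comp d p = (\<Sum>m\<in>{m. mon_degree m = d}. Poly_Mapping.single m (Poly_Mapping.lookup p m))"

lemma lookup_hom_comp: "Poly_Mapping.lookup (hom_comp d p) m = (if mon_degree m = d then Poly_Mapping.lookup p m else 0)"
  by (auto simp: hom_comp_def lookup_sum lookup_single when_def sum.delta finite_mon_degree)

lemma hom_comp_forms [simp]: "hom_comp d p \<in> forms d"
  by (simp add: forms_iff lookup_hom_comp)

lemma hom_comp_of_form: "p \<in> forms e \<Longrightarrow> hom_comp d p = (if d = e then p else 0)"
  by (auto intro!: poly_mapping_eqI simp: lookup_hom_comp forms_iff)

lemma hom_comp_add: "hom_comp d (p + q) = hom_comp d p + hom_comp d q"
  by (rule poly_mapping_eqI) (simp add: lookup_hom_comp lookup_add)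

lemma hom_comp_0 [simp]: "hom_comp d 0 = 0"
  by (rule poly_mapping_eqI) (simp add: lookup_hom_comp)

lemma hom_comp_mult: "hom_comp d (g * p) = (\<Sum>e\<le>d. hom_comp e g * hom_comp (d - e) p)"
  for g p :: "('v::finite, 'a::comm_semiring_1) mpoly"
proof (induction g rule: poly_mapping_single_add_induct)
  case (single m c)
  show ?case
  proof (induction p rule: poly_mapping_single_add_induct)
    case (single n k)
    have 1: "hom_comp e (Poly_Mapping.single m c) = (if e = mon_degree m then Poly_Mapping.single m c else 0)" for e
      by (rule hom_comp_of_form) simp
    have 2: "hom_comp e (Poly_Mapping.single n k) = (if e = mon_degree n then Poly_Mapping.single n k else 0)" for e
      by (rule hom_comp_of_form) simp
    have 3: "hom_comp d (Poly_Mapping.single (m + n) (c * k)) = (if d = mon_degree m + mon_degree n then Poly_Mapping.single (m + n) (c * k) else 0)"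
      by (rule hom_comp_of_form) (simp add: mon_degree_add)
    have "(\<Sum>e\<le>d. hom_comp e (Poly_Mapping.single m c) * hom_comp (d - e) (Poly_Mapping.single n k)) =
        (\<Sum>e\<le>d. if e = mon_degree m then Poly_Mapping.single m c * hom_comp (d - e) (Poly_Mapping.single n k) else 0)"
      by (rule sum.cong) (auto simp: 1)
    also have "\<dots> = (if mon_degree m \<le> d then Poly_Mapping.single m c * hom_comp (d - mon_degree m) (Poly_Mapping.single n k) else 0)"
      by (simp add: sum.delta)
    finally show ?case unfolding mult_single 3 2 by (auto simp: mult_single)
  qed (simp_all add: distrib_left hom_comp_add sum.distrib)
qed (simp_all add: distrib_right hom_comp_add sum.distrib)

lemma hom_comp_mult_form:
  fixes g p :: "('v::finite, 'a::comm_semiring_1) mpoly"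
  assumes "g \<in> forms e" shows "hom_comp (d + e) (g * p) = g * hom_comp d p"
proof -
  have "hom_comp (d + e) (g * p) = (\<Sum>k\<le>d + e. if k = e then g * hom_comp (d + e - k) p else 0)"
    unfolding hom_comp_mult by (rule sum.cong) (auto simp: hom_comp_of_form[OF assms])
  then show ?thesis by (simp add: sum.delta)
qed

lemma sum_hom_comp: obtains N where "p = (\<Sum>d\<le>N. hom_comp d p)"
proof -
  define N where "N = Max (insert 0 (mon_degree ` Poly_Mapping.keys p))"
  have N: "mon_degree m \<le> N" if "Poly_Mapping.lookup p m \<noteq> 0" for m
    unfolding N_def using that by (intro Max_ge) (auto simp: in_keys_iff)
  have "p = (\<Sum>d\<le>N. hom_comp d p)"
    by (rule poly_mapping_eqI) (use N in \<open>auto simp: lookup_sum lookup_hom_comp sum.delta\<close>)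
  then show ?thesis by (rule that)
qed

section \<open>Syzygies of the kernel and the Gorenstein property\<close>

typedef cubic_mon = "{m :: 4 \<Rightarrow>\<^sub>0 nat. mon_degree m = 3}"
  morphisms cubic_exps cubic_mon_of
  by (rule exI[of _ "Poly_Mapping.single 1 3"]) simp

instance cubic_mon :: finite
proof
  have "UNIV = cubic_mon_of ` {m. mon_degree m = 3}"
    using type_definition.Abs_image[OF type_definition_cubic_mon] by simp
  then show "finite (UNIV :: cubic_mon set)"
    by (metis finite_imageI finite_mon_degree)
qed

interpretation i3: degree_index cubic_exps 3
  by unfold_locales
    (auto simp: inj_def cubic_exps_inject type_definition.Rep_range[OF type_definition_cubic_mon])

lemma CARD_cubic_mon: "CARD(cubic_mon) = 20"
  using i3.card_UNIV card_mon_degree_3 by simp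

text \<open>Expanding every \<open>y i\<close> in the basis turns the syzygy into a relation among
  the 34 independent products, in which coordinates outside \<open>U\<close> occur only once and so
  vanish.\<close>

lemma syzygy_in_kernel:
  assumes b: "adapted_basis b 4 U" "ann U = span {v}"
    and z: "(\<Sum>i<4. m22 (b i) (y i)) = 0" and i: "i < 4"
  shows "y i \<in> U"
proof -
  have b': "adapted_basis b 10 UNIV" using b(1) by (simp add: adapted_basis_def)
  have "\<forall>i. \<exists>g. y i = (\<Sum>j<10. g j *\<^sub>R b j)" using adapted_basis_coords[OF b', of "y _"] by blast
  then obtain g where "\<forall>i. y i = (\<Sum>j<10. g i j *\<^sub>R b j)" by (rule choice[THEN exE])
  then have g: "y i = (\<Sum>j<10. g i j *\<^sub>R b j)" for i by simp
  \<comment> \<open>A product of two of the first four quadrics arises from two positions, whose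
    coefficients are collected.\<close>
  define c where "c i j = (if 4 \<le> j then g i j else if i = j then g i i else g i j + g j i)" for i j :: nat
  let ?f = "\<lambda>(i, j). c i j *\<^sub>R m22 (b i) (b j)"
  have split: "{..<10} = {..<4} \<union> {4..<10 :: nat}" by auto
  have tri: "{i..<10} = {i..<4} \<union> {4..<10 :: nat}" if "i < 4" for i using that by auto
  have "(\<Sum>(i, j)\<in>prod_index 4. c i j *\<^sub>R m22 (b i) (b j)) = (\<Sum>i<4. \<Sum>j\<in>{i..<10}. c i j *\<^sub>R m22 (b i) (b j))"
    unfolding prod_index_def by (simp add: sum.Sigma)
  also have "\<dots> = (\<Sum>i<4. (\<Sum>j\<in>{i..<4}. c i j *\<^sub>R m22 (b i) (b j)) + (\<Sum>j\<in>{4..<10}. c i j *\<^sub>R m22 (b i) (b j)))"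
    by (rule sum.cong[OF refl]) (simp add: tri sum.union_disjoint)
  also have "\<dots> = (\<Sum>i<4. \<Sum>j\<in>{i..<4}. c i j *\<^sub>R m22 (b i) (b j)) + (\<Sum>i<4. \<Sum>j\<in>{4..<10}. g i j *\<^sub>R m22 (b i) (b j))"
    by (simp add: sum.distrib c_def)
  also have "(\<Sum>i<4. \<Sum>j\<in>{i..<4}. c i j *\<^sub>R m22 (b i) (b j)) = (\<Sum>i<4. \<Sum>j<4. g i j *\<^sub>R m22 (b i) (b j))"
  proof -
    have sw: "m22 (b 1) (b 0) = m22 (b 0) (b 1)" "m22 (b 2) (b 0) = m22 (b 0) (b 2)" "m22 (b 3) (b 0) = m22 (b 0) (b 3)"
        "m22 (b 2) (b 1) = m22 (b 1) (b 2)" "m22 (b 3) (b 1) = m22 (b 1) (b 3)" "m22 (b 3) (b 2) = m22 (b 2) (b 3)"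
        by (rule m22_commute)+
    have s4: "(\<Sum>i<4. f i) = f 0 + f 1 + f 2 + f 3" for f :: "nat \<Rightarrow> real ^ quartic_mon"
      by (simp add: eval_nat_numeral)
    have st: "{0..<4} = {0, 1, 2, 3 :: nat}" "{1..<4} = {1, 2, 3 :: nat}" "{2..<4} = {2, 3 :: nat}" "{3..<4} = {3 :: nat}" by auto
    show ?thesis unfolding s4 sw st by (simp add: c_def algebra_simps del: One_nat_def)
  qed
  also have "(\<Sum>i<4. \<Sum>j<4. g i j *\<^sub>R m22 (b i) (b j)) + (\<Sum>i<4. \<Sum>j\<in>{4..<10}. g i j *\<^sub>R m22 (b i) (b j))
      = (\<Sum>i<4. \<Sum>j<10. g i j *\<^sub>R m22 (b i) (b j))"
    unfolding sum.distrib[symmetric] split by (rule sum.cong[OF refl], subst sum.union_disjoint) auto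
  also have "\<dots> = (\<Sum>i<4. m22 (b i) (y i))"
    using m22_sum_sum[of "{0 :: nat}" "{..<10}" "\<lambda>_. 1" "\<lambda>_. b _" "g _" b] by (simp add: g)
  finally have s: "(\<Sum>(i, j)\<in>prod_index 4. c i j *\<^sub>R m22 (b i) (b j)) = 0" using z by simp
  have "g i j = 0" if "4 \<le> j" "j < 10" for j
    using products_independent[OF b s, of i j] that i by (simp add: prod_index_def c_def)
  then have "y i = (\<Sum>j<4. g i j *\<^sub>R b j)"
    unfolding g split by (subst sum.union_disjoint) auto
  also have "\<dots> \<in> span (b ` {..<4})" by (intro span_sum span_scale span_base) auto
  finally show ?thesis using b(1) by (simp add: adapted_basis_def)
qed

lemma lf_expansion: "lf m = (\<Sum>i\<in>UNIV. m $ i *\<^sub>R lf (axis i 1))"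
  unfolding lf_axis form_of_def[of lin_exps m]
  by (intro sum.cong refl poly_mapping_eqI) (auto simp: lookup_single when_def)

text \<open>If \<open>m\<close> were nonzero, the multiples of \<open>m\<close> would fill the
  kernel, which would then vanish at any point orthogonal to \<open>m\<close>.\<close>

lemma Zk_trivial:
  assumes "dim (ker v) = 4" "zero_free (ker v)" "m \<in> Zk v" shows "m = 0"
proof (rule ccontr)
  assume m: "m \<noteq> 0"
  have "range (m11 m) \<subseteq> ker v" using assms(3) by (auto simp: Zk_def)
  then have "range (m11 m) = ker v"
    using assms(1) dim_range_m11[OF m] subspace_ker linear_subspace_image[OF linear_m11_right subspace_UNIV]
    by (intro subspace_dim_equal) auto
  moreover have "dim {m} < DIM(real ^ 4)" by simp
  then obtain z where z: "z \<noteq> 0" "\<And>y. y \<in> span {m} \<Longrightarrow> orthogonal z y"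
    using orthogonal_to_subspace_exists by blast
  moreover have "m \<bullet> z = 0" using z(2)[of m] by (simp add: orthogonal_def span_base inner_commute)
  ultimately show False using assms(2) by (force simp: zero_free_def)
qed

text \<open>\<open>S\<close> is any spanning set of the kernel, so that the ideal can be generated
  by the roots of a given representation.\<close>

locale kernel_ideal =
  fixes v :: "real ^ quartic_mon" and S :: "(real ^ quad_mon) set"
  assumes psd: "psd v" and v0: "v \<noteq> 0" and d4: "dim (ker v) = 4" and line: "ann (ker v) = span {v}"
    and zf: "zero_free (ker v)" and S: "span S = ker v"
begin

abbreviation I :: "quaternary set" where "I \<equiv> ideal_generated (qf ` S)"

lemma Z0: "(\<And>a. m11 m a \<in> ker v) \<Longrightarrow> m = 0"
  by (rule Zk_trivial[OF d4 zf]) (simp add: Zk_def)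

lemma qf_in_I: "w \<in> ker v \<Longrightarrow> qf w \<in> I"
proof -
  have "subspace (qf -` I)" by (rule linear_subspace_vimage[OF linear_form_of subspace_ideal])
  then have "span S \<subseteq> qf -` I" by (intro span_minimal) (auto intro: ideal_base)
  then show "w \<in> ker v \<Longrightarrow> qf w \<in> I" using S by auto
qed

text \<open>Only the quadratic component of a cofactor of a generator contributes in degree four,
  and there the generator lies in the radical.\<close>

lemma functional_I: assumes "p \<in> I" shows "v \<bullet> vec4 (g * p) = 0"
proof -
  let ?T = "{p. \<forall>g. v \<bullet> vec4 (g * p) = 0}"
  have "I \<subseteq> ?T"
  proof (rule ideal_minimal)
    show "qf ` S \<subseteq> ?T"
    proof clarify
      fix w and g :: quaternary assume "w \<in> S"
      then have w: "w \<in> ker v" using S span_base by auto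
      have "vec4 (g * qf w) = vec4 (hom_comp (2 + 2) (qf w * g))"
        using exponents by (simp add: coords_def lookup_hom_comp mult.commute)
      also have "\<dots> = vec4 (qf w * hom_comp 2 g)" by (simp only: hom_comp_mult_form[OF i2.form_of_forms])
      also have "\<dots> = m22 w (coords quad_exps (hom_comp 2 g))" by (simp add: m22_def i2.form_of_coords)
      finally show "v \<bullet> vec4 (g * qf w) = 0" using kerD(1)[OF w] by (simp add: B_def)
    qed
    show "0 \<in> ?T" by (simp add: linear_0[OF linear_coords])
    show "p + q \<in> ?T" if "p \<in> ?T" "q \<in> ?T" for p q
      using that by (simp add: distrib_left linear_add[OF linear_coords] inner_add_right)
    show "h * p \<in> ?T" if "p \<in> ?T" for h p
      using that by (simp add: mult.assoc[symmetric])
  qed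
  then show ?thesis using assms by auto
qed

lemma I_forms_2: assumes "qf w \<in> I" shows "w \<in> ker v"
  using functional_I[OF assms, of "qf _"] by (simp add: ker_def B_def m22_def mult.commute)

text \<open>As the annihilator is a line, products of the kernel with quadrics fill the hyperplane
  on which \<open>v\<close> vanishes.\<close>

lemma pf_in_I: assumes "v \<bullet> y = 0" shows "pf y \<in> I"
proof -
  let ?M = "{m22 u z | u z. u \<in> ker v}"
  have "y \<in> span ?M"
  proof (rule ccontr)
    assume "y \<notin> span ?M"
    obtain a b where ab: "y = a + b" "a \<in> span ?M" "b \<in> {z. \<forall>w\<in>span ?M. orthogonal z w}"
      by (rule orth_decomp[OF subspace_span])
    have "b \<in> ann (ker v)" using ab(3) by (auto simp: ann_orthogonal intro: span_base)
    then obtain r where r: "b = r *\<^sub>R v" using line by (auto simp: span_singleton)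
    have "b \<bullet> b = b \<bullet> y" using ab by (simp add: inner_add_right orthogonal_def)
    also have "\<dots> = 0" using assms by (simp add: r)
    finally show False using ab \<open>y \<notin> span ?M\<close> by simp
  qed
  moreover have "subspace (pf -` I)" by (rule linear_subspace_vimage[OF linear_form_of subspace_ideal])
  then have "span ?M \<subseteq> pf -` I"
  proof (intro span_minimal)
    have "pf (m22 u z) \<in> I" if "u \<in> ker v" for u z
      using ideal_mult[OF qf_in_I[OF that], of "qf z"] by (simp add: mult.commute)
    then show "?M \<subseteq> pf -` I" by blast
  qed
  ultimately show ?thesis by auto
qed

lemma form4_in_I: assumes "p \<in> forms 4" "v \<bullet> vec4 p = 0" shows "p \<in> I"
  using pf_in_I[OF assms(2)] i4.form_of_coords[OF assms(1)] by simp

lemma functional_mult_linear: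
  "v \<bullet> vec4 (lf a * (lf c * qf q)) = B v (m11 a c) q"
  by (simp add: B_def m22_def mult.assoc)

lemma variable_lf: "variable i = lf (axis i 1)"
  by (simp add: lf_axis variable_def lin_exps_def)

lemma lf_mult_in:
  assumes "subspace T" "\<And>i. variable i * p \<in> T" shows "lf a * p \<in> T"
proof -
  have "lf a * p = (\<Sum>i\<in>UNIV. a $ i *\<^sub>R (variable i * p))"
    unfolding variable_lf by (subst lf_expansion) (simp add: sum_distrib_right scaleR_mult_left)
  then show ?thesis using assms by (simp add: subspace_sum subspace_scale)
qed

text \<open>The elements \<open>a b g\<close> and \<open>b a g\<close> agree, which for \<open>g\<close> with \<open>\<alpha>(a g) = 0\<close> and
  \<open>\<alpha>(b g) = 1\<close> shows that \<open>a\<close> annihilates the socle generator.\<close>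

lemma lf_mult_quartic: assumes p: "p \<in> forms 4" shows "lf a * p \<in> I"
proof (cases "a = 0")
  case True
  then show ?thesis by (simp add: linear_0[OF linear_form_of] ideal_zero)
next
  case False
  obtain l where l: "\<And>m. m11 l m \<in> ker v \<Longrightarrow> m \<in> Zk v" using generic_linear_form[OF psd] by blast
  have l': "m = 0" if "m11 l m \<in> ker v" for m using Zk_trivial[OF d4 zf l[OF that]] .
  have "dim {a} < DIM(real ^ 4)" by simp
  then obtain b where b: "b \<noteq> 0" "\<And>y. y \<in> span {a} \<Longrightarrow> orthogonal b y"
    using orthogonal_to_subspace_exists by blast
  have ba: "b \<bullet> a = 0" using b(2)[of a] by (simp add: orthogonal_def span_base)
  define Q where "Q x y = B v (m11 l x) (m11 l y)" for x y
  have Q: "bilinear Q" by (auto simp: bilinear_def Q_def m11_simps B_simps intro!: linearI)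
  have nd: "x = 0" if "\<And>a. Q a x = 0" for x
    using that[of x] psd_ker[OF psd, of "m11 l x"] l' by (auto simp: Q_def)
  have "linear (\<lambda>x. x \<bullet> b / (b \<bullet> b))" by (rule linearI) (auto simp: inner_add_left add_divide_distrib)
  then obtain d where d: "\<And>x. Q x d = x \<bullet> b / (b \<bullet> b)" using riesz_form[OF Q nd] by metis
  \<comment> \<open>With \<open>g = lf l * qf q\<close>, the choice of \<open>d\<close> makes
    \<open>v\<close> equal to 1 on \<open>b g\<close> and 0 on \<open>a g\<close>.\<close>
  define q where "q = m11 l d"
  define s where "s = lf b * (lf l * qf q)"
  have s: "v \<bullet> vec4 s = 1" unfolding s_def functional_mult_linear
    using d[of b] b(1) by (simp add: q_def Q_def m11_commute)
  have ag: "lf a * (lf l * qf q) \<in> I"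
  proof (rule form4_in_I)
    have "lf a * (lf l * qf q) \<in> forms (1 + (1 + 2))" by (intro forms_mult i1.form_of_forms i2.form_of_forms)
    then show "lf a * (lf l * qf q) \<in> forms 4" by (simp add: eval_nat_numeral)
    show "v \<bullet> vec4 (lf a * (lf l * qf q)) = 0" unfolding functional_mult_linear
      using d[of a] ba by (simp add: q_def Q_def m11_commute[of a] inner_commute)
  qed
  have as: "lf a * s \<in> I" using ideal_mult[OF ag, of "lf b"] by (simp add: s_def mult_ac)
  have sf: "s \<in> forms 4"
  proof -
    have "s \<in> forms (1 + (1 + 2))" unfolding s_def by (intro forms_mult i1.form_of_forms i2.form_of_forms)
    then show ?thesis by (simp add: eval_nat_numeral)
  qed
  define c where "c = v \<bullet> vec4 p"
  have "p - c *\<^sub>R s \<in> I"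
  proof (rule form4_in_I)
    show "p - c *\<^sub>R s \<in> forms 4" using p sf by (intro subspace_diff[OF subspace_forms]) auto
    show "v \<bullet> vec4 (p - c *\<^sub>R s) = 0"
      using s by (simp add: linear_diff[OF linear_coords] linear_cmul[OF linear_coords] inner_diff_right c_def)
  qed
  then have "lf a * (p - c *\<^sub>R s) + c *\<^sub>R (lf a * s) \<in> I"
    by (intro ideal_add ideal_mult ideal_scaleR as)
  then show ?thesis by (simp add: right_diff_distrib scaleR_mult_right)
qed

lemma forms_subset_I: "5 \<le> d \<Longrightarrow> forms d \<subseteq> I"
proof (induction d rule: dec_induct)
  case base
  show ?case
  proof
    fix p :: quaternary assume p: "p \<in> forms 5"
    have "Poly_Mapping.lookup p n *\<^sub>R Poly_Mapping.single n 1 \<in> I" if n: "mon_degree n = 5" for n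
    proof -
      have "mon_degree n = Suc 4" using n by simp
      then obtain i k where k: "n = lin_exps i + k" "mon_degree k = 4" by (rule monomial_split)
      then have "Poly_Mapping.single n 1 = lf (axis i 1) * Poly_Mapping.single k (1 :: real)"
        by (simp add: lf_axis mult_single)
      then show ?thesis using k(2) by (simp add: ideal_scaleR lf_mult_quartic)
    qed
    then show "p \<in> I" by (subst forms_expansion[OF p]) (auto intro: ideal_sum)
  qed
next
  case (step d)
  show ?case
  proof
    fix p :: quaternary assume p: "p \<in> forms (Suc d)"
    have "Poly_Mapping.lookup p n *\<^sub>R Poly_Mapping.single n 1 \<in> I" if n: "mon_degree n = Suc d" for n
    proof -
      obtain i k where k: "n = lin_exps i + k" "mon_degree k = d" using n by (rule monomial_split)
      then have "Poly_Mapping.single n 1 = lf (axis i 1) * Poly_Mapping.single k (1 :: real)"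
        by (simp add: lf_axis mult_single)
      moreover have "Poly_Mapping.single k 1 \<in> I" using step.IH k(2) by auto
      ultimately show ?thesis by (simp add: ideal_scaleR ideal_mult)
    qed
    then show "p \<in> I" by (subst forms_expansion[OF p]) (auto intro: ideal_sum)
  qed
qed

text \<open>Two dimensions agree. Pairing cubics with linear forms through \<open>v\<close> is
  nondegenerate on the linear side, so cubics orthogonal to all linear forms have dimension 20 - 4 =
  16. They contain the 4 * 4 products of the kernel basis with the variables, which are
  independent.\<close>

lemma cubic_in_I:
  assumes p: "p \<in> forms 3" and ann: "\<And>a. v \<bullet> vec4 (lf a * p) = 0"
  shows "p \<in> I"
proof -
  let ?cf = "form_of cubic_exps" and ?cc = "coords cubic_exps"
  have prod3: "lf a * qf x \<in> forms 3" for a x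
  proof -
    have "lf a * qf x \<in> forms (1 + 2)" by (intro forms_mult i1.form_of_forms i2.form_of_forms)
    then show ?thesis by (simp add: eval_nat_numeral)
  qed
  obtain b where b: "adapted_basis b 4 (ker v)" using adapted_basis_exists[OF subspace_ker d4] by blast
  have bk: "b i \<in> ker v" if "i < 4" for i using b that span_base[of "b i" "b ` {..<4}"] by (auto simp: adapted_basis_def)
  define \<Theta> :: "real ^ cubic_mon \<Rightarrow> real ^ 4" where "\<Theta> y = (\<chi> j. v \<bullet> vec4 (lf (axis j 1) * ?cf y))" for y
  have lin: "linear \<Theta>"
    by (rule linearI) (auto simp: \<Theta>_def vec_eq_iff linear_add[OF linear_form_of] linear_cmul[OF linear_form_of]
        distrib_left scaleR_mult_right linear_add[OF linear_coords] linear_cmul[OF linear_coords] inner_add_right)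
  have in\<Theta>: "m \<bullet> \<Theta> y = v \<bullet> vec4 (lf m * ?cf y)" for m y
  proof -
    have "v \<bullet> vec4 (lf m * ?cf y) = (\<Sum>i\<in>UNIV. m $ i * (v \<bullet> vec4 (lf (axis i 1) * ?cf y)))"
      by (subst lf_expansion) (simp add: sum_distrib_right scaleR_mult_left linear_sum[OF linear_coords]
          linear_cmul[OF linear_coords] inner_sum_right)
    then show ?thesis unfolding inner_vec_def[of m] by (simp add: \<Theta>_def)
  qed
  have "span (range \<Theta>) = UNIV"
  proof (rule ccontr)
    assume "span (range \<Theta>) \<noteq> UNIV"
    then have "span (range \<Theta>) \<subset> span UNIV" by auto
    then obtain m where m: "m \<noteq> 0" "\<And>y. y \<in> span (range \<Theta>) \<Longrightarrow> orthogonal m y"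
      using orthogonal_to_subspace_exists_gen by metis
    have "B v (m11 m a) q = 0" for a q
    proof -
      have "v \<bullet> vec4 (lf m * ?cf (?cc (lf a * qf q))) = 0"
        using m(2)[of "\<Theta> (?cc (lf a * qf q))"] in\<Theta> by (simp add: orthogonal_def span_base)
      then show ?thesis using functional_mult_linear by (simp add: i3.form_of_coords prod3)
    qed
    then show False using Z0[of m] m(1) by (auto simp: ker_def)
  qed
  then have "dim (range \<Theta>) = 4" using dim_eq_full[of "range \<Theta>"] by simp
  then have dK: "dim {y. \<Theta> y = 0} = 16" using rank_nullity[OF lin] by (simp add: CARD_cubic_mon)
  define F where "F = (\<lambda>(i, j). ?cc (lf (axis j 1) * qf (b i)))"
  let ?X = "{..<4 :: nat} \<times> (UNIV :: 4 set)"
  have zero: "c i j = 0" if c: "(\<Sum>x\<in>?X. case_prod c x *\<^sub>R F x) = 0" and i: "i < 4" for c i j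
  proof -
    define L where "L i = (\<chi> j. c i j)" for i
    have "lf (L i) = (\<Sum>j\<in>UNIV. c i j *\<^sub>R lf (axis j 1))" for i
      by (subst lf_expansion) (simp add: L_def)
    then have "(\<Sum>i<4. lf (L i) * qf (b i)) = (\<Sum>i<4. \<Sum>j\<in>UNIV. c i j *\<^sub>R (lf (axis j 1) * qf (b i)))"
      by (simp add: sum_distrib_right scaleR_mult_left)
    also have "\<dots> = (\<Sum>x\<in>?X. case_prod c x *\<^sub>R ?cf (F x))"
      unfolding sum.cartesian_product F_def by (rule sum.cong) (auto simp: i3.form_of_coords prod3)
    also have "\<dots> = ?cf (\<Sum>x\<in>?X. case_prod c x *\<^sub>R F x)"
      by (simp add: linear_sum[OF linear_form_of] linear_cmul[OF linear_form_of])
    also have "\<dots> = 0" by (simp add: c linear_0[OF linear_form_of])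
    finally have L0: "(\<Sum>i<4. lf (L i) * qf (b i)) = 0" .
    \<comment> \<open>Multiplication by \<open>m\<close> raises a linear syzygy to a quadratic one,
      whose coefficients lie in the kernel; since this holds for all \<open>m\<close>, the form
      \<open>L i\<close> is zero.\<close>
    have "m11 (L i) m \<in> ker v" for m
    proof (rule syzygy_in_kernel[OF b line _ i, of "\<lambda>i. m11 (L i) m"])
      have "(\<Sum>i<4. m22 (b i) (m11 (L i) m)) = vec4 (lf m * (\<Sum>i<4. lf (L i) * qf (b i)))"
        by (simp add: m22_def sum_distrib_left linear_sum[OF linear_coords] mult_ac)
      then show "(\<Sum>i<4. m22 (b i) (m11 (L i) m)) = 0" by (simp add: L0 linear_0[OF linear_coords])
    qed
    then have "L i = 0" by (rule Z0)
    then show "c i j = 0" by (simp add: L_def vec_eq_iff)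
  qed
  have inj: "inj_on F ?X"
  proof (rule inj_onI, rule ccontr)
    fix x y assume xy: "x \<in> ?X" "y \<in> ?X" "F x = F y" "x \<noteq> y"
    define c :: "nat \<Rightarrow> 4 \<Rightarrow> real" where "c i j = (if (i, j) = x then 1 else if (i, j) = y then - 1 else 0)" for i j
    have "(\<Sum>z\<in>?X. case_prod c z *\<^sub>R F z) = (\<Sum>z\<in>{x, y}. case_prod c z *\<^sub>R F z)"
      by (rule sum.mono_neutral_right) (use xy in \<open>auto simp: c_def split: if_splits\<close>)
    also have "\<dots> = 0" using xy by (simp add: c_def case_prod_beta)
    finally have "c (fst x) (snd x) = 0" using xy by (intro zero) auto
    then show False by (simp add: c_def)
  qed
  have ind: "independent (F ` ?X)"
  proof (rule independent_if_scalars_zero)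
    fix f x assume f: "(\<Sum>x\<in>F ` ?X. f x *\<^sub>R x) = 0" and x: "x \<in> F ` ?X"
    have "(\<Sum>z\<in>?X. case_prod (\<lambda>i j. f (F (i, j))) z *\<^sub>R F z) = 0"
      using f unfolding sum.reindex[OF inj] by (simp add: case_prod_beta)
    from zero[OF this] show "f x = 0" using x by auto
  qed simp
  have "card (F ` ?X) = 16" using card_image[OF inj] by (simp add: card_cartesian_product)
  moreover have FK: "F ` ?X \<subseteq> {y. \<Theta> y = 0}"
  proof
    fix y assume "y \<in> F ` ?X"
    then obtain i j where ij: "y = F (i, j)" "i < 4" by auto
    then have "qf (b i) \<in> I" by (intro qf_in_I bk) simp
    from functional_I[OF this] have "v \<bullet> vec4 (lf (axis k 1) * (lf (axis j 1) * qf (b i))) = 0" for k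
      by (simp add: mult.assoc[symmetric])
    then show "y \<in> {y. \<Theta> y = 0}" by (simp add: ij \<Theta>_def F_def vec_eq_iff i3.form_of_coords prod3)
  qed
  ultimately have "dim (span (F ` ?X)) = 16" by (simp add: dim_eq_card_independent[OF ind])
  then have "span (F ` ?X) = {y. \<Theta> y = 0}"
    using dK FK linear_subspace_kernel[OF lin] by (intro subspace_dim_equal span_minimal) auto
  moreover have "\<Theta> (?cc p) = 0" using ann by (simp add: \<Theta>_def vec_eq_iff i3.form_of_coords p)
  ultimately have "?cc p \<in> span (F ` ?X)" by simp
  moreover have "?cf (F (i, j)) \<in> I" if "i < 4" for i j
    using ideal_mult[OF qf_in_I[OF bk[OF that]]] by (simp add: F_def i3.form_of_coords prod3)
  then have "span (F ` ?X) \<subseteq> ?cf -` I"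
    by (intro span_minimal linear_subspace_vimage[OF linear_form_of subspace_ideal]) auto
  ultimately show ?thesis using i3.form_of_coords[OF p] by auto
qed

text \<open>Each degree reduces to nondegeneracy of the pairing induced by \<open>v\<close>: cubics
  by \<open>cubic_in_I\<close>, quadrics by the definition of the radical, and linear forms and
  constants because no nonzero linear form multiplies all of \<open>A_1\<close> into the
  kernel.\<close>

lemma socle_low_degree:
  assumes p: "p \<in> forms d" "d \<le> 3" and s: "\<And>a. lf a * p \<in> I"
  shows "p \<in> I"
proof -
  have z: "v \<bullet> vec4 (g * (lf a * p)) = 0" for g a by (rule functional_I[OF s])
  consider "d = 3" | "d = 2" | "d = 1" | "d = 0" using p(2) by linarith
  then show ?thesis
  proof cases
    case 1
    show ?thesis by (rule cubic_in_I) (use p(1) 1 z[of 1] in auto)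
  next
    case 2
    then have pq: "p = qf (coords quad_exps p)" using p(1) by (simp add: i2.form_of_coords)
    have "m11 a c \<in> {x. B v (coords quad_exps p) x = 0}" for a c
      using z[of "lf c" a] by (subst (asm) pq) (simp add: B_def m22_def mult_ac)
    moreover have "subspace {x. B v (coords quad_exps p) x = 0}" by (auto simp: subspace_def B_simps)
    ultimately have "span {m11 a c | a c. True} \<subseteq> {x. B v (coords quad_exps p) x = 0}"
      by (intro span_minimal) auto
    then have "coords quad_exps p \<in> ker v" unfolding span_m11 by (auto simp: ker_def)
    then show ?thesis using qf_in_I pq by metis
  next
    case 3
    then have pl: "p = lf (coords lin_exps p)" using p(1) by (simp add: i1.form_of_coords)
    have "m11 (coords lin_exps p) a \<in> ker v" for a
      using s[of a] pl by (intro I_forms_2) (simp add: mult.commute)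
    then have "coords lin_exps p = 0" by (rule Z0)
    then show ?thesis using pl by (simp add: linear_0[OF linear_form_of] ideal_zero)
  next
    case 4
    define c where "c = Poly_Mapping.lookup p 0"
    have "mon_degree m = 0 \<longleftrightarrow> m = 0" for m :: "4 \<Rightarrow>\<^sub>0 nat" by (auto simp: mon_degree_def poly_mapping_eq_iff fun_eq_iff)
    then have pc: "p = Poly_Mapping.single 0 c"
      using p(1) 4 by (intro poly_mapping_eqI) (auto simp: forms_iff c_def lookup_single when_def)
    have lc: "lf a * p = lf (c *\<^sub>R a)" for a
      unfolding pc by (simp add: mult.commute[of "lf a"] scaleR_eq_mult[symmetric] linear_cmul[OF linear_form_of])
    have mc: "m11 (c *\<^sub>R a) x \<in> ker v" for a x
    proof (rule I_forms_2)
      have "lf x * lf (c *\<^sub>R a) \<in> I" using ideal_mult[OF s[of a], of "lf x"] unfolding lc .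
      then show "qf (m11 (c *\<^sub>R a) x) \<in> I" by (simp add: mult.commute)
    qed
    have "c *\<^sub>R a = 0" for a :: "real ^ 4" by (rule Z0) (rule mc)
    from this[of "axis 1 1"] have "c = 0" by (simp add: axis_eq_0_iff)
    then show ?thesis using pc by (simp add: ideal_zero)
  qed
qed

lemma hom_comp_I: assumes "p \<in> I" shows "hom_comp d p \<in> I"
proof -
  have "I \<subseteq> {p. \<forall>d. hom_comp d p \<in> I}"
  proof (rule ideal_minimal)
    have "qf x \<in> I" if "x \<in> S" for x using that by (intro ideal_base) simp
    then show "qf ` S \<subseteq> {p. \<forall>d. hom_comp d p \<in> I}"
      by (auto simp: hom_comp_of_form[OF i2.form_of_forms] ideal_zero)
  qed (auto simp: hom_comp_add hom_comp_mult ideal_zero intro: ideal_add ideal_sum ideal_mult)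
  then show ?thesis using assms by auto
qed

text \<open>The ideal is homogeneous, so the socle can be computed by degrees: nothing below degree
  4, everything in the ideal from degree 5 on, and a single line modulo the ideal in degree
  4.\<close>

lemma gorenstein: "gorenstein_quotient I 4"
  unfolding gorenstein_quotient_def
proof (intro conjI)
  show "homogeneous_ideal I"
    unfolding homogeneous_ideal_def
  proof
    show "I \<subseteq> ideal_generated (I \<inter> (\<Union>d. forms d))"
      by (rule module.span_mono[OF module_mult]) (auto intro: ideal_base i2.form_of_forms)
    show "ideal_generated (I \<inter> (\<Union>d. forms d)) \<subseteq> I"
      by (rule ideal_minimal) (auto intro: ideal_zero ideal_add ideal_mult)
  qed
  show "\<exists>Bs. finite Bs \<and> span (Bs \<union> I) = UNIV"
  proof (intro exI conjI)
    let ?B = "(\<lambda>m. Poly_Mapping.single m 1 :: quaternary) ` (\<Union>d\<le>4. {m. mon_degree m = d})"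
    show "finite ?B" by (intro finite_imageI finite_UN_I finite_mon_degree) auto
    have "p \<in> span (?B \<union> I)" for p
    proof (induction p rule: poly_mapping_single_add_induct)
      case (single m c)
      show ?case
      proof (cases "mon_degree m \<le> 4")
        case True
        then have "Poly_Mapping.single m 1 \<in> span (?B \<union> I)" by (intro span_base) auto
        from span_scale[OF this, of c] show ?thesis by (simp add: scaleR_eq_mult mult_single)
      next
        case False
        then have "Poly_Mapping.single m c \<in> I" using forms_subset_I[of "mon_degree m"] by auto
        then show ?thesis by (intro span_base) auto
      qed
    qed (auto intro: span_zero span_add)
    then show "span (?B \<union> I) = UNIV" by auto
  qed
  \<comment> \<open>The coefficient vector of \<open>v\<close>, read as a quartic, is a
    representative on which \<open>v\<close> is nonzero.\<close>
  define s where "s = pf v"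
  have vv: "v \<bullet> v \<noteq> 0" using v0 by simp
  have sI: "s \<notin> I" using functional_I[of s 1] vv by (auto simp: s_def)
  have "socle_preimage I = span (insert s I)"
  proof
    show "span (insert s I) \<subseteq> socle_preimage I"
    proof (rule span_minimal)
      show "insert s I \<subseteq> socle_preimage I"
        by (auto simp: socle_preimage_def variable_lf s_def intro: lf_mult_quartic ideal_mult)
      show "subspace (socle_preimage I)"
        by (auto simp: subspace_def socle_preimage_def ideal_zero distrib_left scaleR_mult_right intro: ideal_add ideal_scaleR)
    qed
    show "socle_preimage I \<subseteq> span (insert s I)"
    proof
      fix p assume p: "p \<in> socle_preimage I"
      then have lp: "lf a * p \<in> I" for a
        by (intro lf_mult_in subspace_ideal) (simp add: socle_preimage_def)
      have comp: "lf a * hom_comp d p \<in> I" for a d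
        using hom_comp_I[OF lp[of a], of "d + 1"] by (simp only: hom_comp_mult_form[OF i1.form_of_forms])
      have "hom_comp d p \<in> span (insert s I)" for d
      proof -
        consider "d \<le> 3" | "d = 4" | "5 \<le> d" by linarith
        then show ?thesis
        proof cases
          case 1
          have "hom_comp d p \<in> I" by (rule socle_low_degree[OF hom_comp_forms 1 comp])
          then show ?thesis by (intro span_base) simp
        next
          case 2
          define c where "c = (v \<bullet> vec4 (hom_comp d p)) / (v \<bullet> v)"
          have "hom_comp d p - c *\<^sub>R s \<in> I"
          proof (rule form4_in_I)
            show "hom_comp d p - c *\<^sub>R s \<in> forms 4"
              using 2 by (intro subspace_diff[OF subspace_forms]) (auto simp: s_def)
            show "v \<bullet> vec4 (hom_comp d p - c *\<^sub>R s) = 0"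
              using vv by (simp add: linear_diff[OF linear_coords] linear_cmul[OF linear_coords] inner_diff_right c_def s_def)
          qed
          then have "hom_comp d p - c *\<^sub>R s + c *\<^sub>R s \<in> span (insert s I)"
            by (intro span_add span_scale span_base) auto
          then show ?thesis by simp
        next
          case 3
          then have "hom_comp d p \<in> I" using forms_subset_I[of d] hom_comp_forms by blast
          then show ?thesis by (intro span_base) simp
        qed
      qed
      then have "(\<Sum>d\<le>N. hom_comp d p) \<in> span (insert s I)" for N by (intro span_sum)
      moreover obtain N where "p = (\<Sum>d\<le>N. hom_comp d p)" by (rule sum_hom_comp)
      ultimately show "p \<in> span (insert s I)" by metis
    qed
  qed
  then show "\<exists>s\<in>forms 4. s \<notin> I \<and> socle_preimage I = span (insert s I)"
    using sI by (intro bexI[of _ s]) (auto simp: s_def)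
qed

end

lemma boundary_gorenstein:
  assumes f: "f \<in> boundary_Sigma4" "strictly_positive f" and ps: "length ps = 4" "sos_rep f ps"
  shows "distinct ps" "independent (set ps)" "gorenstein_quotient (ideal_generated (set ps)) 4"
proof -
  obtain v where v: "psd v" "v \<noteq> 0" "dim (ker v) = 4" "ann (ker v) = span {v}"
      "\<And>xs. vec4 f = (\<Sum>x\<leftarrow>xs. m22 x x) \<Longrightarrow> span (set xs) = ker v"
    using boundary_functional[OF f] by metis
  define xs where "xs = map (coords quad_exps) ps"
  note rep = sos_rep_vec[OF ps(2), folded xs_def]
  have sp: "span (set xs) = ker v" by (rule v(5)[OF rep(2)])
  have "dim (ker v) \<le> card (set xs)" using sp by (intro dim_le_card) auto
  moreover have "card (set xs) \<le> 4" using card_length[of xs] ps(1) by (simp add: xs_def)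
  ultimately have c4: "card (set xs) = 4" using v(3) by simp
  then have "distinct xs" using ps(1) by (intro card_distinct) (simp add: xs_def)
  then show "distinct ps" by (simp add: xs_def distinct_map)
  have "independent (set xs)"
    using c4 v(3) sp span_superset[of "set xs"] by (intro card_le_dim_spanning[of _ "ker v"]) auto
  then have "independent (qf ` set xs)"
    using linear_independent_injective_image[OF linear_form_of] i2.inj_form_of by (metis inj_on_subset subset_UNIV)
  moreover have set_ps: "qf ` set xs = set ps" using rep(3) by (metis list.set_map)
  ultimately show "independent (set ps)" by simp
  have "pf (vec4 f) = f" using rep(1) by (rule i4.form_of_coords)
  then have "zero_free (ker v)" using zero_free_representation[of xs] f(2) rep(2) sp by simp
  then interpret kernel_ideal v "set xs" using v sp by unfold_locales
  show "gorenstein_quotient (ideal_generated (set ps)) 4" using gorenstein set_ps by simp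
qed

section \<open>Rational specialisation\<close>

lemma Rats_sum: "(\<And>i. i \<in> A \<Longrightarrow> f i \<in> \<rat>) \<Longrightarrow> sum f A \<in> \<rat>"
  by (induction A rule: infinite_finite_induct) auto

text \<open>A Q-linear retraction of the reals onto the rationals: applied to the entries of a
  solution of linear equations with rational coefficients it yields a rational solution.\<close>

definition rat_spec :: "(real \<Rightarrow> real) \<Rightarrow> bool" where
  "rat_spec \<phi> \<longleftrightarrow> (\<forall>x y. \<phi> (x + y) = \<phi> x + \<phi> y) \<and> (\<forall>x. \<phi> x \<in> \<rat>) \<and>
    (\<forall>q\<in>\<rat>. \<forall>x. \<phi> (q * x) = q * \<phi> x) \<and> (\<forall>q\<in>\<rat>. \<phi> q = q)"

lemma rat_specD:
  assumes "rat_spec \<phi>"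
  shows "\<phi> (x + y) = \<phi> x + \<phi> y" "\<phi> x \<in> \<rat>" "q \<in> \<rat> \<Longrightarrow> \<phi> (q * x) = q * \<phi> x"
    "q \<in> \<rat> \<Longrightarrow> \<phi> (x * q) = \<phi> x * q" "q \<in> \<rat> \<Longrightarrow> \<phi> q = q" "\<phi> 0 = 0"
  using assms by (auto simp: rat_spec_def mult.commute)

lemma rat_spec_sum: "rat_spec \<phi> \<Longrightarrow> \<phi> (sum f A) = (\<Sum>a\<in>A. \<phi> (f a))"
  by (induction A rule: infinite_finite_induct) (auto simp: rat_specD)

text \<open>Extend \<open>1\<close> to a basis over the rationals of the span of \<open>Y\<close> and move its other elements to
  nearby rational numbers.\<close>

lemma rational_specialization:
  fixes Y :: "real set"
  assumes Y: "finite Y" and e: "e > 0"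
  obtains \<phi> where "rat_spec \<phi>" "\<And>y. y \<in> Y \<Longrightarrow> \<bar>\<phi> y - y\<bar> < e"
proof -
  interpret vector_space_pair "\<lambda>(r :: rat) (x :: real). of_rat r * x" "(*) :: rat \<Rightarrow> rat \<Rightarrow> rat"
    by unfold_locales (auto simp: algebra_simps of_rat_add of_rat_mult)
  have "vs1.independent {1}" by simp
  then obtain Bs where Bs: "{1} \<subseteq> Bs" "Bs \<subseteq> insert 1 Y" "vs1.independent Bs" "insert 1 Y \<subseteq> vs1.span Bs"
    using vs1.maximal_independent_subset_extend[of "{1}" "insert 1 Y"] by blast
  have fB: "finite Bs" using Bs(2) Y finite_subset by blast
  have "\<exists>u. y = (\<Sum>b\<in>Bs. of_rat (u b) * b)" if "y \<in> Y" for y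
    using that Bs(4) vs1.span_finite[OF fB] by auto
  then obtain u where u: "\<And>y. y \<in> Y \<Longrightarrow> y = (\<Sum>b\<in>Bs. of_rat (u y b) * b)" by metis
  \<comment> \<open>The summand 1 makes \<open>M\<close> positive and the final estimate
    strict.\<close>
  define M where "M = 1 + (\<Sum>y\<in>Y. \<Sum>b\<in>Bs. \<bar>real_of_rat (u y b)\<bar>)"
  have M: "M > 0" unfolding M_def by (intro add_pos_nonneg sum_nonneg) auto
  define d where "d = e / M"
  have d: "d > 0" using e M by (simp add: d_def)
  have "\<exists>r. \<bar>of_rat r - b\<bar> < d \<and> (b = 1 \<longrightarrow> r = 1)" for b
  proof (cases "b = 1")
    case False
    obtain r where "b < of_rat r" "of_rat r < b + d" using of_rat_dense[of b "b + d"] d by auto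
    then show ?thesis using False by (intro exI[of _ r]) auto
  qed (use d in \<open>auto intro: exI[of _ 1]\<close>)
  then obtain r where r: "\<And>b. \<bar>of_rat (r b) - b\<bar> < d" "r 1 = 1" by metis
  obtain g where g: "Vector_Spaces.linear (\<lambda>(r :: rat) (x :: real). of_rat r * x) (*) g" "\<forall>b\<in>Bs. g b = r b"
    using linear_independent_extend[OF Bs(3)] by blast
  interpret g: Vector_Spaces.linear "\<lambda>(r :: rat) (x :: real). of_rat r * x" "(*)" g by fact
  define \<phi> where "\<phi> x = real_of_rat (g x)" for x
  have g1: "g 1 = 1" using g(2) Bs(1) r(2) by simp
  have sc: "\<phi> (q * x) = q * \<phi> x" if "q \<in> \<rat>" for q x
  proof -
    from \<open>q \<in> \<rat>\<close> obtain p where "q = of_rat p" by (rule Rats_cases)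
    then show ?thesis using g.scale[of p x] by (simp add: \<phi>_def of_rat_mult)
  qed
  have "\<phi> q = q" if "q \<in> \<rat>" for q using sc[OF that, of 1] g1 by (simp add: \<phi>_def)
  then have "rat_spec \<phi>"
    using sc g.add by (simp add: rat_spec_def \<phi>_def of_rat_add)
  moreover have "\<bar>\<phi> y - y\<bar> < e" if y: "y \<in> Y" for y
  proof -
    have "\<phi> y = (\<Sum>b\<in>Bs. of_rat (u y b) * of_rat (r b))"
      using g(2) by (subst u[OF y]) (simp add: \<phi>_def g.sum g.scale of_rat_sum of_rat_mult)
    then have "\<phi> y - y = (\<Sum>b\<in>Bs. of_rat (u y b) * (of_rat (r b) - b))"
      using u[OF y] by (simp add: right_diff_distrib sum_subtractf)
    then have "\<bar>\<phi> y - y\<bar> \<le> (\<Sum>b\<in>Bs. \<bar>of_rat (u y b) * (of_rat (r b) - b)\<bar>)" by (simp add: sum_abs)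
    also have "\<dots> \<le> (\<Sum>b\<in>Bs. \<bar>real_of_rat (u y b)\<bar> * d)"
      using r(1) by (intro sum_mono) (simp add: abs_mult mult_left_mono less_imp_le)
    also have "\<dots> = (\<Sum>b\<in>Bs. \<bar>real_of_rat (u y b)\<bar>) * d" by (simp add: sum_distrib_right)
    also have "\<dots> < M * d"
    proof (rule mult_strict_right_mono[OF _ d])
      have "(\<Sum>b\<in>Bs. \<bar>real_of_rat (u y b)\<bar>) \<le> (\<Sum>y\<in>Y. \<Sum>b\<in>Bs. \<bar>real_of_rat (u y b)\<bar>)"
        by (rule member_le_sum[OF y _ Y]) (auto intro: sum_nonneg)
      then show "(\<Sum>b\<in>Bs. \<bar>real_of_rat (u y b)\<bar>) < M" by (simp add: M_def)
    qed
    also have "\<dots> = e" using M by (simp add: d_def)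
    finally show ?thesis .
  qed
  ultimately show ?thesis using that by blast
qed

section \<open>Sums of squares with rational coefficients\<close>

definition rat_vec :: "real ^ 'n \<Rightarrow> bool" where
  "rat_vec x \<longleftrightarrow> (\<forall>i. x $ i \<in> \<rat>)"

lemma rat_vec_simps: "rat_vec x \<Longrightarrow> rat_vec y \<Longrightarrow> rat_vec (x + y)" "rat_vec x \<Longrightarrow> rat_vec y \<Longrightarrow> rat_vec (x - y)"
  "q \<in> \<rat> \<Longrightarrow> rat_vec x \<Longrightarrow> rat_vec (q *\<^sub>R x)" "rat_vec 0" "rat_vec (axis i 1)"
  by (auto simp: rat_vec_def axis_def)

lemma rat_vec_sum: "(\<And>i. i \<in> A \<Longrightarrow> rat_vec (f i)) \<Longrightarrow> rat_vec (sum f A)"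
  by (auto simp: rat_vec_def intro!: Rats_sum)

lemma vec_axis_sum: "(x :: real ^ 'n) = (\<Sum>i\<in>UNIV. x $ i *\<^sub>R axis i 1)"
  by (simp add: vec_eq_iff axis_def if_distrib sum.delta cong: if_cong)

lemma m22_axes: "m22 x y = (\<Sum>i\<in>UNIV. \<Sum>j\<in>UNIV. (x $ i * y $ j) *\<^sub>R m22 (axis i 1) (axis j 1))"
  by (subst (1) vec_axis_sum[of x], subst (1) vec_axis_sum[of y]) (simp add: m22_sum_sum)

lemma m22_axis_axis: "\<exists>m. m22 (axis i 1) (axis j 1) = axis m 1"
proof -
  have "quad_exps i + quad_exps j \<in> range exponents"
    using quad_exps i4.range by (auto simp: mon_degree_add)
  then show ?thesis using m22_axis by (metis rangeE)
qed

lemma rat_vec_m22: assumes "rat_vec x" "rat_vec y" shows "rat_vec (m22 x y)"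
proof -
  have "rat_vec (m22 (axis i 1) (axis j 1))" for i j using m22_axis_axis[of i j] rat_vec_simps(5) by metis
  then show ?thesis
    using assms by (subst m22_axes) (intro rat_vec_sum rat_vec_simps, auto simp: rat_vec_def)
qed

definition rat_sq :: "(real ^ quartic_mon) set" where
  "rat_sq = {\<Sum>x\<leftarrow>xs. m22 x x | xs. \<forall>x\<in>set xs. rat_vec x}"

lemma rat_sq_add: "a \<in> rat_sq \<Longrightarrow> b \<in> rat_sq \<Longrightarrow> a + b \<in> rat_sq"
proof -
  assume "a \<in> rat_sq" "b \<in> rat_sq"
  then obtain xs ys where "a = (\<Sum>x\<leftarrow>xs. m22 x x)" "b = (\<Sum>x\<leftarrow>ys. m22 x x)"
    "\<forall>x\<in>set xs. rat_vec x" "\<forall>x\<in>set ys. rat_vec x" by (auto simp: rat_sq_def)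
  then have "a + b = (\<Sum>x\<leftarrow>xs @ ys. m22 x x)" "\<forall>x\<in>set (xs @ ys). rat_vec x" by auto
  then show ?thesis unfolding rat_sq_def by blast
qed

lemma rat_sq_0: "0 \<in> rat_sq"
  unfolding rat_sq_def by (intro CollectI exI[of _ "[]"]) simp

lemma rat_sq_sum: "(\<And>i. i \<in> A \<Longrightarrow> f i \<in> rat_sq) \<Longrightarrow> sum f A \<in> rat_sq"
  by (induction A rule: infinite_finite_induct) (auto intro: rat_sq_0 rat_sq_add)

text \<open>Since \<open>a / b\<close> equals \<open>a * b\<close> times the square of
  \<open>1 / b\<close>, it suffices to repeat the square of \<open>x / b\<close> that many
  times.\<close>

lemma rat_sq_scale:
  assumes "c \<in> \<rat>" "0 \<le> c" "rat_vec x" shows "c *\<^sub>R m22 x x \<in> rat_sq"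
proof -
  obtain a b :: nat where ab: "b \<noteq> 0" "c = real a / real b"
    using Rats_abs_nat_div_natE[OF assms(1)] assms(2) by (metis abs_of_nonneg)
  let ?xs = "replicate (a * b) ((1 / real b) *\<^sub>R x)"
  have rep: "(\<Sum>x\<leftarrow>replicate n z. m22 x x) = real n *\<^sub>R m22 z z" for n z
    by (induction n) (auto simp: scaleR_left_distrib)
  have "(\<Sum>x\<leftarrow>?xs. m22 x x) = real (a * b) *\<^sub>R m22 ((1 / real b) *\<^sub>R x) ((1 / real b) *\<^sub>R x)"
    by (rule rep)
  also have "\<dots> = c *\<^sub>R m22 x x" using ab by (simp add: m22_simps)
  finally have "(\<Sum>x\<leftarrow>?xs. m22 x x) = c *\<^sub>R m22 x x" .
  then have "c *\<^sub>R m22 x x = (\<Sum>x\<leftarrow>?xs. m22 x x)" by (rule sym)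
  moreover have "\<forall>x\<in>set ?xs. rat_vec x" using assms(3) by (auto intro!: rat_vec_simps)
  ultimately show ?thesis unfolding rat_sq_def by (intro CollectI exI[of _ ?xs] conjI)
qed

lemma rational_coeffs_qf: assumes "rat_vec x" shows "rational_coeffs (qf x)"
proof -
  have "Poly_Mapping.lookup (qf x) m \<in> \<rat>" for m
    unfolding form_of_def lookup_sum lookup_single
    using assms by (intro Rats_sum) (auto simp: rat_vec_def when_def)
  then show ?thesis by (simp add: rational_coeffs_def)
qed

lemma rat_sq_rational_sos: assumes "y \<in> rat_sq" shows "rational_sos (pf y)"
proof -
  obtain xs where xs: "y = (\<Sum>x\<leftarrow>xs. m22 x x)" "\<forall>x\<in>set xs. rat_vec x" using assms by (auto simp: rat_sq_def)
  then show ?thesis unfolding rational_sos_def xs(1) pf_sq_sum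
    using rational_coeffs_qf by (intro exI[of _ "map qf xs"]) auto
qed

lemma rat_vec_dense:
  assumes "e > 0" obtains r where "rat_vec r" "norm (r - x) < e"
proof -
  let ?n = "real CARD('a)"
  have n: "?n > 0" by simp
  have "\<exists>q\<in>\<rat>. x $ i < q \<and> q < x $ i + e / ?n" for i
    using assms n by (intro Rats_dense_in_real) simp
  then obtain q where q: "\<And>i. q i \<in> \<rat>" "\<And>i. x $ i < q i \<and> q i < x $ i + e / ?n" by metis
  define r where "r = (\<chi> i. q i)"
  have "norm (r - x) \<le> (\<Sum>i\<in>UNIV. \<bar>(r - x) $ i\<bar>)" by (rule norm_le_l1_cart)
  also have "\<dots> < (\<Sum>i\<in>(UNIV :: 'a set). e / ?n)"
    by (rule sum_strict_mono) (use q(2) in \<open>auto simp: r_def abs_less_iff algebra_simps\<close>, smt (verit) q(2))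
  also have "\<dots> = e" using n by simp
  finally show ?thesis using that[of r] q(1) by (simp add: rat_vec_def r_def)
qed

lemma continuous_square: "isCont (\<lambda>x. m22 x x) z"
  using bounded_bilinear.continuous[OF bilinear_m22[unfolded bilinear_conv_bounded_bilinear] continuous_ident continuous_ident] .

lemma approximate_squares:
  assumes "e > 0" shows "\<exists>y\<in>rat_sq. norm (y - (\<Sum>x\<leftarrow>xs. m22 x x)) < e"
  using assms
proof (induction xs arbitrary: e)
  case Nil
  then show ?case using rat_sq_0 by force
next
  case (Cons z xs)
  obtain y where y: "y \<in> rat_sq" "norm (y - (\<Sum>x\<leftarrow>xs. m22 x x)) < e / 2"
    using Cons.IH[of "e / 2"] Cons.prems by auto
  obtain d where d: "d > 0" "\<And>z'. dist z' z < d \<Longrightarrow> dist (m22 z' z') (m22 z z) < e / 2"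
    using continuous_square[of z] Cons.prems unfolding continuous_at_eps_delta by (metis half_gt_zero)
  obtain r where r: "rat_vec r" "norm (r - z) < d" by (rule rat_vec_dense[OF d(1)])
  have n: "norm (m22 r r - m22 z z) < e / 2" using d(2)[of r] r(2) by (simp add: dist_norm)
  have "m22 r r \<in> rat_sq" using rat_sq_scale[of 1 r] r(1) by simp
  then have "m22 r r + y \<in> rat_sq" using y(1) by (rule rat_sq_add)
  moreover have "norm (m22 r r + y - (\<Sum>x\<leftarrow>z # xs. m22 x x)) < e"
    using norm_triangle_lt[of "m22 r r - m22 z z" "y - (\<Sum>x\<leftarrow>xs. m22 x x)" e] n y(2) by (simp add: algebra_simps)
  ultimately show ?case by blast
qed

lemma rat_sq_rat_vec: "y \<in> rat_sq \<Longrightarrow> rat_vec y"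
proof -
  assume "y \<in> rat_sq"
  then obtain xs where xs: "y = (\<Sum>x\<leftarrow>xs. m22 x x)" "\<forall>x\<in>set xs. rat_vec x" by (auto simp: rat_sq_def)
  show ?thesis unfolding xs(1) using xs(2) by (induction xs) (auto intro: rat_vec_simps rat_vec_m22)
qed

lemma m22_polar: "m22 (a + b) (a + b) - m22 (a - b) (a - b) = 4 *\<^sub>R m22 a b"
  by (simp add: m22_simps m22_commute[of b a] vec_eq_iff)

text \<open>A small multiple of a fixed rational sum of squares \<open>E\<close> is set aside, the
  rest is approximated by rational squares, and the error is absorbed coefficient by coefficient
  into the reserve.\<close>

lemma interior_rational:
  assumes y: "y \<in> interior sq_cone" and r: "rat_vec y" shows "y \<in> rat_sq"
proof -
  have "\<exists>nk. m22 (axis (fst nk) 1) (axis (snd nk) 1) = axis m 1" for m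
    using m22_axis_obtain[of m] by (metis fst_conv snd_conv)
  then obtain s where s: "\<And>m. m22 (axis (fst (s m)) 1) (axis (snd (s m)) 1) = axis m 1" by metis
  define P N where "P m = axis (fst (s m)) 1 + axis (snd (s m)) (1 :: real)"
    and "N m = axis (fst (s m)) 1 - axis (snd (s m)) (1 :: real)" for m
  have PN: "rat_vec (P m)" "rat_vec (N m)" for m by (simp_all add: P_def N_def rat_vec_simps)
  have ax: "m22 (P m) (P m) - m22 (N m) (N m) = 4 *\<^sub>R axis m 1" for m
    using m22_polar[of "axis (fst (s m)) 1" "axis (snd (s m)) 1"] by (simp add: P_def N_def s)
  define E where "E = (\<Sum>m\<in>UNIV. m22 (P m) (P m) + m22 (N m) (N m))"
  obtain d where d: "d > 0" "ball y d \<subseteq> sq_cone" using y mem_interior by blast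
  obtain c where c: "c > 0" "norm (c *\<^sub>R E) < d" by (rule small_scaleR[OF d(1)])
  obtain q where q: "q \<in> \<rat>" "0 < q" "q < c" using Rats_dense_in_real[OF c(1)] by blast
  have "norm (q *\<^sub>R E) \<le> norm (c *\<^sub>R E)" using q c by (simp add: mult_right_mono)
  then have "y - q *\<^sub>R E \<in> sq_cone" using d(2) c(2) by (auto simp: dist_norm)
  then obtain xs where xs: "y - q *\<^sub>R E = (\<Sum>x\<leftarrow>xs. m22 x x)" by (auto simp: sq_cone_def)
  obtain z where z: "z \<in> rat_sq" "norm (z - (y - q *\<^sub>R E)) < 4 * q"
    using approximate_squares[of "4 * q" xs] q(2) xs by auto
  define g where "g = y - q *\<^sub>R E - z"
  have gn: "\<bar>g $ m\<bar> < 4 * q" for m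
    using component_le_norm_cart[of g m] z(2) by (simp add: g_def norm_minus_commute)
  have "rat_vec E" unfolding E_def by (intro rat_vec_sum rat_vec_simps rat_vec_m22 PN)
  then have gr: "g $ m \<in> \<rat>" for m
    using r q(1) rat_sq_rat_vec[OF z(1)] rat_vec_simps by (simp add: g_def rat_vec_def)
  have "g = (\<Sum>m\<in>UNIV. (g $ m / 4) *\<^sub>R (m22 (P m) (P m) - m22 (N m) (N m)))"
    unfolding ax by (subst vec_axis_sum) simp
  \<comment> \<open>Each monomial is a quarter of the difference of the squares of
    \<open>P m\<close> and \<open>N m\<close>, and both occur in \<open>E\<close> with weight
    \<open>q\<close>. The error is below \<open>4 * q\<close>, so all new weights stay
    nonnegative.\<close>
  then have "y = z + (\<Sum>m\<in>UNIV. (q + g $ m / 4) *\<^sub>R m22 (P m) (P m) + (q - g $ m / 4) *\<^sub>R m22 (N m) (N m))"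
    unfolding g_def E_def by (simp add: scaleR_sum_right sum.distrib[symmetric] sum_subtractf algebra_simps)
  also have "\<dots> \<in> rat_sq"
  proof (intro rat_sq_add z(1) rat_sq_sum rat_sq_scale PN)
    show "q + g $ m / 4 \<in> \<rat>" "q - g $ m / 4 \<in> \<rat>" for m using gr q(1) by auto
    show "0 \<le> q + g $ m / 4" "0 \<le> q - g $ m / 4" for m using gn[of m] by (auto simp: abs_less_iff)
  qed
  finally show ?thesis .
qed

text \<open>A mixed term equals half its absolute coefficient times the square of
  \<open>y j + sgn (R j k) *\<^sub>R y k\<close>, minus pure squares that the dominant diagonal can
  pay for. All weights remain rational.\<close>

lemma diagonally_dominant_rat_sq:
  fixes R :: "nat \<Rightarrow> nat \<Rightarrow> real"
  assumes R: "\<And>j k. R j k \<in> \<rat>" "\<And>j k. R j k = R k j" and y: "\<And>j. j < n \<Longrightarrow> rat_vec (y j)"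
    and dom: "\<And>j. j < n \<Longrightarrow> (\<Sum>k<n. if j = k then 0 else \<bar>R j k\<bar>) \<le> R j j"
  shows "(\<Sum>j<n. \<Sum>k<n. R j k *\<^sub>R m22 (y j) (y k)) \<in> rat_sq"
proof -
  define t where "t j k = (if j = k then 0 else \<bar>R j k\<bar> / 2)" for j k
  define q where "q j k = m22 (y j + sgn (R j k) *\<^sub>R y k) (y j + sgn (R j k) *\<^sub>R y k)" for j k
  define m where "m j = m22 (y j) (y j)" for j
  have e: "R j k *\<^sub>R m22 (y j) (y k) = (if j = k then R j j *\<^sub>R m j else 0) + t j k *\<^sub>R q j k - t j k *\<^sub>R m j - t j k *\<^sub>R m k" for j k
  proof (cases "j = k \<or> R j k = 0")
    case True
    then show ?thesis by (auto simp: t_def m_def)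
  next
    case False
    then have s: "sgn (R j k) * sgn (R j k) = 1" "\<bar>R j k\<bar> * sgn (R j k) = R j k"
      by (auto simp: sgn_real_def)
    have "q j k = m j + sgn (R j k) *\<^sub>R m22 (y j) (y k) + sgn (R j k) *\<^sub>R m22 (y j) (y k)
        + (sgn (R j k) * sgn (R j k)) *\<^sub>R m k"
      by (simp only: q_def m_def m22_simps m22_commute[of "y k" "y j"] scaleR_add_right scaleR_scaleR add.assoc)
    then have "q j k = m j + m k + (2 * sgn (R j k)) *\<^sub>R m22 (y j) (y k)"
      unfolding s(1) by (simp add: vec_eq_iff)
    moreover have "(\<bar>R j k\<bar> / 2) * (2 * sgn (R j k)) = R j k" using s(2) by simp
    ultimately show ?thesis using False by (simp add: t_def algebra_simps)
  qed
  have tsym: "t j k = t k j" for j k using R(2)[of j k] by (simp add: t_def)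
  have "(\<Sum>j<n. \<Sum>k<n. R j k *\<^sub>R m22 (y j) (y k)) =
      (\<Sum>j<n. R j j *\<^sub>R m j) + (\<Sum>j<n. \<Sum>k<n. t j k *\<^sub>R q j k) - (\<Sum>j<n. \<Sum>k<n. t j k *\<^sub>R m j) - (\<Sum>j<n. \<Sum>k<n. t j k *\<^sub>R m k)"
    unfolding e by (simp add: sum.distrib sum_subtractf sum.delta')
  also have "(\<Sum>j<n. \<Sum>k<n. t j k *\<^sub>R m k) = (\<Sum>j<n. \<Sum>k<n. t j k *\<^sub>R m j)"
    by (subst sum.swap) (simp add: tsym)
  also have "(\<Sum>j<n. R j j *\<^sub>R m j) + (\<Sum>j<n. \<Sum>k<n. t j k *\<^sub>R q j k) - (\<Sum>j<n. \<Sum>k<n. t j k *\<^sub>R m j) - (\<Sum>j<n. \<Sum>k<n. t j k *\<^sub>R m j)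
      = (\<Sum>j<n. (R j j - 2 * (\<Sum>k<n. t j k)) *\<^sub>R m j) + (\<Sum>j<n. \<Sum>k<n. t j k *\<^sub>R q j k)"
  proof -
    have "(R j j - 2 * (\<Sum>k<n. t j k)) *\<^sub>R m j = R j j *\<^sub>R m j - (\<Sum>k<n. t j k *\<^sub>R m j) - (\<Sum>k<n. t j k *\<^sub>R m j)" for j
      unfolding scaleR_sum_left[symmetric] by (simp add: vec_eq_iff algebra_simps)
    then have "(\<Sum>j<n. (R j j - 2 * (\<Sum>k<n. t j k)) *\<^sub>R m j) =
        (\<Sum>j<n. R j j *\<^sub>R m j) - (\<Sum>j<n. \<Sum>k<n. t j k *\<^sub>R m j) - (\<Sum>j<n. \<Sum>k<n. t j k *\<^sub>R m j)"
      by (simp only: sum_subtractf)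
    then show ?thesis by simp
  qed
  also have "\<dots> \<in> rat_sq"
  proof (intro rat_sq_add rat_sq_sum)
    fix j assume j: "j \<in> {..<n}"
    have "2 * (\<Sum>k<n. t j k) = (\<Sum>k<n. if j = k then 0 else \<bar>R j k\<bar>)"
      unfolding sum_distrib_left by (rule sum.cong) (auto simp: t_def)
    then have "2 * (\<Sum>k<n. t j k) \<le> R j j" using dom j by simp
    moreover have "R j j - 2 * (\<Sum>k<n. t j k) \<in> \<rat>"
      using R(1) by (intro Rats_diff Rats_mult Rats_sum) (auto simp: t_def)
    ultimately show "(R j j - 2 * (\<Sum>k<n. t j k)) *\<^sub>R m j \<in> rat_sq"
      unfolding m_def using y j by (intro rat_sq_scale) auto
    fix k assume k: "k \<in> {..<n}"
    have "sgn (R j k) \<in> \<rat>" by (simp add: sgn_real_def)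
    then show "t j k *\<^sub>R q j k \<in> rat_sq"
      unfolding q_def using y j k R(1) by (intro rat_sq_scale rat_vec_simps) (auto simp: t_def)
  qed
  finally show ?thesis .
qed

section \<open>Gradients of equations of the hypersurface\<close>

definition gradient :: "('v::finite, real) mpoly \<Rightarrow> real ^ 'v \<Rightarrow> real ^ 'v" where
  "gradient p x = (\<chi> m. mpoly_eval (mpoly_pderiv m p) (\<lambda>i. x $ i))"

lemma mpoly_eval_pderiv:
  fixes p :: "('v::finite, real) mpoly"
  assumes "finite K" "Poly_Mapping.keys p \<subseteq> K"
  shows "mpoly_eval (mpoly_pderiv v p) x =
    (\<Sum>m\<in>K. of_nat (Poly_Mapping.lookup m v) * Poly_Mapping.lookup p m *
      (\<Prod>w\<in>UNIV. x w ^ Poly_Mapping.lookup (m - Poly_Mapping.single v 1) w))"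
  unfolding mpoly_pderiv_def mpoly_eval_sum mpoly_eval_single using assms
  by (intro sum.mono_neutral_left) (auto simp: in_keys_iff)

lemma has_derivative_monomial:
  fixes z :: "real ^ 'v::finite"
  shows "((\<lambda>x. \<Prod>v\<in>UNIV. (x $ v) ^ Poly_Mapping.lookup m v) has_derivative
    (\<lambda>h. \<Sum>v\<in>UNIV. h $ v * (of_nat (Poly_Mapping.lookup m v) *
      (\<Prod>w\<in>UNIV. (z $ w) ^ Poly_Mapping.lookup (m - Poly_Mapping.single v 1) w)))) (at z)"
proof -
  have "((\<lambda>x :: real ^ 'v. (x $ v) ^ k) has_derivative (\<lambda>h. of_nat k * h $ v * (z $ v) ^ (k - 1))) (at z)" for v k
    by (rule has_derivative_power, rule bounded_linear_imp_has_derivative, rule bounded_linear_vec_nth)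
  then have "((\<lambda>x. \<Prod>v\<in>UNIV. (x $ v) ^ Poly_Mapping.lookup m v) has_derivative
    (\<lambda>h. \<Sum>v\<in>UNIV. of_nat (Poly_Mapping.lookup m v) * h $ v * (z $ v) ^ (Poly_Mapping.lookup m v - 1) *
      (\<Prod>w\<in>UNIV - {v}. (z $ w) ^ Poly_Mapping.lookup m w))) (at z)"
    by (intro has_derivative_prod)
  moreover have "(\<Prod>w\<in>UNIV. (z $ w) ^ Poly_Mapping.lookup (m - Poly_Mapping.single v 1) w) =
      (z $ v) ^ (Poly_Mapping.lookup m v - 1) * (\<Prod>w\<in>UNIV - {v}. (z $ w) ^ Poly_Mapping.lookup m w)" for v
    by (subst prod.remove[of _ v]) (auto simp: lookup_minus lookup_single when_def intro!: prod.cong)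
  ultimately show ?thesis by (simp add: mult_ac)
qed

lemma has_derivative_mpoly_eval:
  fixes z :: "real ^ 'v::finite"
  shows "((\<lambda>x. mpoly_eval p (\<lambda>i. x $ i)) has_derivative (\<lambda>h. gradient p z \<bullet> h)) (at z)"
proof -
  have "((\<lambda>x. \<Sum>m\<in>Poly_Mapping.keys p. Poly_Mapping.lookup p m * (\<Prod>v\<in>UNIV. (x $ v) ^ Poly_Mapping.lookup m v))
      has_derivative (\<lambda>h. \<Sum>m\<in>Poly_Mapping.keys p. Poly_Mapping.lookup p m *
        (\<Sum>v\<in>UNIV. h $ v * (of_nat (Poly_Mapping.lookup m v) *
      (\<Prod>w\<in>UNIV. (z $ w) ^ Poly_Mapping.lookup (m - Poly_Mapping.single v 1) w))))) (at z)"
    by (intro has_derivative_sum has_derivative_mult_right has_derivative_monomial)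
  moreover have "(\<Sum>m\<in>Poly_Mapping.keys p. Poly_Mapping.lookup p m *
        (\<Sum>v\<in>UNIV. h $ v * (of_nat (Poly_Mapping.lookup m v) *
      (\<Prod>w\<in>UNIV. (z $ w) ^ Poly_Mapping.lookup (m - Poly_Mapping.single v 1) w)))) = gradient p z \<bullet> h" for h
    unfolding gradient_def inner_vec_def
    by (simp add: mpoly_eval_pderiv[of "Poly_Mapping.keys p"] sum_distrib_left sum_distrib_right mult_ac)
      (rule sum.swap)
  ultimately show ?thesis by (simp add: mpoly_eval_def)
qed

lemma isCont_mpoly_eval: "isCont (\<lambda>x :: real ^ 'v::finite. mpoly_eval p (\<lambda>i. x $ i)) z"
  by (rule has_derivative_continuous[OF has_derivative_mpoly_eval])

definition vanishes_on_four_squares :: "(quartic_mon, real) mpoly \<Rightarrow> bool" where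
  "vanishes_on_four_squares G \<longleftrightarrow>
    (\<forall>x :: nat \<Rightarrow> real ^ quad_mon. mpoly_eval G (\<lambda>i. (\<Sum>j<4. m22 (x j) (x j)) $ i) = 0)"

text \<open>Replacing \<open>x i\<close> by \<open>x i + t u\<close> stays within sums of four
  squares, with initial velocity twice the product of \<open>x i\<close> and \<open>u\<close>. So
  the gradient is a functional annihilating the span of the \<open>x i\<close> times all
  quadrics.\<close>

lemma gradient_annihilates:
  fixes x :: "nat \<Rightarrow> real ^ quad_mon"
  assumes G: "vanishes_on_four_squares G" and i: "i < 4"
  shows "gradient G (\<Sum>j<4. m22 (x j) (x j)) \<bullet> m22 (x i) u = 0"
proof -
  define y where "y = (\<Sum>j<4. m22 (x j) (x j))"
  define \<gamma> where "\<gamma> t = y + ((2 * t) *\<^sub>R m22 (x i) u + t\<^sup>2 *\<^sub>R m22 u u)" for t :: real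
  have "\<gamma> t = (\<Sum>j<4. m22 ((x(i := x i + t *\<^sub>R u)) j) ((x(i := x i + t *\<^sub>R u)) j))" for t
  proof -
    have "m22 (x i + t *\<^sub>R u) (x i + t *\<^sub>R u) = m22 (x i) (x i) + ((2 * t) *\<^sub>R m22 (x i) u + t\<^sup>2 *\<^sub>R m22 u u)"
      by (simp add: m22_simps m22_commute[of u "x i"] vec_eq_iff power2_eq_square algebra_simps)
    moreover have "(\<Sum>j\<in>{..<4} - {i}. m22 ((x(i := x i + t *\<^sub>R u)) j) ((x(i := x i + t *\<^sub>R u)) j)) =
        (\<Sum>j\<in>{..<4} - {i}. m22 (x j) (x j))" by (rule sum.cong) auto
    ultimately show ?thesis
      using i by (simp add: \<gamma>_def y_def sum.remove[of "{..<4}" i])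
  qed
  then have z: "mpoly_eval G (\<lambda>k. \<gamma> t $ k) = 0" for t
    using G[unfolded vanishes_on_four_squares_def, rule_format, of "x(i := x i + t *\<^sub>R u)"] by presburger
  have "(\<gamma> has_derivative (\<lambda>s. (2 * s) *\<^sub>R m22 (x i) u)) (at 0)"
    unfolding \<gamma>_def by (auto intro!: derivative_eq_intros)
  moreover have "\<gamma> 0 = y" by (simp add: \<gamma>_def)
  ultimately have "((\<lambda>t. mpoly_eval G (\<lambda>k. \<gamma> t $ k)) has_derivative (\<lambda>s. gradient G y \<bullet> ((2 * s) *\<^sub>R m22 (x i) u))) (at 0)"
    using has_derivative_compose[of \<gamma> "\<lambda>s. (2 * s) *\<^sub>R m22 (x i) u" 0 UNIV, OF _ has_derivative_mpoly_eval[of G "\<gamma> 0"]]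
    by simp
  then have "((\<lambda>t :: real. 0) has_derivative (\<lambda>s. gradient G y \<bullet> ((2 * s) *\<^sub>R m22 (x i) u))) (at 0)"
    by (simp only: z)
  then have "(\<lambda>s. gradient G y \<bullet> ((2 * s) *\<^sub>R m22 (x i) u)) = (\<lambda>s. 0)"
    using has_derivative_unique has_derivative_const by blast
  from fun_cong[OF this, of 1] show ?thesis by (simp add: y_def)
qed

lemma Rats_prod: "(\<And>i. i \<in> A \<Longrightarrow> f i \<in> \<rat>) \<Longrightarrow> prod f A \<in> \<rat>"
  by (induction A rule: infinite_finite_induct) auto

lemma specialized_polynomial:
  fixes p :: "('v::finite, real) mpoly"
  assumes \<phi>: "rat_spec \<phi>" and x: "rat_vec x"
  shows "mpoly_eval (Poly_Mapping.map \<phi> p) (\<lambda>i. x $ i) = \<phi> (mpoly_eval p (\<lambda>i. x $ i))"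
    and "gradient (Poly_Mapping.map \<phi> p) x $ v = \<phi> (gradient p x $ v)"
proof -
  note \<phi>D = rat_specD[OF \<phi>]
  have l: "Poly_Mapping.lookup (Poly_Mapping.map \<phi> p) m = \<phi> (Poly_Mapping.lookup p m)" for m
    by (simp add: map.rep_eq when_def \<phi>D)
  have k: "Poly_Mapping.keys (Poly_Mapping.map \<phi> p) \<subseteq> Poly_Mapping.keys p"
    by (auto simp: in_keys_iff l \<phi>D)
  have pr: "(\<Prod>w\<in>UNIV. (x $ w) ^ e w) \<in> \<rat>" for e
    using x by (intro Rats_prod Rats_power) (simp add: rat_vec_def)
  show "mpoly_eval (Poly_Mapping.map \<phi> p) (\<lambda>i. x $ i) = \<phi> (mpoly_eval p (\<lambda>i. x $ i))"
    unfolding mpoly_eval_superset[OF finite_keys k] mpoly_eval_def[of p]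
    by (simp add: l rat_spec_sum[OF \<phi>] \<phi>D(4)[OF pr])
  have c: "\<phi> (real n * a * (\<Prod>w\<in>UNIV. (x $ w) ^ e w)) = real n * \<phi> a * (\<Prod>w\<in>UNIV. (x $ w) ^ e w)" for n a e
    by (simp add: \<phi>D(4)[OF pr] \<phi>D(3))
  show "gradient (Poly_Mapping.map \<phi> p) x $ v = \<phi> (gradient p x $ v)"
    unfolding gradient_def vec_lambda_beta mpoly_eval_pderiv[OF finite_keys k]
    unfolding mpoly_eval_pderiv[OF finite_keys order_refl, where p = p]
    by (simp only: l c rat_spec_sum[OF \<phi>])
qed

text \<open>At rational sums of four squares the new polynomial takes the value
  \<open>\<phi> 0 = 0\<close>; density and continuity give the rest.\<close>

lemma specialized_vanishes:
  assumes \<phi>: "rat_spec \<phi>" and F: "vanishes_on_four_squares F"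
  shows "vanishes_on_four_squares (Poly_Mapping.map \<phi> F)"
  unfolding vanishes_on_four_squares_def
proof
  fix x :: "nat \<Rightarrow> real ^ quad_mon"
  let ?G = "Poly_Mapping.map \<phi> F"
  have "\<exists>q. rat_vec q \<and> norm (q - x j) < 1 / real (Suc n)" for j n
    by (rule rat_vec_dense[of "1 / real (Suc n)" "x j"]) auto
  then have "\<forall>j. \<exists>q. \<forall>n. rat_vec (q n) \<and> norm (q n - x j) < 1 / real (Suc n)"
    by (intro allI choice) auto
  then obtain q where q: "\<forall>j n. rat_vec (q j n) \<and> norm (q j n - x j) < 1 / real (Suc n)"
    by (rule choice[THEN exE]) auto
  have "(\<lambda>n. q j n - x j) \<longlonglongrightarrow> 0" for j
    by (rule Lim_null_comparison[OF _ LIMSEQ_inverse_real_of_nat])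
      (use q in \<open>auto simp: inverse_eq_divide less_imp_le\<close>)
  then have "(\<lambda>n. q j n) \<longlonglongrightarrow> x j" for j by (simp add: LIM_zero_iff)
  then have "(\<lambda>n. m22 (q j n) (q j n)) \<longlonglongrightarrow> m22 (x j) (x j)" for j
    by (rule isCont_tendsto_compose[OF continuous_square])
  then have "(\<lambda>n. \<Sum>j<4. m22 (q j n) (q j n)) \<longlonglongrightarrow> (\<Sum>j<4. m22 (x j) (x j))"
    by (intro tendsto_sum)
  then have "(\<lambda>n. mpoly_eval ?G (\<lambda>i. (\<Sum>j<4. m22 (q j n) (q j n)) $ i)) \<longlonglongrightarrow>
      mpoly_eval ?G (\<lambda>i. (\<Sum>j<4. m22 (x j) (x j)) $ i)"
    by (rule isCont_tendsto_compose[OF isCont_mpoly_eval])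
  moreover have "mpoly_eval ?G (\<lambda>i. (\<Sum>j<4. m22 (q j n) (q j n)) $ i) = 0" for n
  proof -
    have "rat_vec (\<Sum>j<4. m22 (q j n) (q j n))" using q by (intro rat_vec_sum rat_vec_m22) auto
    from specialized_polynomial(1)[OF \<phi> this, of F] show ?thesis
      using F[unfolded vanishes_on_four_squares_def, rule_format, of "\<lambda>j. q j n"] rat_specD(6)[OF \<phi>] by presburger
  qed
  ultimately show "mpoly_eval ?G (\<lambda>i. (\<Sum>j<4. m22 (x j) (x j)) $ i) = 0"
    by (simp add: LIMSEQ_const_iff)
qed

section \<open>Representations in a rational kernel\<close>

lemma abs_sum_mult_bound:
  fixes a :: "nat \<Rightarrow> real"
  assumes "\<And>j. j < n \<Longrightarrow> \<bar>b j\<bar> \<le> e"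
  shows "\<bar>\<Sum>j<n. a j * b j\<bar> \<le> e * (\<Sum>j<n. \<bar>a j\<bar>)"
proof -
  have "\<bar>\<Sum>j<n. a j * b j\<bar> \<le> (\<Sum>j<n. \<bar>a j * b j\<bar>)" by (rule sum_abs)
  also have "\<dots> \<le> (\<Sum>j<n. e * \<bar>a j\<bar>)"
  proof (rule sum_mono)
    fix j assume "j \<in> {..<n}"
    then show "\<bar>a j * b j\<bar> \<le> e * \<bar>a j\<bar>"
      using mult_left_mono[OF assms[of j], of "\<bar>a j\<bar>"] by (simp add: abs_mult mult.commute)
  qed
  finally show ?thesis by (simp add: sum_distrib_left)
qed

lemma perturbed_identity_injective:
  fixes c :: "nat \<Rightarrow> real"
  assumes \<eta>: "\<And>i j. i < 4 \<Longrightarrow> j < (4 :: nat) \<Longrightarrow> \<bar>\<eta> i j\<bar> \<le> 1 / 100"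
    and c: "\<And>j. j < 4 \<Longrightarrow> c j + (\<Sum>i<4. c i * \<eta> i j) = 0" and j: "j < (4 :: nat)"
  shows "c j = 0"
proof -
  define S where "S = (\<Sum>i<4. \<bar>c i\<bar>)"
  have le: "\<bar>c k\<bar> \<le> 1 / 100 * S" if "k < 4" for k
    using abs_sum_mult_bound[of 4 "\<lambda>i. \<eta> i k" "1 / 100" c] \<eta> c[OF that] that by (auto simp: S_def)
  have "S \<le> (\<Sum>i<(4 :: nat). 1 / 100 * S)" unfolding S_def by (rule sum_mono) (use le in \<open>simp add: S_def\<close>)
  moreover have "S \<ge> 0" by (simp add: S_def sum_nonneg)
  ultimately have "S = 0" by simp
  with le[OF j] show ?thesis by simp
qed

text \<open>\<open>a\<close> is row \<open>i\<close> of the inverse of the perturbed identity. Its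
  absolute sum \<open>S\<close> satisfies \<open>S <= 1 + 4/100 * S\<close>, so
  \<open>S <= 100/96\<close>, and the deviation is at most \<open>S / 100\<close>.\<close>

lemma perturbed_identity_inverse:
  fixes a :: "nat \<Rightarrow> real"
  assumes \<eta>: "\<And>i j. i < 4 \<Longrightarrow> j < (4 :: nat) \<Longrightarrow> \<bar>\<eta> i j\<bar> \<le> 1 / 100"
    and a: "\<And>k. k < 4 \<Longrightarrow> a k + (\<Sum>j<4. a j * \<eta> j k) = (if i = k then 1 else 0)"
    and i: "i < 4" and k: "k < (4 :: nat)"
  shows "\<bar>a k - (if i = k then 1 else 0)\<bar> \<le> 1 / 96"
proof -
  define S where "S = (\<Sum>j<4. \<bar>a j\<bar>)"
  have b: "\<bar>\<Sum>j<4. a j * \<eta> j k\<bar> \<le> 1 / 100 * S" if "k < 4" for k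
    using abs_sum_mult_bound[of 4 "\<lambda>i. \<eta> i k" "1 / 100" a] \<eta> that by (auto simp: S_def)
  have "\<bar>a k\<bar> \<le> (if i = k then 1 else 0) + 1 / 100 * S" if "k < 4" for k
    using b[OF that] a[OF that] by (auto split: if_splits)
  then have "S \<le> (\<Sum>k<4. (if i = k then 1 else 0) + 1 / 100 * S)" unfolding S_def by (intro sum_mono) auto
  also have "\<dots> = 1 + 4 / 100 * S" using i by (simp add: sum.distrib)
  finally have "S \<le> 100 / 96" by simp
  moreover have "\<bar>a k - (if i = k then 1 else 0)\<bar> = \<bar>\<Sum>j<4. a j * \<eta> j k\<bar>"
    unfolding a[OF k, symmetric] by simp
  ultimately show ?thesis using b[OF k] by simp
qed

text \<open>For rational \<open>w\<close> the kernel is cut out by linear equations with rational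
  coefficients, which \<phi> respects.\<close>

lemma rat_spec_kernel:
  assumes w: "rat_vec w" and \<phi>: "rat_spec \<phi>" and x: "x \<in> ker w"
  shows "(\<chi> i. \<phi> (x $ i)) \<in> ker w"
proof -
  have B: "B w z y = (\<Sum>i\<in>UNIV. \<Sum>j\<in>UNIV. z $ i * y $ j * (w \<bullet> m22 (axis i 1) (axis j 1)))" for z y
    unfolding B_def by (subst m22_axes) (simp add: inner_sum_right)
  have r: "w \<bullet> m22 (axis i 1) (axis j 1) \<in> \<rat>" for i j
    using w rat_vec_m22[OF rat_vec_simps(5) rat_vec_simps(5), of i j] unfolding inner_vec_def rat_vec_def
    by (intro Rats_sum) (simp add: rat_vec_def)
  have "(\<Sum>i\<in>UNIV. x $ i * (w \<bullet> m22 (axis i 1) (axis j 1))) = 0" for j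
  proof -
    have "linear (\<lambda>z. m22 z (axis j 1))" using bilinear_m22 by (simp add: bilinear_def)
    note lin = linear_sum[OF this]
    have "B w x (axis j 1) = (\<Sum>i\<in>UNIV. x $ i * (w \<bullet> m22 (axis i 1) (axis j 1)))"
      by (subst (1) vec_axis_sum[of x]) (simp add: B_def lin m22_simps inner_sum_right)
    then show ?thesis using kerD(1)[OF x] by simp
  qed
  then have "\<phi> (\<Sum>i\<in>UNIV. x $ i * (w \<bullet> m22 (axis i 1) (axis j 1))) = 0" for j
    by (simp add: rat_specD[OF \<phi>])
  then have z: "(\<Sum>i\<in>UNIV. \<phi> (x $ i) * (w \<bullet> m22 (axis i 1) (axis j 1))) = 0" for j
    by (simp add: rat_spec_sum[OF \<phi>] rat_specD(4)[OF \<phi> r])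
  have "B w (\<chi> i. \<phi> (x $ i)) y = 0" for y
  proof -
    have "B w (\<chi> i. \<phi> (x $ i)) y = (\<Sum>j\<in>UNIV. y $ j * (\<Sum>i\<in>UNIV. \<phi> (x $ i) * (w \<bullet> m22 (axis i 1) (axis j 1))))"
      unfolding B by (subst sum.swap) (simp add: sum_distrib_left mult_ac)
    then show ?thesis by (simp add: z)
  qed
  then show ?thesis by (simp add: ker_def)
qed

text \<open>Independence of an indexed family, so that a repeated vector counts as a
  dependence.\<close>

definition free4 :: "(nat \<Rightarrow> 'a::real_vector) \<Rightarrow> bool" where
  "free4 x \<longleftrightarrow> (\<forall>c. (\<Sum>i<4. c i *\<^sub>R x i) = 0 \<longrightarrow> (\<forall>j<4. c j = 0))"

lemma free4D: "free4 x \<Longrightarrow> (\<Sum>i<4. c i *\<^sub>R x i) = 0 \<Longrightarrow> j < 4 \<Longrightarrow> c j = 0"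
  by (simp add: free4_def)

lemma independent_family_coords:
  fixes y :: "nat \<Rightarrow> real ^ quad_mon"
  assumes U: "subspace U" "dim U = 4" and y: "\<And>j. j < 4 \<Longrightarrow> y j \<in> U"
    and ind: "free4 y" and x: "x \<in> U"
  obtains a where "x = (\<Sum>j<4. a j *\<^sub>R y j)"
proof -
  let ?ys = "x # map y [0..<4]"
  have len: "length ?ys = Suc 4" by simp
  obtain d where d: "(\<Sum>i<length ?ys. d i *\<^sub>R ?ys ! i) = 0" "\<exists>i<length ?ys. d i \<noteq> 0"
    by (rule dependent_list[of U ?ys]) (use U x y in auto)
  have s: "d 0 *\<^sub>R x + (\<Sum>i<4. d (Suc i) *\<^sub>R y i) = 0"
    using d(1) unfolding len sum.lessThan_Suc_shift by simp
  have "d 0 \<noteq> 0"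
  proof
    assume 0: "d 0 = 0"
    then have "d (Suc j) = 0" if "j < 4" for j using free4D[OF ind, of "\<lambda>i. d (Suc i)" j] s that by simp
    then show False using d(2) 0 unfolding len by (metis less_Suc_eq_0_disj)
  qed
  have "d 0 *\<^sub>R x = - (\<Sum>i<4. d (Suc i) *\<^sub>R y i)" using s by (simp add: eq_neg_iff_add_eq_0)
  then have "x = (1 / d 0) *\<^sub>R (- (\<Sum>i<4. d (Suc i) *\<^sub>R y i))"
    using \<open>d 0 \<noteq> 0\<close> by (metis divide_self_if divideR_right inverse_eq_divide)
  also have "\<dots> = (\<Sum>j<4. (- d (Suc j) / d 0) *\<^sub>R y j)"
    by (simp add: scaleR_sum_right sum_negf)
  finally show ?thesis by (rule that)
qed

text \<open>Applying \<phi> to the coordinates of the \<open>x i\<close> gives rational vectors in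
  the same kernel, so close to the \<open>x i\<close> that the transition matrix is near the
  identity and can be inverted with control.\<close>

lemma rational_kernel_perturbation:
  fixes x :: "nat \<Rightarrow> real ^ quad_mon"
  assumes w: "rat_vec w" "dim (ker w) = 4" and x: "\<And>i. i < 4 \<Longrightarrow> x i \<in> ker w"
    and ind: "free4 x"
  obtains y a where "\<And>j. j < 4 \<Longrightarrow> rat_vec (y j)" "\<And>i. i < 4 \<Longrightarrow> x i = (\<Sum>j<4. a i j *\<^sub>R y j)"
    "\<And>i j. i < 4 \<Longrightarrow> j < 4 \<Longrightarrow> \<bar>a i j - (if i = j then 1 else 0)\<bar> \<le> 1 / 96"
proof -
  have sub: "subspace (ker w)" by (rule subspace_ker)
  have "\<exists>a. z \<in> ker w \<longrightarrow> z = (\<Sum>j<4. a j *\<^sub>R x j)" for z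
    using independent_family_coords[OF sub w(2) x ind, of z] by blast
  then obtain D where D: "z \<in> ker w \<Longrightarrow> z = (\<Sum>j<4. D z j *\<^sub>R x j)" for z
    using choice[of "\<lambda>z a. z \<in> ker w \<longrightarrow> z = (\<Sum>j<4. a j *\<^sub>R x j)"] by blast
  \<comment> \<open>On the kernel, coordinates in the basis \<open>x\<close> agree with linear
    functionals on the whole space, which are bounded.\<close>
  obtain K where K: "K > 0" "\<And>z j. z \<in> ker w \<Longrightarrow> j < 4 \<Longrightarrow> \<bar>D z j\<bar> \<le> K * norm z"
  proof -
    have inj: "inj_on x {..<4}"
    proof (rule inj_onI, rule ccontr)
      fix i j :: nat assume ij: "i \<in> {..<4}" "j \<in> {..<4}" "x i = x j" "i \<noteq> j"
      let ?c = "\<lambda>k. (if k = i then 1 else 0) - (if k = j then 1 else (0 :: real))"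
      have "(\<Sum>k<4. ?c k *\<^sub>R x k) = 0"
        using ij by (simp add: scaleR_diff_left sum_subtractf if_distrib[of "\<lambda>r. r *\<^sub>R _"] cong: if_cong)
      from free4D[OF ind this, of i] ij show False by simp
    qed
    have indep: "independent (x ` {..<4})"
    proof (rule ccontr)
      assume "\<not> independent (x ` {..<4})"
      then obtain u where u: "\<exists>v\<in>x ` {..<4}. u v \<noteq> 0" "(\<Sum>v\<in>x ` {..<4}. u v *\<^sub>R v) = 0"
        using dependent_finite[of "x ` {..<4}"] by auto
      have "(\<Sum>k<4. u (x k) *\<^sub>R x k) = 0" using u(2) by (simp add: sum.reindex[OF inj])
      from free4D[OF ind this] u(1) show False by auto
    qed
    have "\<forall>j. \<exists>g :: real ^ quad_mon \<Rightarrow> real. linear g \<and> (\<forall>k<4. g (x k) = (if k = j then 1 else 0))"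
    proof
      fix j
      obtain g :: "real ^ quad_mon \<Rightarrow> real" where g: "linear g"
        "\<forall>v\<in>x ` {..<4}. g v = (if the_inv_into {..<4} x v = j then 1 else 0)"
        using linear_independent_extend[OF indep, of "\<lambda>v. if the_inv_into {..<4} x v = j then 1 else 0"] by blast
      then show "\<exists>g :: real ^ quad_mon \<Rightarrow> real. linear g \<and> (\<forall>k<4. g (x k) = (if k = j then 1 else 0))"
        by (intro exI[of _ g]) (simp add: the_inv_into_f_f[OF inj])
    qed
    then obtain g where "\<forall>j. linear (g j) \<and> (\<forall>k<4. g j (x k) = (if k = j then 1 else (0 :: real)))"
      by (rule choice[THEN exE])
    then have g: "linear (g j)" "k < 4 \<Longrightarrow> g j (x k) = (if k = j then 1 else 0)" for j k by blast+
    have "\<forall>j. \<exists>K>0. \<forall>z. norm (g j z) \<le> K * norm z"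
      using linear_bounded_pos[OF g(1)] by blast
    then obtain K where "\<forall>j. K j > 0 \<and> (\<forall>z. norm (g j z) \<le> K j * norm z)"
      by (rule choice[THEN exE])
    then have K: "K j > 0" "norm (g j z) \<le> K j * norm z" for j z by blast+
    have Dg: "D z j = g j z" if "z \<in> ker w" "j < 4" for z j
    proof -
      have "g j z = (\<Sum>k<4. D z k * g j (x k))"
        by (subst D[OF that(1)]) (simp add: linear_sum[OF g(1)] linear_cmul[OF g(1)])
      also have "\<dots> = (\<Sum>k<4. if k = j then D z k else 0)" by (rule sum.cong) (auto simp: g(2))
      finally show ?thesis using that(2) by simp
    qed
    show ?thesis
    proof
      show "(\<Sum>j<4. K j) > 0" using K(1) by (intro sum_pos) (auto simp: lessThan_empty_iff)
      fix z and j :: nat assume z: "z \<in> ker w" "j < 4"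
      have "\<bar>D z j\<bar> \<le> K j * norm z" using K(2)[of j z] by (simp add: Dg[OF z])
      also have "\<dots> \<le> (\<Sum>j<4. K j) * norm z"
        using z(2) K(1) by (intro mult_right_mono member_le_sum) (auto simp: less_imp_le)
      finally show "\<bar>D z j\<bar> \<le> (\<Sum>j<4. K j) * norm z" .
    qed
  qed
  \<comment> \<open>The distance of \<open>y i\<close> from \<open>x i\<close> is at most the number
    of coordinates times \<open>e\<close>; multiplied by \<open>K\<close> this is 1/100.\<close>
  define e where "e = 1 / (100 * K * real CARD(quad_mon))"
  have e: "e > 0" using K(1) by (simp add: e_def)
  obtain \<phi> where \<phi>: "rat_spec \<phi>" "\<And>t. t \<in> (\<lambda>(i, m). x i $ m) ` ({..<4} \<times> UNIV) \<Longrightarrow> \<bar>\<phi> t - t\<bar> < e"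
    using rational_specialization[OF finite_imageI[OF finite_cartesian_product[OF finite_lessThan finite]] e] by blast
  define y where "y i = (\<chi> m. \<phi> (x i $ m))" for i
  have yk: "y i \<in> ker w" if "i < 4" for i
    unfolding y_def by (rule rat_spec_kernel[OF w(1) \<phi>(1) x[OF that]])
  define \<eta> where "\<eta> i j = D (y i - x i) j" for i j
  have \<eta>: "\<bar>\<eta> i j\<bar> \<le> 1 / 100" if "i < 4" "j < 4" for i j
  proof -
    have "norm (y i - x i) \<le> (\<Sum>m\<in>UNIV. \<bar>(y i - x i) $ m\<bar>)" by (rule norm_le_l1_cart)
    also have "\<dots> \<le> (\<Sum>m\<in>(UNIV :: quad_mon set). e)"
    proof (rule sum_mono)
      fix m
      have "x i $ m \<in> (\<lambda>(i, m). x i $ m) ` ({..<4} \<times> UNIV)"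
        using \<open>i < 4\<close> by (intro image_eqI[of _ _ "(i, m)"]) auto
      from \<phi>(2)[OF this] show "\<bar>(y i - x i) $ m\<bar> \<le> e" by (simp add: y_def)
    qed
    finally have "norm (y i - x i) \<le> 1 / (100 * K)" using K(1) by (simp add: e_def field_simps)
    moreover have "\<bar>\<eta> i j\<bar> \<le> K * norm (y i - x i)"
      unfolding \<eta>_def using K(2) subspace_diff[OF sub yk x] that by blast
    ultimately show ?thesis using K(1) by (simp add: field_simps)
  qed
  have yx: "y i = x i + (\<Sum>j<4. \<eta> i j *\<^sub>R x j)" if "i < 4" for i
    using D[OF subspace_diff[OF sub yk[OF that] x[OF that]]] by (simp add: \<eta>_def algebra_simps)
  have comb: "(\<Sum>i<4. c i *\<^sub>R y i) = (\<Sum>j<4. (c j + (\<Sum>i<4. c i * \<eta> i j)) *\<^sub>R x j)" for c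
  proof -
    have "(\<Sum>i<4. c i *\<^sub>R y i) = (\<Sum>i<4. c i *\<^sub>R x i) + (\<Sum>i<4. \<Sum>j<4. (c i * \<eta> i j) *\<^sub>R x j)"
      by (simp add: yx scaleR_add_right sum.distrib scaleR_sum_right)
    also have "(\<Sum>i<4. \<Sum>j<4. (c i * \<eta> i j) *\<^sub>R x j) = (\<Sum>j<4. (\<Sum>i<4. c i * \<eta> i j) *\<^sub>R x j)"
      by (subst sum.swap) (simp add: scaleR_sum_left)
    finally show ?thesis by (simp add: scaleR_left_distrib sum.distrib)
  qed
  have yind1: "c j = 0" if c: "(\<Sum>i<4. c i *\<^sub>R y i) = 0" "j < 4" for c j
  proof (rule perturbed_identity_injective[OF \<eta> _ c(2)])
    fix k :: nat assume "k < 4"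
    then show "c k + (\<Sum>i<4. c i * \<eta> i k) = 0" using free4D[OF ind c(1)[unfolded comb]] by blast
  qed
  have yind: "free4 y" using yind1 by (simp add: free4_def)
  have "\<exists>a. i < 4 \<longrightarrow> x i = (\<Sum>j<4. a j *\<^sub>R y j)" for i
    using independent_family_coords[OF sub w(2) yk yind, of "x i"] x by blast
  then obtain a where a: "\<And>i. i < 4 \<Longrightarrow> x i = (\<Sum>j<4. a i j *\<^sub>R y j)"
    using choice[of "\<lambda>i a. i < 4 \<longrightarrow> x i = (\<Sum>j<4. a j *\<^sub>R y j)"] by blast
  show ?thesis
  proof (rule that[of y a])
    show "rat_vec (y j)" for j using rat_specD(2)[OF \<phi>(1)] by (simp add: rat_vec_def y_def)
    show "x i = (\<Sum>j<4. a i j *\<^sub>R y j)" if "i < 4" for i using a that by blast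
    fix i j :: nat assume ij: "i < 4" "j < 4"
    show "\<bar>a i j - (if i = j then 1 else 0)\<bar> \<le> 1 / 96"
    proof (rule perturbed_identity_inverse[OF \<eta> _ ij])
      fix k :: nat assume k: "k < 4"
      let ?c = "\<lambda>k. a i k + (\<Sum>j<4. a i j * \<eta> j k) - (if i = k then 1 else 0)"
      have "(\<Sum>k<4. (a i k + (\<Sum>j<4. a i j * \<eta> j k)) *\<^sub>R x k) = x i"
        using a[OF ij(1)] comb[of "a i"] by simp
      moreover have "(\<Sum>k<4. (if i = k then 1 else (0 :: real)) *\<^sub>R x k) = x i"
        using ij(1) by (simp add: if_distrib[of "\<lambda>r. r *\<^sub>R _"] cong: if_cong)
      ultimately have "(\<Sum>k<4. ?c k *\<^sub>R x k) = 0" by (simp add: scaleR_diff_left sum_subtractf)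
      from free4D[OF ind this k] show "a i k + (\<Sum>j<4. a i j * \<eta> j k) = (if i = k then 1 else 0)" by simp
    qed
  qed
qed

text \<open>In the rational basis \<open>y\<close> the form has a real Gram matrix \<open>G\<close>
  near the identity. Applying \<phi> to its entries gives a rational matrix that still represents
  the form, because the form and the products of the \<open>y j\<close> are rational.\<close>

lemma rational_kernel_rational_squares:
  fixes x :: "nat \<Rightarrow> real ^ quad_mon"
  assumes w: "rat_vec w" "dim (ker w) = 4" and x: "\<And>i. i < 4 \<Longrightarrow> x i \<in> ker w"
    and ind: "free4 x"
    and r: "rat_vec (\<Sum>i<4. m22 (x i) (x i))"
  shows "(\<Sum>i<4. m22 (x i) (x i)) \<in> rat_sq"
proof -
  obtain y a where y: "\<And>j. j < 4 \<Longrightarrow> rat_vec (y j)" "\<And>i. i < 4 \<Longrightarrow> x i = (\<Sum>j<4. a i j *\<^sub>R y j)"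
    and a: "\<And>i j. i < 4 \<Longrightarrow> j < 4 \<Longrightarrow> \<bar>a i j - (if i = j then 1 else 0)\<bar> \<le> 1 / 96"
    by (rule rational_kernel_perturbation[OF w x ind]) blast+
  define G where "G j k = (\<Sum>i<4. a i j * a i k)" for j k
  have Gs: "G j k = G k j" for j k by (simp add: G_def mult.commute)
  have Gb: "\<bar>G j k - (if j = k then 1 else 0)\<bar> \<le> 1 / 40" if jk: "j < 4" "k < 4" for j k
  proof -
    define d where "d i j = a i j - (if i = j then 1 else 0)" for i j
    have d: "\<bar>d i j\<bar> \<le> 1 / 96" if "i < 4" "j < 4" for i j using a that by (simp add: d_def)
    have "a i j * a i k = d i j * d i k + (if i = j then d i k else 0) + (if i = k then d i j else 0)
        + (if i = j then (if j = k then 1 else 0) else 0)" for i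
      by (simp add: d_def algebra_simps)
    then have "G j k = (\<Sum>i<4. d i j * d i k) + d j k + d k j + (if j = k then 1 else 0)"
      using jk by (simp add: G_def sum.distrib)
    moreover
    \<comment> \<open>The four quadratic terms contribute at most 1/2304 and the two linear ones
      2/96, together less than 1/40.\<close>
    have "\<bar>\<Sum>i<4. d i j * d i k\<bar> \<le> (\<Sum>i<(4 :: nat). 1 / 96 * (1 / 96))"
      unfolding abs_mult using d jk
      by (intro order_trans[OF sum_abs] sum_mono, unfold abs_mult, intro mult_mono) auto
    then have "\<bar>\<Sum>i<4. d i j * d i k\<bar> \<le> 1 / 2304" by simp
    ultimately show ?thesis using d[OF jk] d[OF jk(2) jk(1)] by linarith
  qed
  have eq: "(\<Sum>i<4. m22 (x i) (x i)) = (\<Sum>j<4. \<Sum>k<4. G j k *\<^sub>R m22 (y j) (y k))"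
  proof -
    have "(\<Sum>i<4. m22 (x i) (x i)) = (\<Sum>i<4. \<Sum>j<4. \<Sum>k<4. (a i j * a i k) *\<^sub>R m22 (y j) (y k))"
      by (rule sum.cong) (simp_all add: y(2) m22_sum_sum)
    also have "\<dots> = (\<Sum>j<4. \<Sum>i<4. \<Sum>k<4. (a i j * a i k) *\<^sub>R m22 (y j) (y k))" by (rule sum.swap)
    also have "\<dots> = (\<Sum>j<4. \<Sum>k<4. \<Sum>i<4. (a i j * a i k) *\<^sub>R m22 (y j) (y k))"
      by (intro sum.cong refl sum.swap)
    finally show ?thesis by (simp add: G_def scaleR_sum_left)
  qed
  obtain \<phi> where \<phi>: "rat_spec \<phi>" "\<And>t. t \<in> (\<lambda>(j, k). G j k) ` ({..<4} \<times> {..<4}) \<Longrightarrow> \<bar>\<phi> t - t\<bar> < 1 / 40"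
    using rational_specialization[of "(\<lambda>(j, k). G j k) ` ({..<4} \<times> {..<4})" "1 / 40"] by auto
  define R where "R j k = \<phi> (G j k)" for j k
  \<comment> \<open>A tolerance of 1/20 suffices for dominance: the off-diagonal entries of a row
    sum to at most 4/20, while diagonal entries are at least 19/20.\<close>
  have Rb: "\<bar>R j k - (if j = k then 1 else 0)\<bar> \<le> 1 / 20" if jk: "j < 4" "k < 4" for j k
  proof -
    have "\<bar>R j k - G j k\<bar> < 1 / 40" unfolding R_def using jk by (intro \<phi>(2)) auto
    then show ?thesis using Gb[OF jk] by linarith
  qed
  have "(\<Sum>j<4. \<Sum>k<4. R j k *\<^sub>R m22 (y j) (y k)) \<in> rat_sq"
  proof (rule diagonally_dominant_rat_sq)
    show "R j k \<in> \<rat>" "R j k = R k j" for j k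
      using rat_specD(2)[OF \<phi>(1)] Gs[of j k] by (simp_all add: R_def)
    fix j :: nat assume j: "j < 4"
    have "(\<Sum>k<4. if j = k then 0 else \<bar>R j k\<bar>) \<le> (\<Sum>k<(4 :: nat). 1 / 20)"
      by (rule sum_mono) (use Rb[OF j] in \<open>fastforce split: if_splits\<close>)
    also have "\<dots> \<le> R j j" using Rb[OF j j] unfolding abs_le_iff by simp
    finally show "(\<Sum>k<4. if j = k then 0 else \<bar>R j k\<bar>) \<le> R j j" .
  qed (rule y(1))
  moreover have "(\<Sum>i<4. m22 (x i) (x i)) = (\<Sum>j<4. \<Sum>k<4. R j k *\<^sub>R m22 (y j) (y k))"
  proof (rule vec_eq_iff[THEN iffD2, rule_format])
    fix m
    have ry: "m22 (y j) (y k) $ m \<in> \<rat>" if "j < 4" "k < 4" for j k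
      using rat_vec_m22[OF y(1) y(1)] that by (simp add: rat_vec_def)
    have "(\<Sum>i<4. m22 (x i) (x i)) $ m \<in> \<rat>" using r by (simp add: rat_vec_def)
    from rat_specD(5)[OF \<phi>(1) this, symmetric]
    have "(\<Sum>i<4. m22 (x i) (x i)) $ m = \<phi> (\<Sum>j<4. \<Sum>k<4. G j k * m22 (y j) (y k) $ m)"
      unfolding eq by simp
    also have "\<dots> = (\<Sum>j<4. \<Sum>k<4. R j k * m22 (y j) (y k) $ m)"
      unfolding rat_spec_sum[OF \<phi>(1)] R_def
      by (intro sum.cong refl rat_specD(4)[OF \<phi>(1)] ry) auto
    finally show "(\<Sum>i<4. m22 (x i) (x i)) $ m = (\<Sum>j<4. \<Sum>k<4. R j k *\<^sub>R m22 (y j) (y k)) $ m" by simp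
  qed
  ultimately show ?thesis by simp
qed

section \<open>Rational forms that are not rational sums of squares\<close>

lemma eval_at_quartic_vec4: "eval_at_quartic G f = mpoly_eval G (\<lambda>m. vec4 f $ m)"
  by (simp add: eval_at_quartic_def coords_def)

lemma four_squares_in_variety:
  assumes "length ps = 4" "sos_rep f ps" shows "f \<in> four_squares_variety"
  using assms sos_rep_vec(1)[OF assms(2)]
  unfolding four_squares_variety_def zero_set_def vanishing_ideal_def by blast

lemma equation_vanishes:
  assumes "four_squares_variety = zero_set {F}" shows "vanishes_on_four_squares F"
  unfolding vanishes_on_four_squares_def
proof
  fix x :: "nat \<Rightarrow> real ^ quad_mon"
  let ?xs = "map x [0..<4]"
  have "pf (\<Sum>x\<leftarrow>?xs. m22 x x) \<in> zero_set {F}"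
    unfolding assms[symmetric] by (rule four_squares_in_variety[OF _ sos_rep_map_qf]) simp
  then have "mpoly_eval F (\<lambda>m. (\<Sum>x\<leftarrow>?xs. m22 x x) $ m) = 0"
    unfolding zero_set_def by (auto simp: eval_at_quartic_vec4)
  moreover have "(\<Sum>x\<leftarrow>?xs. m22 x x) = (\<Sum>j<4. m22 (x j) (x j))" unfolding sum_list_nth by simp
  ultimately show "mpoly_eval F (\<lambda>i. (\<Sum>j<4. m22 (x j) (x j)) $ i) = 0" by simp
qed

text \<open>At a regular point the gradient spans the line of functionals annihilating the kernel; a rational
  specialisation of the equation has a rational nonzero gradient, so the kernel is defined over the rationals.\<close>

lemma rational_boundary_regular:
  assumes f: "f \<in> boundary_Sigma4" "strictly_positive f" and r: "rat_vec (vec4 f)"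
    and F: "vanishes_on_four_squares F" and g: "gradient F (vec4 f) \<noteq> 0"
  shows "vec4 f \<in> rat_sq"
proof -
  obtain v where v: "psd v" "v \<noteq> 0" "dim (ker v) = 4" "ann (ker v) = span {v}"
    and sp: "\<And>xs. vec4 f = (\<Sum>x\<leftarrow>xs. m22 x x) \<Longrightarrow> span (set xs) = ker v"
    by (rule boundary_functional[OF f]) blast
  obtain ps where ps: "length ps = 4" "sos_rep f ps" using boundary_four_squares[OF f] by blast
  define xs where "xs = map (coords quad_exps) ps"
  define x where "x i = xs ! i" for i
  have len: "length xs = 4" using ps(1) by (simp add: xs_def)
  have rep: "vec4 f = (\<Sum>x\<leftarrow>xs. m22 x x)" using sos_rep_vec(2)[OF ps(2)] by (simp only: xs_def)
  have span: "span (set xs) = ker v" by (rule sp[OF rep])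
  have eq: "vec4 f = (\<Sum>i<4. m22 (x i) (x i))" unfolding rep sum_list_nth len x_def ..
  have set_xs: "set xs = x ` {..<4}" unfolding set_conv_nth len x_def by auto
  have "dim (ker v) \<le> card (set xs)" using span by (intro dim_le_card) auto
  moreover have "card (set xs) \<le> 4" using card_length[of xs] len by simp
  ultimately have c4: "card (set xs) = 4" using v(3) by simp
  then have inj: "inj_on x {..<4}" unfolding set_xs by (intro eq_card_imp_inj_on) auto
  have indep: "independent (x ` {..<4})"
    using c4 v(3) span span_superset[of "set xs"] unfolding set_xs by (intro card_le_dim_spanning[of _ "ker v"]) auto
  have free: "free4 x"
    unfolding free4_def
  proof (intro allI impI)
    fix c :: "nat \<Rightarrow> real" and j :: nat assume c: "(\<Sum>i<4. c i *\<^sub>R x i) = 0" "j < 4"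
    have "(\<Sum>z\<in>x ` {..<4}. c (the_inv_into {..<4} x z) *\<^sub>R z) = (\<Sum>i<4. c i *\<^sub>R x i)"
      unfolding sum.reindex[OF inj] by (rule sum.cong) (auto simp: the_inv_into_f_f[OF inj])
    then have "(\<Sum>z\<in>x ` {..<4}. c (the_inv_into {..<4} x z) *\<^sub>R z) = 0" using c(1) by simp
    then have "c (the_inv_into {..<4} x (x j)) = 0"
      using independentD[OF indep, of "x ` {..<4}" "\<lambda>z. c (the_inv_into {..<4} x z)" "x j"] c(2) by auto
    then show "c j = 0" using c(2) by (simp add: the_inv_into_f_f[OF inj])
  qed
  obtain m where m: "gradient F (vec4 f) $ m \<noteq> 0" using g by (auto simp: vec_eq_iff)
  \<comment> \<open>A nonzero coordinate moved by less than its absolute value stays nonzero, so the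
    specialised gradient does not vanish.\<close>
  obtain \<phi> where \<phi>: "rat_spec \<phi>"
    "\<And>t. t \<in> {gradient F (vec4 f) $ m} \<Longrightarrow> \<bar>\<phi> t - t\<bar> < \<bar>gradient F (vec4 f) $ m\<bar>"
    by (rule rational_specialization[of "{gradient F (vec4 f) $ m}" "\<bar>gradient F (vec4 f) $ m\<bar>"])
      (use m in auto)
  define w where "w = gradient (Poly_Mapping.map \<phi> F) (vec4 f)"
  have wm: "w $ n = \<phi> (gradient F (vec4 f) $ n)" for n
    unfolding w_def by (rule specialized_polynomial(2)[OF \<phi>(1) r])
  have wr: "rat_vec w" by (simp add: rat_vec_def wm rat_specD(2)[OF \<phi>(1)])
  have "w $ m \<noteq> 0" using \<phi>(2)[of "gradient F (vec4 f) $ m"] by (auto simp: wm)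
  then have w0: "w \<noteq> 0" by auto
  have "x i \<in> ker w" if "i < 4" for i
    using gradient_annihilates[OF specialized_vanishes[OF \<phi>(1) F] that, of x]
    by (simp add: ker_def B_def w_def eq)
  then have "set xs \<subseteq> ker w" unfolding set_xs by auto
  then have "ker v \<subseteq> ker w" using span span_minimal[OF _ subspace_ker] by metis
  then have "w \<in> span {v}" unfolding v(4)[symmetric] ann_iff_ker .
  then obtain c where c: "w = c *\<^sub>R v" by (auto simp: span_singleton)
  then have "ker w = ker v" using w0 by (auto simp: ker_def B_simps)
  then show ?thesis
    unfolding eq using rational_kernel_rational_squares[OF wr _ _ free] v(3) r[unfolded eq]
      span_superset[of "set xs"] span by (auto simp: set_xs)
qed

lemma not_rational_sos_singular:
  assumes f: "f \<in> Sigma4" "strictly_positive f" "rational_coeffs f" "\<not> rational_sos f"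
  shows "f \<in> boundary_Sigma4" "f \<in> four_squares_variety"
    "hypersurface_equation four_squares_variety F \<Longrightarrow> singular_point F f"
proof -
  have f4: "f \<in> forms 4" using f(1) Sigma4_subset by blast
  have pf: "pf (vec4 f) = f" using f4 by (rule i4.form_of_coords)
  have r: "rat_vec (vec4 f)" using f(3) by (simp add: rat_vec_def rational_coeffs_def coords_def)
  have not: "vec4 f \<notin> rat_sq" using rat_sq_rational_sos[of "vec4 f"] f(4) pf by auto
  show b: "f \<in> boundary_Sigma4"
    unfolding boundary_iff using f(1) interior_rational[OF _ r] not by blast
  show V: "f \<in> four_squares_variety"
    using boundary_four_squares[OF b f(2)] four_squares_in_variety by blast
  assume "hypersurface_equation four_squares_variety F"
  then have F: "four_squares_variety = zero_set {F}" by (simp add: hypersurface_equation_def)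
  have "gradient F (vec4 f) = 0"
    using rational_boundary_regular[OF b f(2) r equation_vanishes[OF F]] not by blast
  then have "eval_at_quartic (mpoly_pderiv m F) f = 0" for m
    unfolding eval_at_quartic_vec4 gradient_def vec_eq_iff by simp
  moreover have "eval_at_quartic F f = 0" using V unfolding F by (simp add: zero_set_def)
  ultimately show "singular_point F f" by (simp add: singular_point_def)
qed

theorem mainTheorem4:
  shows
    "(\<forall>f. f \<in> boundary_Sigma4 \<and> strictly_positive f \<longrightarrow>
        is_ray (normal_cone f) \<and>
        (\<forall>ps qs. sos_rep f ps \<and> sos_rep f qs \<longrightarrow> orthogonally_equivalent ps qs) \<and>
        (\<exists>ps. length ps = 4 \<and> sos_rep f ps) \<and>
        (\<forall>ps. length ps = 4 \<and> sos_rep f ps \<longrightarrow>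
          distinct ps \<and> independent (set ps) \<and>
          gorenstein_quotient (ideal_generated (set ps)) 4)) \<and>
     (\<forall>f. f \<in> Sigma4 \<and> strictly_positive f \<and> rational_coeffs f \<and> \<not> rational_sos f \<longrightarrow>
        f \<in> boundary_Sigma4 \<and>
        f \<in> four_squares_variety \<and>
        (\<forall>F. hypersurface_equation four_squares_variety F \<longrightarrow> singular_point F f))"
proof (intro conjI allI impI)
  fix f assume "f \<in> boundary_Sigma4 \<and> strictly_positive f"
  then have f: "f \<in> boundary_Sigma4" "strictly_positive f" by auto
  show "is_ray (normal_cone f)" by (rule boundary_functional[OF f])
  show "\<exists>ps. length ps = 4 \<and> sos_rep f ps" by (rule boundary_four_squares[OF f])
  fix ps
  show "orthogonally_equivalent ps qs" if "sos_rep f ps \<and> sos_rep f qs" for qs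
    using boundary_orthogonally_equivalent[OF f] that by blast
  assume "length ps = 4 \<and> sos_rep f ps"
  then show "distinct ps" "independent (set ps)" "gorenstein_quotient (ideal_generated (set ps)) 4"
    using boundary_gorenstein[OF f] by auto
next
  fix f assume "f \<in> Sigma4 \<and> strictly_positive f \<and> rational_coeffs f \<and> \<not> rational_sos f"
  then have f: "f \<in> Sigma4" "strictly_positive f" "rational_coeffs f" "\<not> rational_sos f" by auto
  show "f \<in> boundary_Sigma4" "f \<in> four_squares_variety"
    by (rule not_rational_sos_singular[OF f])+
  show "singular_point F f" if "hypersurface_equation four_squares_variety F" for F
    by (rule not_rational_sos_singular(3)[OF f that])
qed

end
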